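(* Let $\varepsilon>0$ be a constant. Let $G$ be a finite simple undirected graph with $n$ vertices, $m$ edges, maximum degree $\Delta$ and degeneracy $d$. Then JP-ADG computes a proper vertex coloring of $G$ in expected depth $$O\!\left(\log^2 n+\log\Delta\cdot\left(d\log n+\frac{\log d\,\log^2 n}{\log\log n}\right)\right)$$ and with $O(n+m)$ work in the CRCW setting.
   Context: Graphs are stored in adjacency-array (CSR) form. For $U\subseteq V$, $N_U(v)$ denotes the set of neighbors of $v$ lying in $U$. The degeneracy $d$ of $G$ is the smallest $s$ such that every nonempty induced subgraph of $G$ has a vertex of degree at most $s$. Cost model: a parallel computation is a directed acyclic graph (DAG) of constant-time operations; its work is the number of nodes and its depth is the length of the longest directed path. In the CRCW setting concurrent reads, concurrent writes and atomic read-modify-write operations (e.g. atomic decrement-and-fetch) to the same memory cell take $O(1)$ time. Summing (Reduce) or counting over an array of size $N$ takes $O(\log N)$ depth and $O(N)$ work. Constants hidden in $O(\cdot)$ may depend on $\varepsilon$. In asymptotic bounds, factors such as $\log n$, $\log\log n$, $\log\Delta$, $\log d$, $\Delta$, $d$ are read as $\max\{1,\cdot\}$. Algorithm ADG (parameter $\varepsilon$). Initialize $U=V$, $D[v]=\deg(v)$ for all $v$, $\ell=1$. While $U\neq\emptyset$: compute $\widehat\delta=\frac1{|U|}\sum_{v\in U}D[v]$; set $R=\{u\in U: D[u]\le(1+\varepsilon)\widehat\delta\}$; for all $v\in R$ and all $u\in N_U(v)$ in parallel, atomically decrement $D[u]$; set $U=U\setminus R$; set $\rho_{\mathrm{ADG}}(v)=\ell$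 for all $v\in R$ in parallel; set $\ell=\ell+1$. (So at the start of each iteration $D[v]$ is the degree of $v$ in $G[U]$ for $v\in U$.) The output is $\rho_{\mathrm{ADG}}$. Algorithm JP (Jones–Plassmann) with a priority function $\rho$ defining a total order on $V$: for each $v$ compute in parallel $pred[v]=\{u\in N(v):\rho(u)>\rho(v)\}$, $succ[v]=\{u\in N(v):\rho(u)<\rho(v)\}$ and a counter $count[v]=|pred[v]|$. In parallel, start coloring all vertices with $pred[v]=\emptyset$. Coloring $v$ means assigning it the smallest color in $\{1,\dots,|pred[v]|+1\}$ not used by any vertex of $pred[v]$; then, in parallel for all $u\in succ[v]$, atomically decrement $count[u]$, and color $u$ (recursively) if the counter becomes $0$. JP-ADG: run ADG, then run JP with the lexicographic priority $\rho=\langle\rho_{\mathrm{ADG}},\rho_{\mathrm R}\rangle$, where $\rho_{\mathrm R}$ is a uniformly random total order on $V$ (used to break ties). The expectation is over $\rho_{\mathrm R}$. *)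

theory Defs
  imports
    "HOL-Probability.Probability_Mass_Function"
    "HOL-Combinatorics.Permutations"
    "HOL-Library.Monad_Syntax"
begin

section \<open>Finite simple graphs on the vertex set \<open>{..<n}\<close>\<close>

definition simple_graph :: "nat \<Rightarrow> nat set set \<Rightarrow> bool" where
  "simple_graph n E \<longleftrightarrow> E \<subseteq> {{u, v} | u v. u < n \<and> v < n \<and> u \<noteq> v}"

definition nbrs :: "nat set set \<Rightarrow> nat set \<Rightarrow> nat \<Rightarrow> nat set" where
  "nbrs E U v = {u \<in> U. {u, v} \<in> E}"

definition vertex_degree :: "nat \<Rightarrow> nat set set \<Rightarrow> nat \<Rightarrow> nat" where
  "vertex_degree n E v = card (nbrs E {..<n} v)"

definition max_degree :: "nat \<Rightarrow> nat set set \<Rightarrow> nat" where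
  "max_degree n E = Max (insert 0 (vertex_degree n E ` {..<n}))"

definition degeneracy :: "nat \<Rightarrow> nat set set \<Rightarrow> nat" where
  "degeneracy n E =
    (LEAST s. \<forall>W. W \<noteq> {} \<and> W \<subseteq> {..<n} \<longrightarrow> (\<exists>v\<in>W. card (nbrs E W v) \<le> s))"

definition proper_coloring :: "nat \<Rightarrow> nat set set \<Rightarrow> (nat \<Rightarrow> nat) \<Rightarrow> bool" where
  "proper_coloring n E c \<longleftrightarrow>
    (\<forall>v<n. 1 \<le> c v) \<and> (\<forall>u<n. \<forall>v<n. {u, v} \<in> E \<longrightarrow> c u \<noteq> c v)"


section \<open>A fork-join language over a CRCW shared memory\<close>

text \<open>
  A program issues constant-time instructions: reading or writing one cell, atomic
  decrement-and-fetch on one cell, binary fork, and procedure call. The continuation of an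
  instruction performs only a bounded amount of arithmetic on registers. \<open>Fork p q k\<close> runs
  \<open>p\<close> and \<open>q\<close> in parallel, waits for both, and passes their results to \<open>k\<close>. Addresses have type
  \<open>'l\<close>; \<open>'c\<close> is the type of procedure names with their arguments.
\<close>

datatype ('l, 'c) prog =
    Ret nat
  | Read 'l "nat \<Rightarrow> ('l, 'c) prog"
  | Write 'l nat "('l, 'c) prog"
  | DecFetch 'l "nat \<Rightarrow> ('l, 'c) prog"
  | Fork "('l, 'c) prog" "('l, 'c) prog" "nat \<Rightarrow> nat \<Rightarrow> ('l, 'c) prog"
  | Call 'c "nat \<Rightarrow> ('l, 'c) prog"

primrec bind_prog :: "('l, 'c) prog \<Rightarrow> (nat \<Rightarrow> ('l, 'c) prog) \<Rightarrow> ('l, 'c) prog" where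
  "bind_prog (Ret x) f = f x"
| "bind_prog (Read l k) f = Read l (\<lambda>x. bind_prog (k x) f)"
| "bind_prog (Write l x p) f = Write l x (bind_prog p f)"
| "bind_prog (DecFetch l k) f = DecFetch l (\<lambda>x. bind_prog (k x) f)"
| "bind_prog (Fork p q k) f = Fork p q (\<lambda>x y. bind_prog (k x y) f)"
| "bind_prog (Call c k) f = Call c (\<lambda>x. bind_prog (k x) f)"

adhoc_overloading Monad_Syntax.bind \<rightleftharpoons> bind_prog

abbreviation read :: "'l \<Rightarrow> ('l, 'c) prog" where "read l \<equiv> Read l Ret"
abbreviation "write" :: "'l \<Rightarrow> nat \<Rightarrow> ('l, 'c) prog" where "write l x \<equiv> Write l x (Ret 0)"
abbreviation dec_fetch :: "'l \<Rightarrow> ('l, 'c) prog" where "dec_fetch l \<equiv> DecFetch l Ret"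
abbreviation call :: "'c \<Rightarrow> ('l, 'c) prog" where "call c \<equiv> Call c Ret"
abbreviation "when" :: "bool \<Rightarrow> ('l, 'c) prog \<Rightarrow> ('l, 'c) prog" where
  "when b p \<equiv> (if b then p else Ret 0)"

text \<open>
  Balanced binary-tree Reduce: run \<open>body i\<close> for all \<open>lo \<le> i < hi\<close> in parallel and combine the
  results with \<open>f\<close>, whose neutral element is \<open>z\<close>.
\<close>

function reduce ::
  "(nat \<Rightarrow> nat \<Rightarrow> nat) \<Rightarrow> nat \<Rightarrow> (nat \<Rightarrow> ('l, 'c) prog) \<Rightarrow> nat \<Rightarrow> nat \<Rightarrow> ('l, 'c) prog" where
  "reduce f z body lo hi =
    (if hi \<le> lo then Ret z
     else if hi = Suc lo then body lo
     else let mid = (lo + hi) div 2 in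
       Fork (reduce f z body lo mid) (reduce f z body mid hi) (\<lambda>x y. Ret (f x y)))"
  by pat_completeness auto
termination by (relation "Wellfounded.measure (\<lambda>(f, z, body, lo, hi). hi - lo)") auto

declare reduce.simps [simp del]

abbreviation parfor :: "nat \<Rightarrow> nat \<Rightarrow> (nat \<Rightarrow> ('l, 'c) prog) \<Rightarrow> ('l, 'c) prog" where
  "parfor lo hi body \<equiv> reduce (\<lambda>_ _. 0) 0 body lo hi"


section \<open>Executions and their computation DAGs\<close>

text \<open>
  A DAG \<open>(N, A)\<close> has nodes \<open>{..<N}\<close> and arcs \<open>A\<close>. Node \<open>0\<close> is the start of the computation;
  every other node is an executed instruction or the join of a fork, numbered in the order of
  execution. \<open>Run a p\<close> is a thread whose latest node is \<open>a\<close> and whose remaining program is \<open>p\<close>.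
\<close>

type_synonym dag = "nat \<times> (nat \<times> nat) set"

datatype ('l, 'c) thread =
    Run nat "('l, 'c) prog"
  | Join "('l, 'c) thread" "('l, 'c) thread" "nat \<Rightarrow> nat \<Rightarrow> ('l, 'c) prog"

type_synonym 'l mem = "'l \<Rightarrow> nat"
type_synonym ('l, 'c) state = "('l, 'c) thread \<times> 'l mem \<times> dag"

fun add_node :: "nat set \<Rightarrow> dag \<Rightarrow> dag" where
  "add_node P (N, A) = (Suc N, A \<union> P \<times> {N})"

text \<open>
  Threads interleave arbitrarily. Concurrent accesses to one cell are serialized in an arbitrary
  order but add no arcs to the DAG, so each of them costs one unit whatever the contention (CRCW).
\<close>

inductive step :: "('c \<Rightarrow> ('l, 'c) prog) \<Rightarrow> ('l, 'c) state \<Rightarrow> ('l, 'c) state \<Rightarrow> bool"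
  for \<Gamma> :: "'c \<Rightarrow> ('l, 'c) prog" where
  step_read:
    "step \<Gamma> (Run a (Read l k), m, g) (Run (fst g) (k (m l)), m, add_node {a} g)"
| step_write:
    "step \<Gamma> (Run a (Write l x p), m, g) (Run (fst g) p, m(l := x), add_node {a} g)"
| step_dec_fetch:
    "step \<Gamma> (Run a (DecFetch l k), m, g)
       (Run (fst g) (k (m l - 1)), m(l := m l - 1), add_node {a} g)"
| step_call:
    "step \<Gamma> (Run a (Call c k), m, g) (Run (fst g) (\<Gamma> c \<bind> k), m, add_node {a} g)"
| step_fork:
    "step \<Gamma> (Run a (Fork p q k), m, g)
       (Join (Run (fst g) p) (Run (fst g) q) k, m, add_node {a} g)"
| step_join:
    "step \<Gamma> (Join (Run a (Ret x)) (Run b (Ret y)) k, m, g)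
       (Run (fst g) (k x y), m, add_node {a, b} g)"
| step_left:
    "step \<Gamma> (s, m, g) (s', m', g') \<Longrightarrow> step \<Gamma> (Join s t k, m, g) (Join s' t k, m', g')"
| step_right:
    "step \<Gamma> (t, m, g) (t', m', g') \<Longrightarrow> step \<Gamma> (Join s t k, m, g) (Join s t' k, m', g')"

lemma step_work:
  assumes "step \<Gamma> s s'"
  shows "fst (snd (snd s')) = Suc (fst (snd (snd s)))"
proof -
  have add: "fst (add_node P g) = Suc (fst g)" for P and g :: dag
    by (cases g) simp
  show ?thesis
    using assms by induction (simp_all add: add)
qed

definition initial :: "('l, 'c) prog \<Rightarrow> 'l mem \<Rightarrow> ('l, 'c) state" where
  "initial p m = (Run 0 p, m, (1, {}))"

definition terminated :: "('c \<Rightarrow> ('l, 'c) prog) \<Rightarrow> ('l, 'c) state \<Rightarrow> bool" where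
  "terminated \<Gamma> s \<longleftrightarrow> (\<nexists>s'. step \<Gamma> s s')"

definition memory :: "('l, 'c) state \<Rightarrow> 'l mem" where
  "memory s = fst (snd s)"

definition dag_of :: "('l, 'c) state \<Rightarrow> dag" where
  "dag_of s = snd (snd s)"

definition work :: "dag \<Rightarrow> nat" where
  "work g = card {..<fst g}"

definition dag_path :: "dag \<Rightarrow> nat list \<Rightarrow> bool" where
  "dag_path g xs \<longleftrightarrow>
    xs \<noteq> [] \<and> set xs \<subseteq> {..<fst g} \<and> successively (\<lambda>a b. (a, b) \<in> snd g) xs"

definition depth :: "dag \<Rightarrow> nat" where
  "depth g = Max {length xs - 1 | xs. dag_path g xs}"


section \<open>Memory layout\<close>

text \<open>
  \<open>Off\<close>, \<open>Adj\<close> are the CSR arrays of the graph and \<open>RandPrio\<close> holds \<open>\<rho>\<^sub>R\<close>; these three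
  are the input. \<open>Active l i\<close> is the \<open>i\<close>-th vertex of \<open>U\<close> at the start of round \<open>l\<close>, and \<open>InU\<close>,
  \<open>InR\<close> are membership flags. \<open>InPred i\<close> and \<open>InSucc i\<close> say whether the neighbour in CSR slot
  \<open>i\<close> of a vertex \<open>v\<close> belongs to \<open>pred[v]\<close> resp. \<open>succ[v]\<close>, and \<open>NumPred v\<close> is \<open>|pred[v]|\<close>.
\<close>

datatype loc =
    Off nat | Adj nat | RandPrio nat
  | Deg nat | Active nat nat | InU nat | InR nat | LeftCount nat | AdgPrio nat
  | InPred nat | InSucc nat | NumPred nat | Count nat | Used nat nat | Color nat

datatype proc = AdgRound nat nat | ColorVertex nat

definition csr :: "nat \<Rightarrow> nat set set \<Rightarrow> loc mem \<Rightarrow> bool" where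
  "csr n E m \<longleftrightarrow>
    m (Off 0) = 0 \<and>
    (\<forall>v<n. m (Off (Suc v)) = m (Off v) + vertex_degree n E v \<and>
      bij_betw (\<lambda>i. m (Adj i)) {m (Off v)..<m (Off (Suc v))} (nbrs E {..<n} v))"


section \<open>ADG\<close>

definition adg_init :: "nat \<Rightarrow> (loc, proc) prog" where
  "adg_init n = parfor 0 n (\<lambda>v. do {
     a \<leftarrow> read (Off v);
     b \<leftarrow> read (Off (Suc v));
     write (Deg v) (b - a);
     write (InU v) 1;
     write (Active 1 v) v
   })"

text \<open>
  Compaction of \<open>U - R\<close> from \<open>Active l\<close> into \<open>Active (Suc l)\<close> by parallel prefix sums. The
  interval split at \<open>mid\<close> stores the number of survivors in its left half at \<open>LeftCount mid\<close>.
\<close>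

function count_active :: "nat \<Rightarrow> nat \<Rightarrow> nat \<Rightarrow> (loc, proc) prog" where
  "count_active l lo hi =
    (if hi \<le> lo then Ret 0
     else if hi = Suc lo then do {
       v \<leftarrow> read (Active l lo);
       r \<leftarrow> read (InR v);
       Ret (if r = 1 then 0 else 1)
     }
     else let mid = (lo + hi) div 2 in
       Fork (count_active l lo mid) (count_active l mid hi)
         (\<lambda>x y. do { write (LeftCount mid) x; Ret (x + y) }))"
  by pat_completeness auto
termination by (relation "Wellfounded.measure (\<lambda>(l, lo, hi). hi - lo)") auto

function scatter_active :: "nat \<Rightarrow> nat \<Rightarrow> nat \<Rightarrow> nat \<Rightarrow> (loc, proc) prog" where
  "scatter_active l base lo hi =
    (if hi \<le> lo then Ret 0
     else if hi = Suc lo then do {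
       v \<leftarrow> read (Active l lo);
       r \<leftarrow> read (InR v);
       when (r \<noteq> 1) (write (Active (Suc l) base) v)
     }
     else let mid = (lo + hi) div 2 in do {
       c \<leftarrow> read (LeftCount mid);
       Fork (scatter_active l base lo mid) (scatter_active l (base + c) mid hi) (\<lambda>_ _. Ret 0)
     })"
  by pat_completeness auto
termination by (relation "Wellfounded.measure (\<lambda>(l, base, lo, hi). hi - lo)") auto

declare count_active.simps [simp del] scatter_active.simps [simp del]

text \<open>Round \<open>l\<close> of the while loop, entered with \<open>|U| = k\<close>.\<close>

definition adg_round :: "real \<Rightarrow> nat \<Rightarrow> nat \<Rightarrow> (loc, proc) prog" where
  "adg_round \<epsilon> l k = when (k \<noteq> 0) (do {
     S \<leftarrow> reduce (+) 0 (\<lambda>i. do { v \<leftarrow> read (Active l i); read (Deg v) }) 0 k;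
     let \<delta> = real S / real k;
     parfor 0 k (\<lambda>i. do {
       v \<leftarrow> read (Active l i);
       d \<leftarrow> read (Deg v);
       write (InR v) (if real d \<le> (1 + \<epsilon>) * \<delta> then 1 else 0)
     });
     parfor 0 k (\<lambda>i. do {
       v \<leftarrow> read (Active l i);
       r \<leftarrow> read (InR v);
       when (r = 1) (do {
         a \<leftarrow> read (Off v);
         b \<leftarrow> read (Off (Suc v));
         parfor a b (\<lambda>j. do {
           u \<leftarrow> read (Adj j);
           x \<leftarrow> read (InU u);
           when (x = 1) (dec_fetch (Deg u))
         })
       })
     });
     parfor 0 k (\<lambda>i. do {
       v \<leftarrow> read (Active l i);
       r \<leftarrow> read (InR v);
       when (r = 1) (write (InU v) 0)
     });
     k' \<leftarrow> count_active l 0 k;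
     scatter_active l 0 0 k;
     parfor 0 k (\<lambda>i. do {
       v \<leftarrow> read (Active l i);
       r \<leftarrow> read (InR v);
       when (r = 1) (write (AdgPrio v) l)
     });
     call (AdgRound (Suc l) k')
   })"

definition adg :: "nat \<Rightarrow> (loc, proc) prog" where
  "adg n = do { adg_init n; call (AdgRound 1 n) }"


section \<open>JP with the priority \<open>\<langle>\<rho>\<^sub>A\<^sub>D\<^sub>G, \<rho>\<^sub>R\<rangle>\<close>\<close>

text \<open>Returns 1 if \<open>\<rho>(u) < \<rho>(v)\<close> and 0 otherwise.\<close>

definition prio_less :: "nat \<Rightarrow> nat \<Rightarrow> (loc, proc) prog" where
  "prio_less u v = do {
     a \<leftarrow> read (AdgPrio u);
     b \<leftarrow> read (AdgPrio v);
     x \<leftarrow> read (RandPrio u);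
     y \<leftarrow> read (RandPrio v);
     Ret (if a < b \<or> a = b \<and> x < y then 1 else 0)
   }"

definition jp_init :: "nat \<Rightarrow> (loc, proc) prog" where
  "jp_init n = parfor 0 n (\<lambda>v. do {
     a \<leftarrow> read (Off v);
     b \<leftarrow> read (Off (Suc v));
     p \<leftarrow> reduce (+) 0 (\<lambda>i. do {
       u \<leftarrow> read (Adj i);
       s \<leftarrow> prio_less u v;
       write (InSucc i) s;
       q \<leftarrow> prio_less v u;
       write (InPred i) q;
       Ret q
     }) a b;
     write (NumPred v) p;
     write (Count v) p
   })"

definition color_vertex :: "nat \<Rightarrow> (loc, proc) prog" where
  "color_vertex v = do {
     a \<leftarrow> read (Off v);
     b \<leftarrow> read (Off (Suc v));
     p \<leftarrow> read (NumPred v);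
     parfor 1 (p + 2) (\<lambda>c. write (Used v c) 0);
     parfor a b (\<lambda>i. do {
       q \<leftarrow> read (InPred i);
       when (q = 1) (do {
         u \<leftarrow> read (Adj i);
         c \<leftarrow> read (Color u);
         when (c \<le> p + 1) (write (Used v c) 1)
       })
     });
     c \<leftarrow> reduce min (p + 1) (\<lambda>c. do {
       x \<leftarrow> read (Used v c);
       Ret (if x = 0 then c else p + 1)
     }) 1 (p + 2);
     write (Color v) c;
     parfor a b (\<lambda>i. do {
       s \<leftarrow> read (InSucc i);
       when (s = 1) (do {
         u \<leftarrow> read (Adj i);
         x \<leftarrow> dec_fetch (Count u);
         when (x = 0) (call (ColorVertex u))
       })
     })
   }"

definition jp :: "nat \<Rightarrow> (loc, proc) prog" where
  "jp n = do {
     jp_init n;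
     parfor 0 n (\<lambda>v. do {
       p \<leftarrow> read (NumPred v);
       when (p = 0) (call (ColorVertex v))
     })
   }"


section \<open>JP-ADG\<close>

fun procs :: "real \<Rightarrow> proc \<Rightarrow> (loc, proc) prog" where
  "procs \<epsilon> (AdgRound l k) = adg_round \<epsilon> l k"
| "procs \<epsilon> (ColorVertex v) = color_vertex v"

definition jp_adg :: "nat \<Rightarrow> (loc, proc) prog" where
  "jp_adg n = do { adg n; jp n }"

text \<open>
  The state \<open>s\<close> is reached by some (possibly unfinished) execution of JP-ADG on the graph
  \<open>(n, E)\<close> when \<open>\<rho>\<^sub>R(v) = \<pi> v\<close>. Memory outside the input arrays is uninitialized.
  Every step adds a node (\<open>step_work\<close>), so a bound on the work of all reachable states excludes
  infinite executions.
\<close>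

definition jp_adg_reaches ::
  "real \<Rightarrow> nat \<Rightarrow> nat set set \<Rightarrow> (nat \<Rightarrow> nat) \<Rightarrow> (loc, proc) state \<Rightarrow> bool" where
  "jp_adg_reaches \<epsilon> n E \<pi> s \<longleftrightarrow>
    (\<exists>m. csr n E m \<and> (\<forall>v<n. m (RandPrio v) = \<pi> v) \<and>
      (step (procs \<epsilon>))\<^sup>*\<^sup>* (initial (jp_adg n) m) s)"

definition jp_adg_finishes ::
  "real \<Rightarrow> nat \<Rightarrow> nat set set \<Rightarrow> (nat \<Rightarrow> nat) \<Rightarrow> (loc, proc) state \<Rightarrow> bool" where
  "jp_adg_finishes \<epsilon> n E \<pi> s \<longleftrightarrow> jp_adg_reaches \<epsilon> n E \<pi> s \<and> terminated (procs \<epsilon>) s"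

text \<open>A total order on \<open>{..<n}\<close> is represented by the bijection that maps each vertex to its rank.\<close>

definition random_order :: "nat \<Rightarrow> (nat \<Rightarrow> nat) pmf" where
  "random_order n = pmf_of_set {\<pi>. \<pi> permutes {..<n}}"


section \<open>Asymptotic bounds\<close>

definition pos1 :: "real \<Rightarrow> real" where
  "pos1 x = max 1 x"

definition jp_adg_depth_bound :: "nat \<Rightarrow> nat \<Rightarrow> nat \<Rightarrow> real" where
  "jp_adg_depth_bound n \<Delta> d =
    (pos1 (ln n))\<^sup>2 +
    pos1 (ln \<Delta>) *
      (pos1 d * pos1 (ln n) + pos1 (ln d) * (pos1 (ln n))\<^sup>2 / pos1 (ln (ln n)))"

end

theory Submission
  imports Defs
begin

text \<open>
  Executions are abstracted to threads labelled with depths, and analysed in a concurrent program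
  logic in which each thread owns ghost tokens and work credits, so that one argument covers all
  interleavings. A round of ADG removes a constant fraction of the remaining vertices, so there are
  \<open>O(log n)\<close> rounds and their work is a geometric sum. In JP, the budget for coloring a vertex is
  released when its counter drops to zero, which happens once; the colors do not depend on the
  schedule, and the nesting of calls follows the priority-decreasing paths.

  A vertex has at most \<open>2 (1 + \<epsilon>) d\<close> neighbours in its own level, because the average degree of
  every induced subgraph is at most \<open>2 d\<close>. A path with \<open>k\<close> vertices in a level is decreasing under
  a random order with probability \<open>1 / k!\<close>, so by a union bound over the at most
  \<open>n (2 (1 + \<epsilon>) d)^k\<close> such paths no level contains a decreasing path with
  \<open>k = O(d + log d log n / log log n)\<close> vertices, except with probability at most \<open>1 / n\<close>.
\<close>

section \<open>Threads annotated with depths\<close>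

text \<open>The scheduler may depend on the random order, and it decides which of several racing
  threads performs the last decrement and hence makes the recursive call. Depth and work therefore
  cannot be read off a fixed computation tree. Both are bounded for each fixed order
  \<open>\<pi>\<close> and all schedules at once: depth by a function \<open>h\<close> on vertices
  that drops along every possible recursive call, work by credits that go to whichever thread wins
  the race. The order enters these bounds only through the height, so randomness is confined to a
  count of permutations.

  Levels are stacked on top of each other in the height, which costs the factor
  \<open>rounds\<close>. A failure probability of \<open>1 / n\<close> is small enough because the
  height never has to exceed \<open>n\<close>: failures add at most 1 to the expectation.

  To keep the DAG out of the logic, the node number carried by a thread is replaced by a depth
  label; a state of \<open>cstep\<close> then consists of threads and memory only.\<close>

inductive cstep ::
  "('c \<Rightarrow> ('l, 'c) prog) \<Rightarrow> ('l, 'c) thread \<times> 'l mem \<Rightarrow> ('l, 'c) thread \<times> 'l mem \<Rightarrow> bool"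
  for \<Gamma> :: "'c \<Rightarrow> ('l, 'c) prog" where
  cstep_read: "cstep \<Gamma> (Run a (Read l k), m) (Run (Suc a) (k (m l)), m)"
| cstep_write: "cstep \<Gamma> (Run a (Write l x p), m) (Run (Suc a) p, m(l := x))"
| cstep_dec_fetch:
    "cstep \<Gamma> (Run a (DecFetch l k), m) (Run (Suc a) (k (m l - 1)), m(l := m l - 1))"
| cstep_call: "cstep \<Gamma> (Run a (Call c k), m) (Run (Suc a) (\<Gamma> c \<bind> k), m)"
| cstep_fork:
    "cstep \<Gamma> (Run a (Fork p q k), m) (Join (Run (Suc a) p) (Run (Suc a) q) k, m)"
| cstep_join:
    "cstep \<Gamma> (Join (Run a (Ret x)) (Run b (Ret y)) k, m) (Run (Suc (max a b)) (k x y), m)"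
| cstep_left: "cstep \<Gamma> (s, m) (s', m') \<Longrightarrow> cstep \<Gamma> (Join s t k, m) (Join s' t k, m')"
| cstep_right: "cstep \<Gamma> (t, m) (t', m') \<Longrightarrow> cstep \<Gamma> (Join s t k, m) (Join s t' k, m')"

primrec thread_nodes :: "('l, 'c) thread \<Rightarrow> nat set" where
  "thread_nodes (Run a p) = {a}"
| "thread_nodes (Join s t k) = thread_nodes s \<union> thread_nodes t"

primrec relabel :: "(nat \<Rightarrow> nat) \<Rightarrow> ('l, 'c) thread \<Rightarrow> ('l, 'c) thread" where
  "relabel f (Run a p) = Run (f a) p"
| "relabel f (Join s t k) = Join (relabel f s) (relabel f t) k"

primrec max_label :: "('l, 'c) thread \<Rightarrow> nat" where
  "max_label (Run a p) = a"
| "max_label (Join s t k) = max (max_label s) (max_label t)"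

lemma relabel_cong: "(\<And>a. a \<in> thread_nodes t \<Longrightarrow> f a = g a) \<Longrightarrow> relabel f t = relabel g t"
  by (induction t) auto

lemma relabel_fresh: "thread_nodes t \<subseteq> {..<N} \<Longrightarrow> relabel (f(N := d)) t = relabel f t"
  by (rule relabel_cong) auto

text \<open>The fresh node becomes the latest node of some thread of the new state, so its label
  \<open>d\<close> is visible in \<open>max_label\<close>. Labels elsewhere are unaffected, because
  the nodes of untouched threads are older than \<open>fst g\<close>.\<close>

lemma step_imp_cstep:
  assumes "step \<Gamma> (t, m, g) (t', m', g')" and "thread_nodes t \<subseteq> {..<fst g}"
  shows "fst g' = Suc (fst g) \<and> thread_nodes t' \<subseteq> {..<Suc (fst g)} \<and>
    (\<exists>P d. snd g' = snd g \<union> P \<times> {fst g} \<and> P \<subseteq> {..<fst g} \<and> (\<forall>a\<in>P. f a < d) \<and>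
      d \<le> max_label (relabel (f(fst g := d)) t') \<and>
      cstep \<Gamma> (relabel f t, m) (relabel (f(fst g := d)) t', m'))"
  using assms
proof (induction "(t, m, g)" "(t', m', g')" arbitrary: t m g t' m' g' rule: step.induct)
  case (step_read a l k m g)
  then show ?case
    by (cases g) (auto intro!: exI[of _ "{a}"] exI[of _ "Suc (f a)"] cstep.intros)
next
  case (step_write a l x p m g)
  then show ?case
    by (cases g) (auto intro!: exI[of _ "{a}"] exI[of _ "Suc (f a)"] cstep.intros)
next
  case (step_dec_fetch a l k m g)
  show ?case
    using step_dec_fetch cstep.cstep_dec_fetch[of \<Gamma> "f a" l k m]
    by (cases g) (auto intro!: exI[of _ "{a}"] exI[of _ "Suc (f a)"])
next
  case (step_call a c k m g)
  then show ?case
    by (cases g) (auto intro!: exI[of _ "{a}"] exI[of _ "Suc (f a)"] cstep.intros)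
next
  case (step_fork a p q k m g)
  then show ?case
    by (cases g) (auto intro!: exI[of _ "{a}"] exI[of _ "Suc (f a)"] cstep.intros)
next
  case (step_join a x b y k m g)
  then show ?case
    by (cases g)
      (auto intro!: exI[of _ "{a, b}"] exI[of _ "Suc (max (f a) (f b))"] cstep.intros)
next
  case (step_left s m g s' m' g' t k)
  have fresh: "relabel (f(fst g := d)) t = relabel f t" for d
    using step_left(3) by (intro relabel_fresh) auto
  from step_left(2,3) obtain P d where
    *: "snd g' = snd g \<union> P \<times> {fst g}" "P \<subseteq> {..<fst g}" "\<forall>a\<in>P. f a < d"
      "d \<le> max_label (relabel (f(fst g := d)) s')"
      "cstep \<Gamma> (relabel f s, m) (relabel (f(fst g := d)) s', m')" by auto
  show ?case
    using step_left(2,3) * fresh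
    by (auto intro!: exI[of _ P] exI[of _ d] cstep.cstep_left)
next
  case (step_right t m g t' m' g' s k)
  have fresh: "relabel (f(fst g := d)) s = relabel f s" for d
    using step_right(3) by (intro relabel_fresh) auto
  from step_right(2,3) obtain P d where
    *: "snd g' = snd g \<union> P \<times> {fst g}" "P \<subseteq> {..<fst g}" "\<forall>a\<in>P. f a < d"
      "d \<le> max_label (relabel (f(fst g := d)) t')"
      "cstep \<Gamma> (relabel f t, m) (relabel (f(fst g := d)) t', m')" by auto
  show ?case
    using step_right(2,3) * fresh
    by (auto intro!: exI[of _ P] exI[of _ d] cstep.cstep_right)
qed

text \<open>
  The last conjunct turns a bound on the labels of all reachable threads into a bound on the depth
  of every node.
\<close>

lemma steps_imp_csteps:
  assumes "(step \<Gamma>)\<^sup>*\<^sup>* (initial p m0) (t, m, g)"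
  shows "\<exists>f n. fst g = Suc n \<and> thread_nodes t \<subseteq> {..<fst g} \<and>
    (cstep \<Gamma> ^^ n) (Run 0 p, m0) (relabel f t, m) \<and>
    (\<forall>(a, b)\<in>snd g. a < fst g \<and> b < fst g \<and> f a < f b) \<and>
    (\<forall>a<fst g. \<exists>n t' m'. (cstep \<Gamma> ^^ n) (Run 0 p, m0) (t', m') \<and> f a \<le> max_label t')"
  using assms
proof (induction "(t, m, g)" arbitrary: t m g rule: rtranclp_induct)
  case base
  then show ?case
    by (auto simp: initial_def intro!: exI[of _ "\<lambda>_. 0"] exI[of _ 0])
next
  case (step s t' m' g')
  obtain t m g where s: "s = (t, m, g)" by (cases s)
  from step(3)[OF s] obtain f n where f:
    "fst g = Suc n" "thread_nodes t \<subseteq> {..<fst g}"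
    "(cstep \<Gamma> ^^ n) (Run 0 p, m0) (relabel f t, m)"
    "\<forall>(a, b)\<in>snd g. a < fst g \<and> b < fst g \<and> f a < f b"
    "\<forall>a<fst g. \<exists>n t' m'. (cstep \<Gamma> ^^ n) (Run 0 p, m0) (t', m') \<and> f a \<le> max_label t'"
    by blast
  from step_imp_cstep[OF step(2)[unfolded s] f(2), of f] obtain P d where P:
    "fst g' = Suc (fst g)" "thread_nodes t' \<subseteq> {..<Suc (fst g)}"
    "snd g' = snd g \<union> P \<times> {fst g}" "P \<subseteq> {..<fst g}" "\<forall>a\<in>P. f a < d"
    "d \<le> max_label (relabel (f(fst g := d)) t')"
    "cstep \<Gamma> (relabel f t, m) (relabel (f(fst g := d)) t', m')"
    by blast
  let ?f = "f(fst g := d)"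
  have run: "(cstep \<Gamma> ^^ Suc n) (Run 0 p, m0) (relabel ?f t', m')"
    using f(3) P(7) by auto
  have arcs: "\<forall>(a, b)\<in>snd g'. a < fst g' \<and> b < fst g' \<and> ?f a < ?f b"
    using f(4) P(1,3,4,5) by fastforce
  have "\<exists>n t' m'. (cstep \<Gamma> ^^ n) (Run 0 p, m0) (t', m') \<and> ?f a \<le> max_label t'"
    if "a < fst g'" for a
  proof (cases "a = fst g")
    case True
    then show ?thesis using run P(6) by (metis fun_upd_same)
  next
    case False
    then show ?thesis using that P(1) f(5) by simp
  qed
  then show ?case
    using run arcs P(1,2) f(1) by (intro exI[of _ ?f] exI[of _ "Suc n"]) auto
qed

lemma depth_le:
  assumes "0 < fst g" and "\<forall>(a, b)\<in>snd g. f a < (f b :: nat)" and "\<And>a. a < fst g \<Longrightarrow> f a \<le> D"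
  shows "depth g \<le> D"
proof -
  have path: "f (hd xs) + (length xs - 1) \<le> f (last xs)"
    if "successively (\<lambda>a b. (a, b) \<in> snd g) xs" "xs \<noteq> []" for xs
    using that
  proof (induction xs rule: induct_list012)
    case (3 x y zs)
    then have "f x < f y" using assms(2) by auto
    with 3 show ?case by auto
  qed auto
  have le: "length xs - 1 \<le> D" if "dag_path g xs" for xs
    using path[of xs] assms(3)[of "last xs"] that
    by (fastforce simp: dag_path_def dest: last_in_set)
  have "dag_path g [0]" using assms(1) by (simp add: dag_path_def)
  then have "{length xs - 1 | xs. dag_path g xs} \<noteq> {}" by blast
  moreover have "{length xs - 1 | xs. dag_path g xs} \<subseteq> {..D}" using le by auto
  ultimately show ?thesis
    unfolding depth_def by (subst Max_le_iff) (auto intro: finite_subset)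
qed

text \<open>No instruction blocks, and a \<open>Join\<close> whose two sides have returned can step.
  A stuck state is thus a returned one, which turns \<open>terminated\<close> into a statement about
  results.\<close>

lemma not_terminal_imp_step:
  assumes "\<And>a x. t \<noteq> Run a (Ret x)"
  shows "\<exists>s'. step \<Gamma> (t, m, g) s'"
  using assms
proof (induction t arbitrary: m)
  case (Run a p)
  then show ?case by (cases p) (blast intro: step.intros)+
next
  case (Join s t k)
  consider a x b y where "s = Run a (Ret x)" "t = Run b (Ret y)"
    | "\<And>a x. s \<noteq> Run a (Ret x)" | "\<And>a x. t \<noteq> Run a (Ret x)" by blast
  then show ?case
  proof cases
    case 1
    then show ?thesis by (blast intro: step_join)
  next
    case 2
    then obtain s' where "step \<Gamma> (s, m, g) s'" using Join(1) by blast
    then show ?thesis by (cases s') (blast intro: step_left)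
  next
    case 3
    then obtain s' where "step \<Gamma> (t, m, g) s'" using Join(2) by blast
    then show ?thesis by (cases s') (blast intro: step_right)
  qed
qed

section \<open>A concurrent program logic with work and depth\<close>

text \<open>
  \<open>\<sigma>\<close> is the multiset of ghost tokens owned by the thread; the environment may change memory and
  its own tokens \<open>o\<close> as long as the invariant \<open>I\<close> holds of the memory and all tokens. \<open>w\<close> is the
  number of work credits owned by the thread, \<open>\<Phi>\<close> the number of credits stored in the invariant,
  and \<open>D\<close> bounds the depth of all nodes. Every step satisfies the guarantee \<open>G\<close>.
\<close>

coinductive safe ::
  "('c \<Rightarrow> ('l, 'c) prog) \<Rightarrow> ('l mem \<Rightarrow> 'r multiset \<Rightarrow> bool) \<Rightarrow> ('l mem \<Rightarrow> 'l mem \<Rightarrow> bool) \<Rightarrow>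
   ('r multiset \<Rightarrow> nat) \<Rightarrow> (nat \<Rightarrow> 'r multiset \<Rightarrow> bool) \<Rightarrow> nat \<Rightarrow>
   ('l, 'c) thread \<Rightarrow> 'r multiset \<Rightarrow> nat \<Rightarrow> bool"
  for \<Gamma> I G \<Phi> Q D where
  safeI:
    "\<lbrakk>max_label t \<le> D; \<And>a x. t = Run a (Ret x) \<Longrightarrow> Q x \<sigma>;
      \<And>m o' t' m'. I m (\<sigma> + o') \<Longrightarrow> cstep \<Gamma> (t, m) (t', m') \<Longrightarrow>
        \<exists>\<sigma>' w'. I m' (\<sigma>' + o') \<and> G m m' \<and> w' + \<Phi> (\<sigma>' + o') < w + \<Phi> (\<sigma> + o') \<and>
          safe \<Gamma> I G \<Phi> Q D t' \<sigma>' w'\<rbrakk>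
     \<Longrightarrow> safe \<Gamma> I G \<Phi> Q D t \<sigma> w"

lemma safe_max_label: "safe \<Gamma> I G \<Phi> Q D t \<sigma> w \<Longrightarrow> max_label t \<le> D"
  by (erule safe.cases) auto

lemma safe_Ret: "safe \<Gamma> I G \<Phi> Q D (Run a (Ret x)) \<sigma> w \<Longrightarrow> Q x \<sigma>"
  by (erule safe.cases) auto

lemma safe_step:
  assumes "safe \<Gamma> I G \<Phi> Q D t \<sigma> w" "I m (\<sigma> + o')" "cstep \<Gamma> (t, m) (t', m')"
  obtains \<sigma>' w' where "I m' (\<sigma>' + o')" "G m m'" "w' + \<Phi> (\<sigma>' + o') < w + \<Phi> (\<sigma> + o')"
    "safe \<Gamma> I G \<Phi> Q D t' \<sigma>' w'"
  using assms by (cases rule: safe.cases) blast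

text \<open>A form of coinduction in which the successor may leave the candidate set
  \<open>X\<close> for \<open>safe\<close> itself. It is needed when a thread passes over to a
  continuation that is already known to be safe.\<close>

lemma safe_coinduct:
  assumes "X t \<sigma> w"
    and final: "\<And>t \<sigma> w. X t \<sigma> w \<Longrightarrow> max_label t \<le> D"
      "\<And>a x \<sigma> w. X (Run a (Ret x)) \<sigma> w \<Longrightarrow> Q x \<sigma>"
    and step: "\<And>t \<sigma> w m o' t' m'. X t \<sigma> w \<Longrightarrow> I m (\<sigma> + o') \<Longrightarrow> cstep \<Gamma> (t, m) (t', m') \<Longrightarrow>
      \<exists>\<sigma>' w'. I m' (\<sigma>' + o') \<and> G m m' \<and> w' + \<Phi> (\<sigma>' + o') < w + \<Phi> (\<sigma> + o') \<and>
        (X t' \<sigma>' w' \<or> safe \<Gamma> I G \<Phi> Q D t' \<sigma>' w')"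
  shows "safe \<Gamma> I G \<Phi> Q D t \<sigma> w"
proof (rule safe.coinduct[where X = X])
  fix t \<sigma> w assume X: "X t \<sigma> w"
  have "\<forall>a x. t = Run a (Ret x) \<longrightarrow> Q x \<sigma>" using final(2) X by blast
  then show "\<exists>t' \<sigma>' w'. t = t' \<and> \<sigma> = \<sigma>' \<and> w = w' \<and> max_label t' \<le> D \<and>
      (\<forall>a x. t' = Run a (Ret x) \<longrightarrow> Q x \<sigma>') \<and>
      (\<forall>m o' t m'. I m (\<sigma>' + o') \<longrightarrow> cstep \<Gamma> (t', m) (t, m') \<longrightarrow>
        (\<exists>\<sigma> w. I m' (\<sigma> + o') \<and> G m m' \<and> w + \<Phi> (\<sigma> + o') < w' + \<Phi> (\<sigma>' + o') \<and>
          (X t \<sigma> w \<or> safe \<Gamma> I G \<Phi> Q D t \<sigma> w)))"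
    using final(1)[OF X] step[OF X]
    by (rule_tac exI[of _ t], rule_tac exI[of _ \<sigma>], rule_tac exI[of _ w], simp)
qed (fact assms(1))

lemma safe_mono:
  assumes "safe \<Gamma> I G \<Phi> Q D t \<sigma> w" "\<And>x \<sigma>. Q x \<sigma> \<Longrightarrow> Q' x \<sigma>" "D \<le> D'" "w \<le> w'"
  shows "safe \<Gamma> I G \<Phi> Q' D' t \<sigma> w'"
proof (rule safe_coinduct[where X = "\<lambda>t \<sigma> w'. \<exists>w\<le>w'. safe \<Gamma> I G \<Phi> Q D t \<sigma> w"])
  fix t \<sigma> w m o' t' m'
  assume "\<exists>w'\<le>w. safe \<Gamma> I G \<Phi> Q D t \<sigma> w'" and st: "I m (\<sigma> + o')" "cstep \<Gamma> (t, m) (t', m')"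
  then obtain v where v: "v \<le> w" "safe \<Gamma> I G \<Phi> Q D t \<sigma> v" by blast
  from v(2) st obtain \<sigma>' w' where "I m' (\<sigma>' + o')" "G m m'"
    "w' + \<Phi> (\<sigma>' + o') < v + \<Phi> (\<sigma> + o')" "safe \<Gamma> I G \<Phi> Q D t' \<sigma>' w'"
    by (rule safe_step)
  then show "\<exists>\<sigma>' w'. I m' (\<sigma>' + o') \<and> G m m' \<and> w' + \<Phi> (\<sigma>' + o') < w + \<Phi> (\<sigma> + o') \<and>
      ((\<exists>w\<le>w'. safe \<Gamma> I G \<Phi> Q D t' \<sigma>' w) \<or> safe \<Gamma> I G \<Phi> Q' D' t' \<sigma>' w')"
    using v(1) by (intro exI[of _ \<sigma>'] exI[of _ w']) auto
next
  fix t \<sigma> w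
  assume "\<exists>w'\<le>w. safe \<Gamma> I G \<Phi> Q D t \<sigma> w'"
  then show "max_label t \<le> D'"
    using assms(3) by (auto dest: safe_max_label)
next
  fix a x \<sigma> w
  assume "\<exists>w'\<le>w. safe \<Gamma> I G \<Phi> Q D (Run a (Ret x)) \<sigma> w'"
  then show "Q' x \<sigma>" using assms(2) by (auto dest: safe_Ret)
qed (use assms in blast)

text \<open>Frame rule: while the thread runs, \<open>r\<close> is counted among the tokens of the
  environment, which no step of the thread changes.\<close>

lemma safe_frame:
  assumes "safe \<Gamma> I G \<Phi> Q D t \<sigma> w"
  shows "safe \<Gamma> I G \<Phi> (\<lambda>x \<sigma>'. \<exists>\<sigma>0. \<sigma>' = \<sigma>0 + r \<and> Q x \<sigma>0) D t (\<sigma> + r) w"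
proof (rule safe_coinduct[where X = "\<lambda>t \<sigma>' w. \<exists>\<sigma>. \<sigma>' = \<sigma> + r \<and> safe \<Gamma> I G \<Phi> Q D t \<sigma> w"])
  fix t \<sigma>' w m o' t' m'
  assume "\<exists>\<sigma>. \<sigma>' = \<sigma> + r \<and> safe \<Gamma> I G \<Phi> Q D t \<sigma> w"
    and st: "I m (\<sigma>' + o')" "cstep \<Gamma> (t, m) (t', m')"
  then obtain \<sigma> where \<sigma>: "\<sigma>' = \<sigma> + r" "safe \<Gamma> I G \<Phi> Q D t \<sigma> w" by blast
  have "I m (\<sigma> + (r + o'))" using st(1) \<sigma>(1) by (simp add: add.assoc)
  from \<sigma>(2) this st(2) obtain \<sigma>2 w' where "I m' (\<sigma>2 + (r + o'))" "G m m'"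
    "w' + \<Phi> (\<sigma>2 + (r + o')) < w + \<Phi> (\<sigma> + (r + o'))" "safe \<Gamma> I G \<Phi> Q D t' \<sigma>2 w'"
    by (rule safe_step)
  then show "\<exists>\<sigma>2 w'. I m' (\<sigma>2 + o') \<and> G m m' \<and> w' + \<Phi> (\<sigma>2 + o') < w + \<Phi> (\<sigma>' + o') \<and>
      ((\<exists>\<sigma>. \<sigma>2 = \<sigma> + r \<and> safe \<Gamma> I G \<Phi> Q D t' \<sigma> w') \<or>
        safe \<Gamma> I G \<Phi> (\<lambda>x \<sigma>'. \<exists>\<sigma>0. \<sigma>' = \<sigma>0 + r \<and> Q x \<sigma>0) D t' \<sigma>2 w')"
    using \<sigma>(1) by (intro exI[of _ "\<sigma>2 + r"] exI[of _ w']) (auto simp: add.assoc)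
qed (use assms in \<open>auto dest: safe_max_label safe_Ret\<close>)

text \<open>The two sides of a \<open>Join\<close> return to that join, so a continuation is
  appended at the root only.\<close>

primrec bind_thread ::
  "('l, 'c) thread \<Rightarrow> (nat \<Rightarrow> ('l, 'c) prog) \<Rightarrow> ('l, 'c) thread" where
  "bind_thread (Run a p) f = Run a (p \<bind> f)"
| "bind_thread (Join s t k) f = Join s t (\<lambda>x y. k x y \<bind> f)"

lemma bind_prog_assoc: "(p \<bind> f) \<bind> g = p \<bind> (\<lambda>x. f x \<bind> g)" for p :: "('l, 'c) prog"
  by (induction p) (auto intro!: ext)

lemma max_label_bind_thread [simp]: "max_label (bind_thread t f) = max_label t"
  by (cases t) auto

lemma cstep_bind_thread:
  assumes "cstep \<Gamma> (bind_thread t f, m) (t', m')" "\<And>a x. t \<noteq> Run a (Ret x)"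
  shows "\<exists>t1. t' = bind_thread t1 f \<and> cstep \<Gamma> (t, m) (t1, m')"
proof (cases t)
  case (Run a p)
  show ?thesis
  proof (cases p)
    case (Ret x)
    then show ?thesis using Run assms(2) by simp
  next
    case (Fork q1 q2 k)
    then show ?thesis
      using assms(1) Run
      by (auto elim!: cstep.cases[of \<Gamma> "(Run _ _, _)"] intro: cstep.intros
          intro!: exI[of _ "Join _ _ _"])
  qed (use assms(1) Run in
      \<open>auto elim!: cstep.cases[of \<Gamma> "(Run _ _, _)"] intro: cstep.cstep_dec_fetch[simplified] cstep.intros
        simp: bind_prog_assoc intro!: exI[of _ "Run _ _"]\<close>)
next
  case (Join t1 t2 k)
  with assms(1) have "cstep \<Gamma> (Join t1 t2 (\<lambda>x y. k x y \<bind> f), m) (t', m')" by simp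
  then show ?thesis
  proof cases
    case (cstep_join a x b y)
    then show ?thesis
      using Join by (auto intro!: exI[of _ "Run _ _"] cstep.intros)
  next
    case (cstep_left s')
    then show ?thesis
      using Join by (auto intro!: exI[of _ "Join _ _ _"] cstep.intros)
  next
    case (cstep_right s')
    then show ?thesis
      using Join by (auto intro!: exI[of _ "Join _ _ _"] cstep.cstep_right)
  qed
qed

text \<open>Passing from \<open>Ret x\<close> to the continuation is not a step of the machine, so
  the two work budgets add up without an extra unit.\<close>

lemma safe_bind:
  assumes "safe \<Gamma> I G \<Phi> Q1 D1 t \<sigma> w1" "D1 \<le> D"
    and cont: "\<And>a x \<sigma>'. Q1 x \<sigma>' \<Longrightarrow> a \<le> D1 \<Longrightarrow> safe \<Gamma> I G \<Phi> Q D (Run a (f x)) \<sigma>' w2"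
  shows "safe \<Gamma> I G \<Phi> Q D (bind_thread t f) \<sigma> (w1 + w2)"
proof -
  define X where "X \<equiv> \<lambda>t' \<sigma> w. \<exists>t w1. t' = bind_thread t f \<and> w = w1 + w2 \<and>
    safe \<Gamma> I G \<Phi> Q1 D1 t \<sigma> w1"
  have fin: "safe \<Gamma> I G \<Phi> Q D (Run a (f x)) \<sigma> (w1 + w2)"
    if "safe \<Gamma> I G \<Phi> Q1 D1 (Run a (Ret x)) \<sigma> w1" for a x \<sigma> w1
    using safe_Ret[OF that] safe_max_label[OF that]
    by (rule_tac safe_mono[OF cont[of x \<sigma> a]]) auto
  have st: "\<exists>\<sigma>' w'. I m' (\<sigma>' + o') \<and> G m m' \<and> w' + \<Phi> (\<sigma>' + o') < w + \<Phi> (\<sigma> + o') \<and>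
        (X t' \<sigma>' w' \<or> safe \<Gamma> I G \<Phi> Q D t' \<sigma>' w')"
    if X: "X t0 \<sigma> w" and I: "I m (\<sigma> + o')" and c: "cstep \<Gamma> (t0, m) (t', m')"
    for t0 \<sigma> w m o' t' m'
  proof -
    from X obtain t w1 where t0: "t0 = bind_thread t f" "w = w1 + w2"
      and s: "safe \<Gamma> I G \<Phi> Q1 D1 t \<sigma> w1" unfolding X_def by blast
    show ?thesis
    proof (cases "\<exists>a x. t = Run a (Ret x)")
      case True
      then obtain a x where t: "t = Run a (Ret x)" by blast
      have "cstep \<Gamma> (Run a (f x), m) (t', m')" using c t0 t by simp
      from safe_step[OF fin[OF s[unfolded t]] I this] show ?thesis
        using t0(2) by blast
    next
      case False
      with cstep_bind_thread[of \<Gamma> t f m t' m'] c t0 obtain t1 where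
        t1: "t' = bind_thread t1 f" "cstep \<Gamma> (t, m) (t1, m')" by blast
      from s I t1(2) obtain \<sigma>' w' where "I m' (\<sigma>' + o')" "G m m'"
        "w' + \<Phi> (\<sigma>' + o') < w1 + \<Phi> (\<sigma> + o')" "safe \<Gamma> I G \<Phi> Q1 D1 t1 \<sigma>' w'"
        by (rule safe_step)
      then show ?thesis
        using t1(1) t0(2) unfolding X_def by (intro exI[of _ \<sigma>'] exI[of _ "w' + w2"]) auto
    qed
  qed
  have lab: "max_label t \<le> D" if "X t \<sigma> w" for t \<sigma> w
    using that assms(2) safe_max_label unfolding X_def by (fastforce intro: order.trans)
  have ret: "Q x \<sigma>" if "X (Run a (Ret x)) \<sigma> w" for a x \<sigma> w
  proof -
    from that obtain t w1 where t: "Run a (Ret x) = bind_thread t f"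
      and s: "safe \<Gamma> I G \<Phi> Q1 D1 t \<sigma> w1" unfolding X_def by blast
    from t obtain y where y: "t = Run a (Ret y)" "f y = Ret x"
      by (cases t; cases "case t of Run a p \<Rightarrow> p | Join _ _ _ \<Rightarrow> Ret 0") auto
    show ?thesis using safe_Ret[OF fin[OF s[unfolded y(1)], unfolded y(2)]] .
  qed
  have "X (bind_thread t f) \<sigma> (w1 + w2)" using assms(1) unfolding X_def by blast
  then show ?thesis by (rule safe_coinduct[where X = X, OF _ lab ret st])
qed

text \<open>Each side runs with the tokens of the other counted as environment. The additional unit
  of work pays for the join node; its label \<open>Suc (max a b)\<close> explains
  \<open>Suc D1\<close> and \<open>D1 < D\<close>.\<close>

lemma safe_Join:
  assumes "safe \<Gamma> I G \<Phi> Q1 D1 s \<sigma>1 w1" "safe \<Gamma> I G \<Phi> Q2 D1 t \<sigma>2 w2"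
    and G: "\<And>m. G m m" and "D1 < D"
    and cont: "\<And>a x y \<sigma>1 \<sigma>2. Q1 x \<sigma>1 \<Longrightarrow> Q2 y \<sigma>2 \<Longrightarrow> a \<le> Suc D1 \<Longrightarrow>
      safe \<Gamma> I G \<Phi> Q D (Run a (k x y)) (\<sigma>1 + \<sigma>2) w3"
  shows "safe \<Gamma> I G \<Phi> Q D (Join s t k) (\<sigma>1 + \<sigma>2) (Suc (w1 + w2 + w3))"
proof -
  define X where "X \<equiv> \<lambda>t' \<sigma>' w'. \<exists>s t \<sigma>1 \<sigma>2 w1 w2. t' = Join s t k \<and> \<sigma>' = \<sigma>1 + \<sigma>2 \<and>
      w' = Suc (w1 + w2 + w3) \<and> safe \<Gamma> I G \<Phi> Q1 D1 s \<sigma>1 w1 \<and> safe \<Gamma> I G \<Phi> Q2 D1 t \<sigma>2 w2"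
  have st: "\<exists>\<sigma>' w'. I m' (\<sigma>' + o') \<and> G m m' \<and> w' + \<Phi> (\<sigma>' + o') < w + \<Phi> (\<sigma> + o') \<and>
      (X t' \<sigma>' w' \<or> safe \<Gamma> I G \<Phi> Q D t' \<sigma>' w')"
    if X: "X t0 \<sigma> w" and I0: "I m (\<sigma> + o')" and c: "cstep \<Gamma> (t0, m) (t', m')"
    for t0 \<sigma> w m o' t' m'
  proof -
    from X obtain s t \<sigma>1 \<sigma>2 w1 w2 where X: "t0 = Join s t k" "\<sigma> = \<sigma>1 + \<sigma>2"
      "w = Suc (w1 + w2 + w3)" and
      s: "safe \<Gamma> I G \<Phi> Q1 D1 s \<sigma>1 w1" and t: "safe \<Gamma> I G \<Phi> Q2 D1 t \<sigma>2 w2"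
      unfolding X_def by blast
    have I: "I m (\<sigma>1 + \<sigma>2 + o')" using I0 X(2) by simp
    from c[unfolded X(1)] show ?thesis
    proof cases
      case (cstep_join a x b y)
      have "a \<le> D1" "b \<le> D1" "Q1 x \<sigma>1" "Q2 y \<sigma>2"
        using safe_max_label[OF s] safe_max_label[OF t] s t cstep_join
        by (auto dest: safe_Ret)
      then have "safe \<Gamma> I G \<Phi> Q D (Run (Suc (max a b)) (k x y)) (\<sigma>1 + \<sigma>2) w3"
        by (intro cont) auto
      then show ?thesis
        using cstep_join I G X by (intro exI[of _ "\<sigma>1 + \<sigma>2"] exI[of _ w3]) auto
    next
      case (cstep_left s')
      have "I m (\<sigma>1 + (\<sigma>2 + o'))" using I by (simp add: add.assoc)
      from s this cstep_left(2) obtain \<sigma>' w' where l: "I m' (\<sigma>' + (\<sigma>2 + o'))" "G m m'"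
        "w' + \<Phi> (\<sigma>' + (\<sigma>2 + o')) < w1 + \<Phi> (\<sigma>1 + (\<sigma>2 + o'))" "safe \<Gamma> I G \<Phi> Q1 D1 s' \<sigma>' w'"
        by (rule safe_step)
      have "X t' (\<sigma>' + \<sigma>2) (Suc (w' + w2 + w3))"
        using cstep_left(1) t l(4) unfolding X_def by blast
      then show ?thesis
        using l X by (intro exI[of _ "\<sigma>' + \<sigma>2"] exI[of _ "Suc (w' + w2 + w3)"])
          (auto simp: add.assoc)
    next
      case (cstep_right t1)
      have "I m (\<sigma>2 + (\<sigma>1 + o'))" using I by (simp add: add_ac)
      from t this cstep_right(2) obtain \<sigma>' w' where l: "I m' (\<sigma>' + (\<sigma>1 + o'))" "G m m'"
        "w' + \<Phi> (\<sigma>' + (\<sigma>1 + o')) < w2 + \<Phi> (\<sigma>2 + (\<sigma>1 + o'))" "safe \<Gamma> I G \<Phi> Q2 D1 t1 \<sigma>' w'"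
        by (rule safe_step)
      have "X t' (\<sigma>1 + \<sigma>') (Suc (w1 + w' + w3))"
        using cstep_right(1) s l(4) unfolding X_def by blast
      moreover have "I m' (\<sigma>1 + \<sigma>' + o')" "w' + \<Phi> (\<sigma>1 + \<sigma>' + o') < w2 + \<Phi> (\<sigma>1 + \<sigma>2 + o')"
        using l by (simp_all add: add_ac)
      ultimately show ?thesis
        using l(2) X by (intro exI[of _ "\<sigma>1 + \<sigma>'"] exI[of _ "Suc (w1 + w' + w3)"]) auto
    qed
  qed
  have lab: "max_label t \<le> D" if "X t \<sigma> w" for t \<sigma> w
  proof -
    from that obtain s u \<sigma>1 \<sigma>2 w1 w2 where "t = Join s u k"
      "safe \<Gamma> I G \<Phi> Q1 D1 s \<sigma>1 w1" "safe \<Gamma> I G \<Phi> Q2 D1 u \<sigma>2 w2" unfolding X_def by blast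
    then show ?thesis using assms(4) by (auto dest!: safe_max_label)
  qed
  have init: "X (Join s t k) (\<sigma>1 + \<sigma>2) (Suc (w1 + w2 + w3))"
    using assms(1,2) unfolding X_def by blast
  have ret: "Q x \<sigma>" if "X (Run a (Ret x)) \<sigma> w" for a x \<sigma> w
    using that unfolding X_def by blast
  show ?thesis by (rule safe_coinduct[where X = X, OF init lab ret st])
qed

text \<open>Quantifying over the start label makes \<open>d\<close> a relative depth. The
  postcondition sees owned tokens and not the memory, so other threads cannot invalidate it; facts
  about memory are recovered from \<open>I\<close>.\<close>

definition tri ::
  "('c \<Rightarrow> ('l, 'c) prog) \<Rightarrow> ('l mem \<Rightarrow> 'r multiset \<Rightarrow> bool) \<Rightarrow> ('l mem \<Rightarrow> 'l mem \<Rightarrow> bool) \<Rightarrow>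
   ('r multiset \<Rightarrow> nat) \<Rightarrow> nat \<Rightarrow> nat \<Rightarrow> 'r multiset \<Rightarrow> ('l, 'c) prog \<Rightarrow>
   (nat \<Rightarrow> 'r multiset \<Rightarrow> bool) \<Rightarrow> bool" where
  "tri \<Gamma> I G \<Phi> w d \<sigma> p Q \<longleftrightarrow> (\<forall>a. safe \<Gamma> I G \<Phi> Q (a + d) (Run a p) \<sigma> w)"

lemma tri_mono:
  assumes "tri \<Gamma> I G \<Phi> w d \<sigma> p Q" "\<And>x \<sigma>. Q x \<sigma> \<Longrightarrow> Q' x \<sigma>" "d \<le> d'" "w \<le> w'"
  shows "tri \<Gamma> I G \<Phi> w' d' \<sigma> p Q'"
  unfolding tri_def
proof
  fix a
  show "safe \<Gamma> I G \<Phi> Q' (a + d') (Run a p) \<sigma> w'"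
    by (rule safe_mono[of _ _ _ _ Q "a + d" _ _ w]) (use assms in \<open>simp_all add: tri_def\<close>)
qed

lemma tri_frame:
  assumes "tri \<Gamma> I G \<Phi> w d \<sigma> p Q"
  shows "tri \<Gamma> I G \<Phi> w d (\<sigma> + r) p (\<lambda>x \<sigma>'. \<exists>\<sigma>0. \<sigma>' = \<sigma>0 + r \<and> Q x \<sigma>0)"
  using assms unfolding tri_def by (intro allI safe_frame) simp

lemma tri_Ret: "Q x \<sigma> \<Longrightarrow> tri \<Gamma> I G \<Phi> w d \<sigma> (Ret x) Q"
  unfolding tri_def by (intro allI safeI) (auto elim: cstep.cases)

lemma tri_bind:
  assumes "tri \<Gamma> I G \<Phi> w1 d1 \<sigma> p Q1" "\<And>x \<sigma>'. Q1 x \<sigma>' \<Longrightarrow> tri \<Gamma> I G \<Phi> w2 d2 \<sigma>' (f x) Q"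
    and "w1 + w2 \<le> w" "d1 + d2 \<le> d"
  shows "tri \<Gamma> I G \<Phi> w d \<sigma> (p \<bind> f) Q"
  unfolding tri_def
proof
  fix a
  have "safe \<Gamma> I G \<Phi> Q (a + d) (bind_thread (Run a p) f) \<sigma> (w1 + w2)"
  proof (rule safe_bind)
    show "safe \<Gamma> I G \<Phi> Q1 (a + d1) (Run a p) \<sigma> w1" using assms(1) by (simp add: tri_def)
    fix b x \<sigma>' assume "Q1 x \<sigma>'" "b \<le> a + d1"
    then show "safe \<Gamma> I G \<Phi> Q (a + d) (Run b (f x)) \<sigma>' w2"
      using assms(2)[of x \<sigma>'] assms(4) unfolding tri_def
      by (rule_tac safe_mono[of _ _ _ _ Q "b + d2" _ _ w2]) auto
  qed (use assms(4) in simp)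
  then show "safe \<Gamma> I G \<Phi> Q (a + d) (Run a (p \<bind> f)) \<sigma> w"
    using safe_mono[of _ _ _ _ Q "a + d" _ _ "w1 + w2" Q "a + d" w] assms(3) by simp
qed

lemma tri_step:
  assumes "\<And>a. p \<noteq> Ret a" "0 < d"
    "\<And>a m o' t' m'. I m (\<sigma> + o') \<Longrightarrow> cstep \<Gamma> (Run a p, m) (t', m') \<Longrightarrow>
      \<exists>\<sigma>' w' p'. t' = Run (Suc a) p' \<and> I m' (\<sigma>' + o') \<and> G m m' \<and>
        w' + \<Phi> (\<sigma>' + o') < w + \<Phi> (\<sigma> + o') \<and> tri \<Gamma> I G \<Phi> w' (d - 1) \<sigma>' p' Q"
  shows "tri \<Gamma> I G \<Phi> w d \<sigma> p Q"
  unfolding tri_def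
proof (intro allI safeI)
  fix a m o' t' m' assume "I m (\<sigma> + o')" "cstep \<Gamma> (Run a p, m) (t', m')"
  from assms(3)[OF this] obtain \<sigma>' w' p' where t': "t' = Run (Suc a) p'" and
    *: "I m' (\<sigma>' + o')" "G m m'" "w' + \<Phi> (\<sigma>' + o') < w + \<Phi> (\<sigma> + o')" and
    "tri \<Gamma> I G \<Phi> w' (d - 1) \<sigma>' p' Q" by blast
  then have "safe \<Gamma> I G \<Phi> Q (Suc a + (d - 1)) t' \<sigma>' w'" unfolding tri_def by blast
  then have "safe \<Gamma> I G \<Phi> Q (a + d) t' \<sigma>' w'" using assms(2) by simp
  with * show "\<exists>\<sigma>' w'. I m' (\<sigma>' + o') \<and> G m m' \<and> w' + \<Phi> (\<sigma>' + o') < w + \<Phi> (\<sigma> + o') \<and>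
    safe \<Gamma> I G \<Phi> Q (a + d) t' \<sigma>' w'" by blast
next
  fix a
  show "max_label (Run a p) \<le> a + d" by simp
qed (use assms(1) in simp)

lemma tri_Read:
  assumes "0 < d"
    "\<And>m o'. I m (\<sigma> + o') \<Longrightarrow> \<exists>\<sigma>' w'. I m (\<sigma>' + o') \<and> G m m \<and>
      w' + \<Phi> (\<sigma>' + o') < w + \<Phi> (\<sigma> + o') \<and> tri \<Gamma> I G \<Phi> w' (d - 1) \<sigma>' (k (m l)) Q"
  shows "tri \<Gamma> I G \<Phi> w d \<sigma> (Read l k) Q"
proof (rule tri_step)
  fix a m o' t' m' assume I: "I m (\<sigma> + o')" and "cstep \<Gamma> (Run a (Read l k), m) (t', m')"
  from this(2) show "\<exists>\<sigma>' w' p'. t' = Run (Suc a) p' \<and> I m' (\<sigma>' + o') \<and> G m m' \<and>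
        w' + \<Phi> (\<sigma>' + o') < w + \<Phi> (\<sigma> + o') \<and> tri \<Gamma> I G \<Phi> w' (d - 1) \<sigma>' p' Q"
    by cases (use assms(2)[OF I] in simp)
qed (use assms(1) in simp_all)

lemma tri_Write:
  assumes "0 < d"
    "\<And>m o'. I m (\<sigma> + o') \<Longrightarrow> \<exists>\<sigma>' w'. I (m(l := x)) (\<sigma>' + o') \<and> G m (m(l := x)) \<and>
      w' + \<Phi> (\<sigma>' + o') < w + \<Phi> (\<sigma> + o') \<and> tri \<Gamma> I G \<Phi> w' (d - 1) \<sigma>' p Q"
  shows "tri \<Gamma> I G \<Phi> w d \<sigma> (Write l x p) Q"
proof (rule tri_step)
  fix a m o' t' m' assume I: "I m (\<sigma> + o')" and "cstep \<Gamma> (Run a (Write l x p), m) (t', m')"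
  from this(2) show "\<exists>\<sigma>' w' p'. t' = Run (Suc a) p' \<and> I m' (\<sigma>' + o') \<and> G m m' \<and>
        w' + \<Phi> (\<sigma>' + o') < w + \<Phi> (\<sigma> + o') \<and> tri \<Gamma> I G \<Phi> w' (d - 1) \<sigma>' p' Q"
    by cases (use assms(2)[OF I] in simp)
qed (use assms(1) in simp_all)

lemma tri_DecFetch:
  assumes "0 < d"
    "\<And>m o'. I m (\<sigma> + o') \<Longrightarrow> \<exists>\<sigma>' w'. I (m(l := m l - 1)) (\<sigma>' + o') \<and> G m (m(l := m l - 1)) \<and>
      w' + \<Phi> (\<sigma>' + o') < w + \<Phi> (\<sigma> + o') \<and> tri \<Gamma> I G \<Phi> w' (d - 1) \<sigma>' (k (m l - 1)) Q"
  shows "tri \<Gamma> I G \<Phi> w d \<sigma> (DecFetch l k) Q"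
proof (rule tri_step)
  fix a m o' t' m' assume I: "I m (\<sigma> + o')" and "cstep \<Gamma> (Run a (DecFetch l k), m) (t', m')"
  from this(2) show "\<exists>\<sigma>' w' p'. t' = Run (Suc a) p' \<and> I m' (\<sigma>' + o') \<and> G m m' \<and>
        w' + \<Phi> (\<sigma>' + o') < w + \<Phi> (\<sigma> + o') \<and> tri \<Gamma> I G \<Phi> w' (d - 1) \<sigma>' p' Q"
    by cases (use assms(2)[OF I] in simp)
qed (use assms(1) in simp_all)

lemma tri_Call:
  assumes "0 < d" "0 < w" "\<And>m. G m m" "tri \<Gamma> I G \<Phi> (w - 1) (d - 1) \<sigma> (\<Gamma> c \<bind> k) Q"
  shows "tri \<Gamma> I G \<Phi> w d \<sigma> (Call c k) Q"
proof (rule tri_step)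
  fix a m o' t' m' assume I: "I m (\<sigma> + o')" and "cstep \<Gamma> (Run a (Call c k), m) (t', m')"
  from this(2) show "\<exists>\<sigma>' w' p'. t' = Run (Suc a) p' \<and> I m' (\<sigma>' + o') \<and> G m m' \<and>
        w' + \<Phi> (\<sigma>' + o') < w + \<Phi> (\<sigma> + o') \<and> tri \<Gamma> I G \<Phi> w' (d - 1) \<sigma>' p' Q"
    by cases (rule exI[of _ \<sigma>], rule exI[of _ "w - 1"], use assms I in simp)
qed (use assms(1) in simp_all)

lemma tri_Fork:
  assumes "tri \<Gamma> I G \<Phi> w1 d1 \<sigma>1 p Q1" "tri \<Gamma> I G \<Phi> w2 d1 \<sigma>2 q Q2" and G: "\<And>m. G m m"
    and "\<And>x y \<sigma>1 \<sigma>2. Q1 x \<sigma>1 \<Longrightarrow> Q2 y \<sigma>2 \<Longrightarrow> tri \<Gamma> I G \<Phi> w3 d3 (\<sigma>1 + \<sigma>2) (k x y) Q"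
    and "w1 + w2 + w3 + 2 \<le> w" "d1 + d3 + 2 \<le> d"
  shows "tri \<Gamma> I G \<Phi> w d (\<sigma>1 + \<sigma>2) (Fork p q k) Q"
  unfolding tri_def
proof (intro allI safeI)
  fix a m o' t' m'
  assume I: "I m (\<sigma>1 + \<sigma>2 + o')" and "cstep \<Gamma> (Run a (Fork p q k), m) (t', m')"
  from this(2) have st: "t' = Join (Run (Suc a) p) (Run (Suc a) q) k" "m' = m"
    by (auto elim: cstep.cases)
  have "safe \<Gamma> I G \<Phi> Q (a + d) t' (\<sigma>1 + \<sigma>2) (Suc (w1 + w2 + w3))"
    unfolding st
  proof (rule safe_Join[where ?D1.0 = "Suc a + d1" and ?Q1.0 = Q1 and ?Q2.0 = Q2])
    fix b x y \<sigma>1 \<sigma>2 assume *: "Q1 x \<sigma>1" "Q2 y \<sigma>2" and b: "b \<le> Suc (Suc a + d1)"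
    have "safe \<Gamma> I G \<Phi> Q (b + d3) (Run b (k x y)) (\<sigma>1 + \<sigma>2) w3"
      using assms(4)[OF *] by (simp add: tri_def)
    then show "safe \<Gamma> I G \<Phi> Q (a + d) (Run b (k x y)) (\<sigma>1 + \<sigma>2) w3"
      using b assms(6) safe_mono[of _ _ _ _ Q "b + d3" _ _ w3 Q "a + d" w3] by simp
  next
    show "safe \<Gamma> I G \<Phi> Q1 (Suc a + d1) (Run (Suc a) p) \<sigma>1 w1"
      "safe \<Gamma> I G \<Phi> Q2 (Suc a + d1) (Run (Suc a) q) \<sigma>2 w2"
      using assms(1,2) unfolding tri_def by blast+
  qed (use assms(3,6) in simp_all)
  then show "\<exists>\<sigma>' w'. I m' (\<sigma>' + o') \<and> G m m' \<and>
      w' + \<Phi> (\<sigma>' + o') < w + \<Phi> (\<sigma>1 + \<sigma>2 + o') \<and> safe \<Gamma> I G \<Phi> Q (a + d) t' \<sigma>' w'"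
    using I G assms(5) st(2)
    by (intro exI[of _ "\<sigma>1 + \<sigma>2"] exI[of _ "Suc (w1 + w2 + w3)"]) auto
qed simp_all

text \<open>\<open>A\<close> relates the tokens of the inner logic to the tokens that represent them outside.\<close>

lemma tri_nest:
  assumes "tri \<Gamma> J H \<Psi> w d \<sigma>2 p Q2" "A \<sigma>2 \<sigma>"
    and inner: "\<And>m o' \<sigma>2 \<sigma>. A \<sigma>2 \<sigma> \<Longrightarrow> I m (\<sigma> + o') \<Longrightarrow> J m \<sigma>2"
    and outer: "\<And>m m' o' \<sigma>2 \<sigma> \<sigma>2'. A \<sigma>2 \<sigma> \<Longrightarrow> I m (\<sigma> + o') \<Longrightarrow> J m' \<sigma>2' \<Longrightarrow> H m m' \<Longrightarrow>
      \<exists>\<sigma>'. A \<sigma>2' \<sigma>' \<and> I m' (\<sigma>' + o') \<and> G m m' \<and> \<Phi> (\<sigma>' + o') = \<Phi> (\<sigma> + o')"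
    and post: "\<And>x \<sigma>2 \<sigma>. Q2 x \<sigma>2 \<Longrightarrow> A \<sigma>2 \<sigma> \<Longrightarrow> Q x \<sigma>"
  shows "tri \<Gamma> I G \<Phi> (w + \<Psi> \<sigma>2) d \<sigma> p Q"
  unfolding tri_def
proof
  fix a
  define D where "D = a + d"
  \<comment> \<open>The credits \<open>\<Psi> \<sigma>2\<close> stored by the inner invariant are
    carried by the outer thread, so the outer potential stays constant throughout. The inner
    computation owns all inner tokens and has an empty environment.\<close>
  define X where "X \<equiv> \<lambda>t \<sigma> v. \<exists>\<sigma>2 w. v = w + \<Psi> \<sigma>2 \<and> A \<sigma>2 \<sigma> \<and> safe \<Gamma> J H \<Psi> Q2 D t \<sigma>2 w"
  have st: "\<exists>\<sigma>' w'. I m' (\<sigma>' + o') \<and> G m m' \<and> w' + \<Phi> (\<sigma>' + o') < v + \<Phi> (\<sigma> + o') \<and>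
      (X t' \<sigma>' w' \<or> safe \<Gamma> I G \<Phi> Q D t' \<sigma>' w')"
    if X: "X t \<sigma> v" and I: "I m (\<sigma> + o')" and c: "cstep \<Gamma> (t, m) (t', m')" for t \<sigma> v m o' t' m'
  proof -
    from X obtain \<sigma>2 w where v: "v = w + \<Psi> \<sigma>2" and A: "A \<sigma>2 \<sigma>" and s: "safe \<Gamma> J H \<Psi> Q2 D t \<sigma>2 w"
      unfolding X_def by blast
    have "J m (\<sigma>2 + {#})" using inner[OF A I] by simp
    from s this c obtain \<sigma>2' w' where *: "J m' (\<sigma>2' + {#})" "H m m'"
      "w' + \<Psi> (\<sigma>2' + {#}) < w + \<Psi> (\<sigma>2 + {#})" "safe \<Gamma> J H \<Psi> Q2 D t' \<sigma>2' w'"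
      by (rule safe_step)
    from outer[OF A I _ *(2)] *(1) obtain \<sigma>' where
      "A \<sigma>2' \<sigma>'" "I m' (\<sigma>' + o')" "G m m'" "\<Phi> (\<sigma>' + o') = \<Phi> (\<sigma> + o')" by auto
    then show ?thesis
      using * v unfolding X_def by (intro exI[of _ \<sigma>'] exI[of _ "w' + \<Psi> \<sigma>2'"]) auto
  qed
  have init: "X (Run a p) \<sigma> (w + \<Psi> \<sigma>2)" using assms(1,2) by (auto simp: tri_def X_def D_def)
  have lab: "max_label t \<le> D" if "X t \<sigma> w" for t \<sigma> w
    using that safe_max_label unfolding X_def by blast
  have ret: "Q x \<sigma>" if "X (Run a (Ret x)) \<sigma> w" for a x \<sigma> w
    using that post unfolding X_def by (blast dest: safe_Ret)
  have "safe \<Gamma> I G \<Phi> Q D (Run a p) \<sigma> (w + \<Psi> \<sigma>2)"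
    by (rule safe_coinduct[where X = X, OF init lab ret st])
  then show "safe \<Gamma> I G \<Phi> Q (a + d) (Run a p) \<sigma> (w + \<Psi> \<sigma>2)" by (simp add: D_def)
qed

subsection \<open>Parallel loops\<close>

text \<open>The binary logarithm rounded up: \<open>Suc n div 2\<close> is the size of the larger
  part when an interval of length \<open>n\<close> is split at its midpoint.\<close>

fun clog :: "nat \<Rightarrow> nat" where
  "clog n = (if n \<le> 1 then 0 else Suc (clog (Suc n div 2)))"

declare clog.simps [simp del]

lemma clog_mono: "m \<le> n \<Longrightarrow> clog m \<le> clog n"
proof (induction n arbitrary: m rule: clog.induct)
  case (1 n)
  show ?case
  proof (cases "m \<le> 1")
    case False
    then have "clog (Suc m div 2) \<le> clog (Suc n div 2)"
      using 1(2) by (intro 1(1)) (auto intro: div_le_mono)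
    then show ?thesis using False 1(2) by (simp add: clog.simps[of m] clog.simps[of n])
  qed (simp add: clog.simps[of m])
qed

text \<open>Rounding up gives \<open>2 ^ (clog n - 1) < n\<close>. Over the integers this becomes a
  bound by \<open>n - 1\<close>, a form that survives the halving and yields \<open>2 * k\<close>
  for \<open>n = Suc k\<close>.\<close>

lemma clog_le: "2 \<le> n \<Longrightarrow> 2 ^ clog n \<le> 2 * (n - 1)"
proof (induction n rule: clog.induct)
  case (1 n)
  show ?case
  proof (cases "n = 2")
    case True
    then show ?thesis by (simp add: clog.simps)
  next
    case False
    then have "2 \<le> Suc n div 2" using 1(2) by linarith
    then have "2 ^ clog (Suc n div 2) \<le> 2 * (Suc n div 2 - 1)" using 1 by simp
    moreover have "(2 :: nat) ^ clog n = 2 * 2 ^ clog (Suc n div 2)"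
      using 1(2) by (subst clog.simps) simp
    ultimately show ?thesis by linarith
  qed
qed

text \<open>\<open>P a b\<close> describes value and tokens obtained on the subinterval from
  \<open>a\<close> to \<open>b\<close>. A binary tree with \<open>k\<close> leaves has
  \<open>k - 1\<close> forks of two nodes each, hence 2 units per index, and depth 2 per
  halving.\<close>

lemma tri_reduce:
  assumes G: "\<And>m. G m m"
    and body: "\<And>i. lo \<le> i \<Longrightarrow> i < hi \<Longrightarrow> tri \<Gamma> I G \<Phi> (w i) d (\<sigma> i) (body i) (P i (Suc i))"
    and comb: "\<And>a b c x y r s. lo \<le> a \<Longrightarrow> a < b \<Longrightarrow> b < c \<Longrightarrow> c \<le> hi \<Longrightarrow>
      P a b x r \<Longrightarrow> P b c y s \<Longrightarrow> P a c (f x y) (r + s)"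
    and empty: "hi \<le> lo \<Longrightarrow> P lo hi z {#}"
  shows "tri \<Gamma> I G \<Phi> (\<Sum>i = lo..<hi. w i + 2) (d + 2 * clog (hi - lo)) (\<Sum>i = lo..<hi. \<sigma> i)
    (reduce f z body lo hi) (P lo hi)"
proof (cases "hi \<le> lo")
  case True
  then show ?thesis using empty by (simp add: reduce.simps[of f z] tri_Ret)
next
  case False
  \<comment> \<open>The sharper count for nonempty intervals makes the induction close: of the 4
    units saved by the two halves, 2 pay for the fork and join here and 2 are saved again.\<close>
  have "tri \<Gamma> I G \<Phi> ((\<Sum>i = a..<b. w i + 2) - 2) (d + 2 * clog (b - a)) (\<Sum>i = a..<b. \<sigma> i)
    (reduce f z body a b) (P a b)" if "lo \<le> a" "a < b" "b \<le> hi" for a b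
    using that
  proof (induction "b - a" arbitrary: a b rule: less_induct)
    case less
    show ?case
    proof (cases "b = Suc a")
      case True
      then show ?thesis
        using less.prems tri_mono[OF body[of a]] by (simp add: reduce.simps[of f z])
    next
      case False
      let ?c = "(a + b) div 2"
      let ?h = "Suc (b - a) div 2"
      let ?W = "\<lambda>a b. \<Sum>i = a..<b. w i + 2"
      have c: "a < ?c" "?c < b" "?c - a \<le> ?h" "b - ?c \<le> ?h"
          "?c - a < b - a" "b - ?c < b - a" using less.prems False by linarith+
      have "?W a ?c + ?W ?c b = ?W a b"
        using c by (intro sum.atLeastLessThan_concat) auto
      moreover have "2 \<le> ?W a ?c" "2 \<le> ?W ?c b"
        using c(1,2) by (simp_all add: sum.atLeast_Suc_lessThan)
      ultimately have W: "?W a ?c - 2 + (?W ?c b - 2) + 0 + 2 \<le> ?W a b - 2" by linarith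
      have \<sigma>: "(\<Sum>i = a..<b. \<sigma> i) = (\<Sum>i = a..<?c. \<sigma> i) + (\<Sum>i = ?c..<b. \<sigma> i)"
        using c by (simp add: sum.atLeastLessThan_concat)
      have clog: "clog (b - a) = Suc (clog ?h)"
        using less.prems False by (subst clog.simps) auto
      have L: "tri \<Gamma> I G \<Phi> (?W a ?c - 2) (d + 2 * clog ?h) (\<Sum>i = a..<?c. \<sigma> i)
          (reduce f z body a ?c) (P a ?c)"
        using c less.prems clog_mono[OF c(3)] by (intro tri_mono[OF less(1)]) auto
      have R: "tri \<Gamma> I G \<Phi> (?W ?c b - 2) (d + 2 * clog ?h) (\<Sum>i = ?c..<b. \<sigma> i)
          (reduce f z body ?c b) (P ?c b)"
        using c less.prems clog_mono[OF c(4)] by (intro tri_mono[OF less(1)]) auto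
      have red: "reduce f z body a b =
          Fork (reduce f z body a ?c) (reduce f z body ?c b) (\<lambda>x y. Ret (f x y))"
        using less.prems False by (subst reduce.simps) (simp add: Let_def)
      show ?thesis
        unfolding red \<sigma>
        by (rule tri_Fork[OF L R G tri_Ret W]) (use comb c less.prems clog in simp_all)
    qed
  qed
  note main = this
  show ?thesis by (rule tri_mono[OF main]) (use False in simp_all)
qed

subsection \<open>Computations in which every cell receives at most one value\<close>

text \<open>The tokens are the cells that have already received their final value \<open>m1 l\<close>.\<close>

definition settled :: "'l set \<Rightarrow> 'l mem \<Rightarrow> 'l mem \<Rightarrow> 'l mem \<Rightarrow> 'l multiset \<Rightarrow> bool" where
  "settled S m0 m1 m T \<longleftrightarrow> (\<forall>l\<in>S. m l = (if l \<in># T then m1 l else m0 l))"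

definition only_writes :: "'l set \<Rightarrow> 'l mem \<Rightarrow> 'l mem \<Rightarrow> bool" where
  "only_writes A m m' \<longleftrightarrow> (\<forall>l. l \<notin> A \<longrightarrow> m' l = m l)"

abbreviation settling where
  "settling \<Gamma> S A m0 m1 \<equiv> tri \<Gamma> (settled S m0 m1) (only_writes A) (\<lambda>_. 0)"

text \<open>The final memory \<open>m1\<close> is named before the run, so a cell can have only two
  values and the schedule cannot influence the result. \<open>S\<close> is the part of memory
  described by the invariant, \<open>A\<close> the cells that may be written; tokens once gained are
  kept.\<close>

definition stri where
  "stri \<Gamma> S A m0 m1 w d \<sigma> p Q \<longleftrightarrow>
    settling \<Gamma> S A m0 m1 w d \<sigma> p (\<lambda>x \<sigma>'. \<sigma> \<subseteq># \<sigma>' \<and> Q x \<sigma>')"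

lemma stri_Ret: "Q x \<sigma> \<Longrightarrow> stri \<Gamma> S A m0 m1 w d \<sigma> (Ret x) Q"
  by (simp add: stri_def tri_Ret)

lemma stri_mono:
  assumes "stri \<Gamma> S A m0 m1 w d \<sigma> p Q" "\<And>x \<sigma>. Q x \<sigma> \<Longrightarrow> Q' x \<sigma>" "d \<le> d'" "w \<le> w'"
  shows "stri \<Gamma> S A m0 m1 w' d' \<sigma> p Q'"
  unfolding stri_def by (rule tri_mono[OF assms(1)[unfolded stri_def]]) (use assms in auto)

text \<open>A read has a predictable value if the thread owns the token of the cell, or if the phase
  does not change the cell.\<close>

lemma stri_Read:
  assumes "l \<in> S" "0 < w" "0 < d" "l \<in># \<sigma> \<or> m0 l = m1 l"
    and "stri \<Gamma> S A m0 m1 (w - 1) (d - 1) \<sigma> (k (m1 l)) Q"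
  shows "stri \<Gamma> S A m0 m1 w d \<sigma> (Read l k) Q"
  unfolding stri_def
proof (rule tri_Read)
  fix m o' assume I: "settled S m0 m1 m (\<sigma> + o')"
  then have "m l = m1 l" using assms(1,4) by (auto simp: settled_def)
  then show "\<exists>\<sigma>' w'. settled S m0 m1 m (\<sigma>' + o') \<and> only_writes A m m \<and> w' + 0 < w + 0 \<and>
      settling \<Gamma> S A m0 m1 w' (d - 1) \<sigma>' (k (m l))
        (\<lambda>x \<sigma>'. \<sigma> \<subseteq># \<sigma>' \<and> Q x \<sigma>')"
    using I assms(2,5) unfolding stri_def
    by (intro exI[of _ \<sigma>] exI[of _ "w - 1"]) (auto simp: only_writes_def)
qed (fact assms(3))

text \<open>Several threads may write one cell, since each of them writes \<open>m1 l\<close>. The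
  concurrent marking of a color relies on this.\<close>

lemma stri_Write:
  assumes "l \<in> A" "x = m1 l" "0 < w" "0 < d"
    and "stri \<Gamma> S A m0 m1 (w - 1) (d - 1) (add_mset l \<sigma>) p Q"
  shows "stri \<Gamma> S A m0 m1 w d \<sigma> (Write l x p) Q"
  unfolding stri_def
proof (rule tri_Write)
  fix m o' assume I: "settled S m0 m1 m (\<sigma> + o')"
  have "settling \<Gamma> S A m0 m1 (w - 1) (d - 1) (add_mset l \<sigma>) p
        (\<lambda>x \<sigma>'. \<sigma> \<subseteq># \<sigma>' \<and> Q x \<sigma>')"
    by (rule tri_mono[OF assms(5)[unfolded stri_def]])
      (auto dest: mset_subset_eq_insertD simp: subset_mset.less_imp_le)
  then show "\<exists>\<sigma>' w'. settled S m0 m1 (m(l := x)) (\<sigma>' + o') \<and> only_writes A m (m(l := x)) \<and>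
      w' + 0 < w + 0 \<and> settling \<Gamma> S A m0 m1 w' (d - 1) \<sigma>' p
        (\<lambda>x \<sigma>'. \<sigma> \<subseteq># \<sigma>' \<and> Q x \<sigma>')"
    using I assms(1,2,3)
    by (intro exI[of _ "add_mset l \<sigma>"] exI[of _ "w - 1"]) (auto simp: only_writes_def settled_def)
qed (fact assms(4))

lemma stri_bind:
  assumes "stri \<Gamma> S A m0 m1 w1 d1 \<sigma> p Q1"
    and "\<And>x \<sigma>'. \<sigma> \<subseteq># \<sigma>' \<Longrightarrow> Q1 x \<sigma>' \<Longrightarrow> stri \<Gamma> S A m0 m1 w2 d2 \<sigma>' (f x) Q"
    and "w1 + w2 \<le> w" "d1 + d2 \<le> d"
  shows "stri \<Gamma> S A m0 m1 w d \<sigma> (p \<bind> f) Q"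
  unfolding stri_def
proof (rule tri_bind[OF assms(1)[unfolded stri_def] _ assms(3,4)])
  fix x \<sigma>' assume *: "\<sigma> \<subseteq># \<sigma>' \<and> Q1 x \<sigma>'"
  show "settling \<Gamma> S A m0 m1 w2 d2 \<sigma>' (f x) (\<lambda>x \<sigma>'. \<sigma> \<subseteq># \<sigma>' \<and> Q x \<sigma>')"
    using * by (intro tri_mono[OF assms(2)[unfolded stri_def]]) (auto intro: subset_mset.order_trans)
qed

lemma stri_Fork:
  assumes "stri \<Gamma> S A m0 m1 w1 d1 {#} p Q1" "stri \<Gamma> S A m0 m1 w2 d1 {#} q Q2"
    and "\<And>x y r s. Q1 x r \<Longrightarrow> Q2 y s \<Longrightarrow> stri \<Gamma> S A m0 m1 w3 d3 (r + s) (k x y) Q"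
    and "w1 + w2 + w3 + 2 \<le> w" "d1 + d3 + 2 \<le> d"
  shows "stri \<Gamma> S A m0 m1 w d {#} (Fork p q k) Q"
proof -
  have "settling \<Gamma> S A m0 m1 w d ({#} + {#}) (Fork p q k)
      (\<lambda>x \<sigma>'. {#} \<subseteq># \<sigma>' \<and> Q x \<sigma>')"
  proof (rule tri_Fork[OF assms(1,2)[unfolded stri_def] _ _ assms(4,5)])
    fix x y r s assume "{#} \<subseteq># r \<and> Q1 x r" "{#} \<subseteq># s \<and> Q2 y s"
    then have "stri \<Gamma> S A m0 m1 w3 d3 (r + s) (k x y) Q" using assms(3) by blast
    then show "settling \<Gamma> S A m0 m1 w3 d3 (r + s) (k x y)
        (\<lambda>x \<sigma>'. {#} \<subseteq># \<sigma>' \<and> Q x \<sigma>')"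
      unfolding stri_def by (rule tri_mono) auto
  qed (simp add: only_writes_def)
  then show ?thesis by (simp add: stri_def)
qed

lemma stri_reduce:
  assumes body: "\<And>i. lo \<le> i \<Longrightarrow> i < hi \<Longrightarrow>
      stri \<Gamma> S A m0 m1 (w i) d {#} (body i) (\<lambda>x r. x = F i (Suc i) \<and> W i \<subseteq> set_mset r)"
    and comb: "\<And>a b c. lo \<le> a \<Longrightarrow> a < b \<Longrightarrow> b < c \<Longrightarrow> c \<le> hi \<Longrightarrow> f (F a b) (F b c) = F a c"
    and empty: "hi \<le> lo \<Longrightarrow> F lo hi = z"
    and "(\<Sum>i = lo..<hi. w i + 2) \<le> w'" "d + 2 * clog (hi - lo) \<le> d'"
  shows "stri \<Gamma> S A m0 m1 w' d' \<sigma> (reduce f z body lo hi)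
    (\<lambda>x r. x = F lo hi \<and> (\<forall>i\<in>{lo..<hi}. W i \<subseteq> set_mset r))"
proof -
  have "settling \<Gamma> S A m0 m1 (\<Sum>i = lo..<hi. w i + 2)
      (d + 2 * clog (hi - lo)) (\<Sum>i = lo..<hi. {#}) (reduce f z body lo hi)
      (\<lambda>x r. x = F lo hi \<and> (\<forall>i\<in>{lo..<hi}. W i \<subseteq> set_mset r))"
  proof (rule tri_reduce[where P = "\<lambda>a b x r. x = F a b \<and> (\<forall>i\<in>{a..<b}. W i \<subseteq> set_mset r)"])
    fix i assume "lo \<le> i" "i < hi"
    then show "settling \<Gamma> S A m0 m1 (w i) d {#} (body i)
        (\<lambda>x r. x = F i (Suc i) \<and> (\<forall>i\<in>{i..<Suc i}. W i \<subseteq> set_mset r))"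
      by (intro tri_mono[OF body[unfolded stri_def]]) (auto simp: less_Suc_eq_le)
  next
    fix a b c x y r s
    assume "lo \<le> a" "a < b" "b < c" "c \<le> hi" "x = F a b \<and> (\<forall>i\<in>{a..<b}. W i \<subseteq> set_mset r)"
      "y = F b c \<and> (\<forall>i\<in>{b..<c}. W i \<subseteq> set_mset s)"
    then show "f x y = F a c \<and> (\<forall>i\<in>{a..<c}. W i \<subseteq> set_mset (r + s))"
      using comb[of a b c] by (auto simp: subset_iff Ball_def) (meson not_less)+
  qed (auto simp: only_writes_def empty)
  from tri_frame[OF this, of \<sigma>] show ?thesis
    unfolding stri_def sum.neutral_const add_0 by (rule tri_mono) (use assms(4,5) in \<open>force+\<close>)
qed

lemma stri_parfor:
  assumes body: "\<And>i. lo \<le> i \<Longrightarrow> i < hi \<Longrightarrow>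
      stri \<Gamma> S A m0 m1 (w i) d {#} (body i) (\<lambda>x r. W i \<subseteq> set_mset r)"
    and "(\<Sum>i = lo..<hi. w i + 2) \<le> w'" "d + 2 * clog (hi - lo) \<le> d'"
  shows "stri \<Gamma> S A m0 m1 w' d' \<sigma> (parfor lo hi body)
    (\<lambda>x r. \<forall>i\<in>{lo..<hi}. W i \<subseteq> set_mset r)"
proof -
  have "settling \<Gamma> S A m0 m1 (\<Sum>i = lo..<hi. w i + 2)
      (d + 2 * clog (hi - lo)) (\<Sum>i = lo..<hi. {#}) (parfor lo hi body)
      (\<lambda>x r. \<forall>i\<in>{lo..<hi}. W i \<subseteq> set_mset r)"
  proof (rule tri_reduce[where P = "\<lambda>a b x r. \<forall>i\<in>{a..<b}. W i \<subseteq> set_mset r"])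
    fix i assume "lo \<le> i" "i < hi"
    then show "settling \<Gamma> S A m0 m1 (w i) d {#} (body i)
        (\<lambda>x r. \<forall>i\<in>{i..<Suc i}. W i \<subseteq> set_mset r)"
      by (intro tri_mono[OF body[unfolded stri_def]]) (auto simp: less_Suc_eq_le)
  next
    fix a b c x y r s
    assume "lo \<le> a" "a < b" "b < c" "c \<le> hi" "\<forall>i\<in>{a..<b}. W i \<subseteq> set_mset r"
      "\<forall>i\<in>{b..<c}. W i \<subseteq> set_mset s"
    then show "\<forall>i\<in>{a..<c}. W i \<subseteq> set_mset (r + s)"
      by (auto simp: subset_iff Ball_def) (meson not_less)+
  qed (auto simp: only_writes_def)
  from tri_frame[OF this, of \<sigma>] show ?thesis
    unfolding stri_def sum.neutral_const add_0 by (rule tri_mono) (use assms(2,3) in \<open>force+\<close>)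
qed

subsection \<open>Sequential composition of verified phases\<close>

text \<open>The memory itself is the only token, which leaves nothing for other threads. Between
  phases the logic thus reduces to Hoare triples about the whole memory.\<close>

definition htri where
  "htri \<Gamma> w d m p Q \<longleftrightarrow>
    tri \<Gamma> (\<lambda>m T. T = {#m#}) (\<lambda>_ _. True) (\<lambda>_. 0) w d {#m#} p (\<lambda>x T. \<exists>m. T = {#m#} \<and> Q x m)"

lemma htri_Ret: "Q x m \<Longrightarrow> htri \<Gamma> w d m (Ret x) Q"
  by (simp add: htri_def tri_Ret)

lemma htri_mono:
  assumes "htri \<Gamma> w d m p Q" "\<And>x m. Q x m \<Longrightarrow> Q' x m" "d \<le> d'" "w \<le> w'"
  shows "htri \<Gamma> w' d' m p Q'"
  unfolding htri_def by (rule tri_mono[OF assms(1)[unfolded htri_def]]) (use assms in auto)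

lemma htri_bind:
  assumes "htri \<Gamma> w1 d1 m p Q1" "\<And>x m'. Q1 x m' \<Longrightarrow> htri \<Gamma> w2 d2 m' (f x) Q"
    and "w1 + w2 \<le> w" "d1 + d2 \<le> d"
  shows "htri \<Gamma> w d m (p \<bind> f) Q"
  unfolding htri_def
  by (rule tri_bind[OF assms(1)[unfolded htri_def] _ assms(3,4)])
    (use assms(2) in \<open>auto simp: htri_def\<close>)

lemma htri_Call:
  assumes "0 < d" "0 < w" "htri \<Gamma> (w - 1) (d - 1) m (\<Gamma> c \<bind> k) Q"
  shows "htri \<Gamma> w d m (Call c k) Q"
  using assms unfolding htri_def by (intro tri_Call) auto

text \<open>Entering a concurrent phase means paying the credits that its invariant initially
  stores; on leaving it, the invariant holds of the final memory and final tokens.\<close>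

lemma htri_nest:
  assumes "tri \<Gamma> J H \<Psi> w d \<sigma> p Q2" "J m \<sigma>" "\<And>x \<sigma> m. Q2 x \<sigma> \<Longrightarrow> J m \<sigma> \<Longrightarrow> Q x m"
  shows "htri \<Gamma> (w + \<Psi> \<sigma>) d m p Q"
  unfolding htri_def
  by (rule tri_nest[where A = "\<lambda>\<sigma> T. \<exists>m. T = {#m#} \<and> J m \<sigma>" and ?Q2.0 = Q2, OF assms(1)])
    (use assms(2,3) in auto)

lemma htri_stri:
  assumes "stri \<Gamma> UNIV UNIV m m1 w d {#} p Q2"
    "\<And>x r. Q2 x r \<Longrightarrow> (\<forall>l. m l \<noteq> m1 l \<longrightarrow> l \<in># r) \<and> Q x m1"
  shows "htri \<Gamma> w d m p Q"
proof -
  have "htri \<Gamma> (w + 0) d m p Q"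
  proof (rule htri_nest[OF assms(1)[unfolded stri_def]])
    fix x \<sigma> m' assume "{#} \<subseteq># \<sigma> \<and> Q2 x \<sigma>" and s: "settled UNIV m m1 m' \<sigma>"
    then have "m' = m1" using assms(2)[of x \<sigma>] by (auto simp: settled_def fun_eq_iff)
    then show "Q x m'" using assms(2) \<open>{#} \<subseteq># \<sigma> \<and> Q2 x \<sigma>\<close> by blast
  qed (simp add: settled_def)
  then show ?thesis by simp
qed

text \<open>Every step strictly lowers the credits, so their initial number bounds the length of
  every run, whatever the interleaving.\<close>

lemma htri_sound:
  assumes "htri \<Gamma> w d m p Q" "(cstep \<Gamma> ^^ n) (Run a p, m) (t, m')"
  shows "n \<le> w \<and> max_label t \<le> a + d \<and> (\<forall>b x. t = Run b (Ret x) \<longrightarrow> Q x m')"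
proof -
  let ?safe = "safe \<Gamma> (\<lambda>m T. T = {#m#}) (\<lambda>_ _. True) (\<lambda>_. 0) (\<lambda>x T. \<exists>m. T = {#m#} \<and> Q x m)"
  have "\<exists>v. n + v \<le> w \<and> ?safe (a + d) t {#m'#} v"
    using assms(2)
  proof (induction n arbitrary: t m')
    case 0
    then show ?case using assms(1) by (auto simp: htri_def tri_def)
  next
    case (Suc n)
    then obtain t1 m1 where "(cstep \<Gamma> ^^ n) (Run a p, m) (t1, m1)" and c: "cstep \<Gamma> (t1, m1) (t, m')"
      by auto
    with Suc.IH obtain v where v: "n + v \<le> w" "?safe (a + d) t1 {#m1#} v" by blast
    from v(2) _ c obtain \<sigma>' w' where "\<sigma>' + {#} = {#m'#}" "w' + 0 < v + 0" "?safe (a + d) t \<sigma>' w'"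
      by (rule safe_step[where o' = "{#}"]) auto
    then show ?case using v(1) by (intro exI[of _ w']) auto
  qed
  then show ?thesis by (auto dest: safe_max_label safe_Ret)
qed

section \<open>Degrees, degeneracy and the levels computed by ADG\<close>

lemma nbrs_iff: "u \<in> nbrs E U v \<longleftrightarrow> u \<in> U \<and> {u, v} \<in> E"
  by (simp add: nbrs_def)

lemma finite_nbrs [simp]: "finite U \<Longrightarrow> finite (nbrs E U v)"
  by (simp add: nbrs_def)

lemma simple_graph_edgeD:
  assumes "simple_graph n E" "{u, v} \<in> E"
  shows "u < n" "v < n" "u \<noteq> v"
  using assms unfolding simple_graph_def by (auto simp: doubleton_eq_iff dest!: subsetD)

lemma finite_edges: "simple_graph n E \<Longrightarrow> finite E"
proof -
  assume "simple_graph n E"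
  then have "E \<subseteq> Pow {..<n}" by (auto simp: simple_graph_def)
  then show ?thesis by (rule finite_subset) simp
qed

lemma sum_vertex_degree_le:
  assumes "simple_graph n E"
  shows "(\<Sum>v<n. vertex_degree n E v) \<le> 2 * card E"
proof -
  let ?S = "SIGMA v:{..<n}. nbrs E {..<n} v"
  have "(\<Sum>v<n. vertex_degree n E v) = card ?S"
    by (simp add: vertex_degree_def)
  also have "?S \<subseteq> (\<Union>e\<in>E. {(u, v). {u, v} = e \<and> u \<noteq> v})"
    using simple_graph_edgeD[OF assms] by (auto simp: nbrs_iff insert_commute)
  then have "card ?S \<le> card (\<Union>e\<in>E. {(u, v). {u, v} = e \<and> u \<noteq> v})"
  proof (rule card_mono[rotated])
    have "(\<Union>e\<in>E. {(u, v). {u, v} = e \<and> u \<noteq> v}) \<subseteq> {..<n} \<times> {..<n}"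
      using simple_graph_edgeD[OF assms] by auto
    then show "finite (\<Union>e\<in>E. {(u, v). {u, v} = e \<and> u \<noteq> v})" by (rule finite_subset) simp
  qed
  also have "\<dots> \<le> (\<Sum>e\<in>E. card {(u, v). {u, v} = e \<and> u \<noteq> v})"
    by (intro card_UN_le finite_edges[OF assms])
  also have "\<dots> \<le> (\<Sum>e\<in>E. 2)"
  proof (rule sum_mono)
    fix e assume "e \<in> E"
    then obtain a b where e: "e = {a, b}" using assms by (auto simp: simple_graph_def)
    have "{(u, v). {u, v} = e \<and> u \<noteq> v} \<subseteq> {(a, b), (b, a)}"
      using e by (auto simp: doubleton_eq_iff)
    from card_mono[OF _ this] show "card {(u, v). {u, v} = e \<and> u \<noteq> v} \<le> 2"
      by (simp add: card_insert_if split: if_splits)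
  qed
  finally show ?thesis by simp
qed

lemma vertex_degree_le_max_degree: "v < n \<Longrightarrow> vertex_degree n E v \<le> max_degree n E"
  by (simp add: max_degree_def)

lemma vertex_degree_less: "simple_graph n E \<Longrightarrow> v < n \<Longrightarrow> vertex_degree n E v < n"
proof -
  assume G: "simple_graph n E" and v: "v < n"
  have "{v, v} \<notin> E" using simple_graph_edgeD(3)[OF G] by blast
  then have "nbrs E {..<n} v \<subseteq> {..<n} - {v}" by (auto simp: nbrs_iff)
  from card_mono[OF _ this] v show ?thesis by (simp add: vertex_degree_def)
qed

lemma degeneracy_witness:
  assumes "W \<noteq> {}" "W \<subseteq> {..<n}"
  shows "\<exists>v\<in>W. card (nbrs E W v) \<le> degeneracy n E"
proof -
  let ?P = "\<lambda>s. \<forall>W. W \<noteq> {} \<and> W \<subseteq> {..<n} \<longrightarrow> (\<exists>v\<in>W. card (nbrs E W v) \<le> s)"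
  have "?P n"
  proof (intro allI impI)
    fix W assume W: "W \<noteq> {} \<and> W \<subseteq> {..<n}"
    then obtain v where "v \<in> W" by blast
    have "nbrs E W v \<subseteq> {..<n}" using W by (auto simp: nbrs_iff)
    from card_mono[OF _ this] \<open>v \<in> W\<close> show "\<exists>v\<in>W. card (nbrs E W v) \<le> n" by auto
  qed
  then have "?P (degeneracy n E)" unfolding degeneracy_def by (rule LeastI)
  then show ?thesis using assms by blast
qed

text \<open>Peeling: deleting a vertex of degree at most \<open>degeneracy n E\<close> lowers the
  sum of degrees by its own degree and by 1 for each neighbour, that is, by at most twice the
  degeneracy.\<close>

lemma sum_card_nbrs_le:
  assumes "simple_graph n E" "W \<subseteq> {..<n}"
  shows "(\<Sum>v\<in>W. card (nbrs E W v)) \<le> 2 * degeneracy n E * card W"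
  using assms(2)
proof (induction "card W" arbitrary: W)
  case 0
  then have "W = {}" using finite_subset by fastforce
  then show ?case by simp
next
  case (Suc c)
  then have fin: "finite W" and "W \<noteq> {}" by (auto intro: finite_subset)
  then obtain v where v: "v \<in> W" "card (nbrs E W v) \<le> degeneracy n E"
    using degeneracy_witness Suc.prems by blast
  let ?W = "W - {v}"
  have irr: "{v, v} \<notin> E" using simple_graph_edgeD[OF assms(1), of v v] by blast
  have *: "card (nbrs E W u) = card (nbrs E ?W u) + (if u \<in> nbrs E W v then 1 else 0)"
    if "u \<in> ?W" for u
  proof (cases "u \<in> nbrs E W v")
    case True
    then have "nbrs E W u = insert v (nbrs E ?W u)"
      using v(1) by (auto simp: nbrs_iff insert_commute)
    then show ?thesis using True fin by (simp add: nbrs_iff)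
  next
    case False
    then have "nbrs E W u = nbrs E ?W u"
      using that by (auto simp: nbrs_iff insert_commute)
    then show ?thesis using False by simp
  qed
  have "nbrs E W v \<subseteq> ?W" using irr by (auto simp: nbrs_iff)
  then have cnt: "(\<Sum>u\<in>?W. if u \<in> nbrs E W v then 1 else 0) = card (nbrs E W v)"
    using fin by (simp add: sum.If_cases Int_absorb1)
  have "(\<Sum>u\<in>W. card (nbrs E W u)) = card (nbrs E W v) + (\<Sum>u\<in>?W. card (nbrs E W u))"
    using fin v(1) by (simp add: sum.remove)
  also have "(\<Sum>u\<in>?W. card (nbrs E W u)) = (\<Sum>u\<in>?W. card (nbrs E ?W u)) + card (nbrs E W v)"
    by (simp add: * sum.distrib cnt)
  also have "(\<Sum>u\<in>?W. card (nbrs E ?W u)) \<le> 2 * degeneracy n E * c"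
    using Suc.hyps(1)[of ?W] Suc.hyps(2)[symmetric] Suc.prems fin v(1) by auto
  finally show ?case using v(2) Suc.hyps(2)[symmetric] by (simp add: algebra_simps)
qed

section \<open>The rounds of ADG as operations on vertex sets\<close>

definition removed :: "real \<Rightarrow> nat set set \<Rightarrow> nat set \<Rightarrow> nat set" where
  "removed \<epsilon> E U = {u \<in> U. real (card (nbrs E U u)) \<le>
     (1 + \<epsilon>) * (real (\<Sum>v\<in>U. card (nbrs E U v)) / real (card U))}"

primrec remaining :: "real \<Rightarrow> nat \<Rightarrow> nat set set \<Rightarrow> nat \<Rightarrow> nat set" where
  "remaining \<epsilon> n E 0 = {..<n}"
| "remaining \<epsilon> n E (Suc l) = remaining \<epsilon> n E l - removed \<epsilon> E (remaining \<epsilon> n E l)"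

text \<open>\<open>remaining\<close> is indexed from 0 while the program numbers its rounds from 1.
  A vertex removed from \<open>remaining \<epsilon> n E l\<close> gets level \<open>Suc l\<close>,
  the number that the program writes to \<open>AdgPrio\<close>.\<close>

definition level :: "real \<Rightarrow> nat \<Rightarrow> nat set set \<Rightarrow> nat \<Rightarrow> nat" where
  "level \<epsilon> n E v = (LEAST l. v \<notin> remaining \<epsilon> n E l)"

definition rounds :: "real \<Rightarrow> nat \<Rightarrow> nat" where
  "rounds \<epsilon> n = Suc (nat \<lceil>ln n / ln (1 + \<epsilon>)\<rceil>)"

lemma removed_subset: "removed \<epsilon> E U \<subseteq> U"
  by (auto simp: removed_def)

text \<open>Markov's inequality: survivors exceed \<open>1 + \<epsilon>\<close> times the average
  degree, while their degrees sum to at most the total. Total degree 0 is separate because the total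
  is cancelled; then every vertex is removed.\<close>

lemma card_Diff_removed_le:
  assumes "0 < \<epsilon>" "finite U"
  shows "(1 + \<epsilon>) * real (card (U - removed \<epsilon> E U)) \<le> real (card U)"
proof -
  let ?S = "\<Sum>v\<in>U. card (nbrs E U v)"
  let ?X = "U - removed \<epsilon> E U"
  show ?thesis
  proof (cases "?S = 0")
    case True
    then have X: "?X = {}" using assms by (auto simp: removed_def)
    show ?thesis unfolding X by simp
  next
    case False
    then have pos: "0 < real ?S" by (simp del: of_nat_sum)
    have "real (card ?X) * ((1 + \<epsilon>) * (real ?S / real (card U))) =
        (\<Sum>v\<in>?X. (1 + \<epsilon>) * (real ?S / real (card U)))" by simp
    also have "\<dots> \<le> (\<Sum>v\<in>?X. real (card (nbrs E U v)))"
      by (rule sum_mono) (auto simp: removed_def)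
    also have "\<dots> \<le> (\<Sum>v\<in>U. real (card (nbrs E U v)))"
      using assms(2) by (intro sum_mono2) auto
    finally have "real (card ?X) * ((1 + \<epsilon>) * (real ?S / real (card U))) \<le> real ?S" by simp
    moreover have "0 < card U" using False assms(2) by (auto simp: card_gt_0_iff)
    ultimately have "((1 + \<epsilon>) * real (card ?X)) * real ?S \<le> real (card U) * real ?S"
      by (simp add: field_simps del: of_nat_sum)
    then show ?thesis using pos by (rule mult_right_le_imp_le)
  qed
qed

lemma remaining_subset: "remaining \<epsilon> n E l \<subseteq> {..<n}"
  by (induction l) auto

lemma finite_remaining [simp]: "finite (remaining \<epsilon> n E l)"
  by (rule finite_subset[OF remaining_subset]) simp

lemma remaining_antimono: "k \<le> l \<Longrightarrow> remaining \<epsilon> n E l \<subseteq> remaining \<epsilon> n E k"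
  by (induction l) (auto simp: le_Suc_eq)

lemma card_remaining_le:
  assumes "0 < \<epsilon>"
  shows "(1 + \<epsilon>) ^ l * real (card (remaining \<epsilon> n E l)) \<le> real n"
proof (induction l)
  case (Suc l)
  let ?U = "remaining \<epsilon> n E l"
  have "(1 + \<epsilon>) ^ l * ((1 + \<epsilon>) * real (card (?U - removed \<epsilon> E ?U))) \<le> (1 + \<epsilon>) ^ l * real (card ?U)"
    using assms by (intro mult_left_mono card_Diff_removed_le) auto
  then show ?case using Suc by (simp add: algebra_simps)
qed simp

lemma remaining_rounds:
  assumes "0 < \<epsilon>"
  shows "remaining \<epsilon> n E (rounds \<epsilon> n) = {}"
proof (cases "n = 0")
  case True
  then show ?thesis using remaining_subset[of \<epsilon> n E] by simp
next
  case False
  have "ln n / ln (1 + \<epsilon>) < real (rounds \<epsilon> n)" unfolding rounds_def by linarith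
  then have "ln n < real (rounds \<epsilon> n) * ln (1 + \<epsilon>)" using assms by (simp add: field_simps)
  also have "\<dots> = ln ((1 + \<epsilon>) ^ rounds \<epsilon> n)" using assms by (simp add: ln_realpow)
  finally have lt: "real n < (1 + \<epsilon>) ^ rounds \<epsilon> n" using assms False by simp
  show ?thesis
  proof (rule ccontr)
    assume "remaining \<epsilon> n E (rounds \<epsilon> n) \<noteq> {}"
    then have "1 \<le> real (card (remaining \<epsilon> n E (rounds \<epsilon> n)))"
      by (simp add: Suc_le_eq card_gt_0_iff)
    then have "(1 + \<epsilon>) ^ rounds \<epsilon> n * 1 \<le> (1 + \<epsilon>) ^ rounds \<epsilon> n * real (card (remaining \<epsilon> n E (rounds \<epsilon> n)))"
      using assms by (intro mult_left_mono) auto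
    with card_remaining_le[OF assms, of "rounds \<epsilon> n" n E] lt show False by simp
  qed
qed

lemma level_eq:
  assumes "v \<in> remaining \<epsilon> n E l" "v \<notin> remaining \<epsilon> n E (Suc l)"
  shows "level \<epsilon> n E v = Suc l"
  unfolding level_def
proof (rule Least_equality)
  fix k assume "v \<notin> remaining \<epsilon> n E k"
  then show "Suc l \<le> k" using assms(1) remaining_antimono[of k l \<epsilon> n E] by (metis not_less_eq_eq subsetD)
qed fact

lemma level_witness:
  assumes "0 < \<epsilon>" "v < n"
  obtains l where "level \<epsilon> n E v = Suc l" "l < rounds \<epsilon> n"
    "v \<in> removed \<epsilon> E (remaining \<epsilon> n E l)"
proof -
  let ?P = "\<lambda>l. v \<notin> remaining \<epsilon> n E l"
  have "?P (rounds \<epsilon> n)" using remaining_rounds[OF assms(1)] by blast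
  then have 1: "?P (level \<epsilon> n E v)" "level \<epsilon> n E v \<le> rounds \<epsilon> n"
    unfolding level_def by (rule LeastI, rule Least_le)
  have "level \<epsilon> n E v \<noteq> 0"
  proof
    assume "level \<epsilon> n E v = 0"
    then show False using 1(1) assms(2) by simp
  qed
  then obtain l where l: "level \<epsilon> n E v = Suc l" using not0_implies_Suc by blast
  then have "\<not> ?P l" unfolding level_def by (intro not_less_Least) simp
  then show ?thesis using that[OF l] 1 l by simp
qed

lemma mem_remaining_iff:
  assumes "0 < \<epsilon>" "v < n"
  shows "v \<in> remaining \<epsilon> n E l \<longleftrightarrow> l < level \<epsilon> n E v"
proof -
  obtain k where k: "level \<epsilon> n E v = Suc k" "v \<in> removed \<epsilon> E (remaining \<epsilon> n E k)"
    by (rule level_witness[OF assms])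
  then have "v \<in> remaining \<epsilon> n E k" "v \<notin> remaining \<epsilon> n E (Suc k)" using removed_subset by auto
  then show ?thesis
    using k(1) remaining_antimono[of l k \<epsilon> n E] remaining_antimono[of "Suc k" l \<epsilon> n E]
    by (cases "l \<le> k") auto
qed

text \<open>Neighbours of equal level are still present when \<open>v\<close> is removed, so they
  are part of the degree that was compared with the average.\<close>

lemma card_level_nbrs_le:
  assumes "0 < \<epsilon>" "simple_graph n E" "v < n"
  shows "real (card {u. {u, v} \<in> E \<and> level \<epsilon> n E u = level \<epsilon> n E v})
    \<le> 2 * (1 + \<epsilon>) * real (degeneracy n E)"
proof -
  obtain l where l: "level \<epsilon> n E v = Suc l" and v: "v \<in> removed \<epsilon> E (remaining \<epsilon> n E l)"
    by (rule level_witness[OF assms(1,3)])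
  let ?U = "remaining \<epsilon> n E l"
  have "{u. {u, v} \<in> E \<and> level \<epsilon> n E u = level \<epsilon> n E v} \<subseteq> nbrs E ?U v"
    using l simple_graph_edgeD[OF assms(2)] mem_remaining_iff[OF assms(1), of _ n E l]
    by (auto simp: nbrs_iff)
  from card_mono[OF _ this]
  have "real (card {u. {u, v} \<in> E \<and> level \<epsilon> n E u = level \<epsilon> n E v}) \<le> real (card (nbrs E ?U v))"
    by simp
  also have "\<dots> \<le> (1 + \<epsilon>) * (real (\<Sum>v\<in>?U. card (nbrs E ?U v)) / real (card ?U))"
    using v by (simp add: removed_def)
  also have "\<dots> \<le> (1 + \<epsilon>) * (real (2 * degeneracy n E * card ?U) / real (card ?U))"
    using assms sum_card_nbrs_le[OF assms(2) remaining_subset[of \<epsilon> n E l]]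
    by (intro mult_left_mono divide_right_mono) (simp_all del: of_nat_mult of_nat_sum)
  also have "\<dots> \<le> 2 * (1 + \<epsilon>) * real (degeneracy n E)"
    using assms(1) by (cases "card ?U = 0") (auto simp: algebra_simps)
  finally show ?thesis .
qed

section \<open>Monotone paths under a random order\<close>

text \<open>Double counting instead of probability: precomposing with the permutations of
  \<open>set xs\<close> turns each good \<open>\<pi>\<close> into \<open>fact (length xs)\<close>
  permutations of \<open>{..<n}\<close>, and all permutations obtained in this way are
  different.\<close>

lemma card_decreasing_permutations:
  assumes "distinct xs" "set xs \<subseteq> {..<n}"
  shows "card {\<pi>. \<pi> permutes {..<n} \<and> sorted_wrt (>) (map \<pi> xs)} * fact (length xs) \<le> fact n"
proof -
  let ?A = "{\<pi>. \<pi> permutes {..<n} \<and> sorted_wrt (>) (map \<pi> xs)}"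
  let ?P = "{\<sigma>. \<sigma> permutes set xs}"
  let ?f = "\<lambda>(\<pi>, \<sigma>). \<pi> \<circ> \<sigma>"
  have finP: "finite {\<pi>. \<pi> permutes {..<n}}" by (simp add: finite_permutations)
  have "inj_on ?f (?A \<times> ?P)"
  proof (rule inj_onI, clarify)
    fix \<pi> \<sigma> \<pi>' \<sigma>'
    assume \<pi>: "\<pi> permutes {..<n}" "sorted_wrt (>) (map \<pi> xs)" and \<sigma>: "\<sigma> permutes set xs"
      and \<pi>': "\<pi>' permutes {..<n}" "sorted_wrt (>) (map \<pi>' xs)" and \<sigma>': "\<sigma>' permutes set xs"
      and eq: "\<pi> \<circ> \<sigma> = \<pi>' \<circ> \<sigma>'"
    have "\<pi> ` set xs = (\<pi> \<circ> \<sigma>) ` set xs" using permutes_image[OF \<sigma>] by (metis image_comp)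
    also have "\<dots> = \<pi>' ` set xs" using eq permutes_image[OF \<sigma>'] by (metis image_comp)
    \<comment> \<open>A decreasing sequence is determined by its set of values, so
      \<open>\<pi>\<close> and \<open>\<pi>'\<close> agree on \<open>xs\<close>; outside
      \<open>xs\<close> both inner permutations are the identity.\<close>
    finally have "set (rev (map \<pi> xs)) = set (rev (map \<pi>' xs))" by simp
    moreover have "sorted_wrt (<) (rev (map \<pi> xs))" "sorted_wrt (<) (rev (map \<pi>' xs))"
      using \<pi>(2) \<pi>'(2) by (simp_all add: sorted_wrt_rev)
    ultimately have "rev (map \<pi> xs) = rev (map \<pi>' xs)"
      by (intro sorted_distinct_set_unique) (auto simp: strict_sorted_iff)
    then have on: "\<pi> x = \<pi>' x" if "x \<in> set xs" for x using that by simp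
    have "\<pi> x = \<pi>' x" for x
    proof (cases "x \<in> set xs")
      case False
      then show ?thesis
        using eq permutes_not_in[OF \<sigma>] permutes_not_in[OF \<sigma>'] by (metis comp_apply)
    qed (rule on)
    then have "\<pi> = \<pi>'" by blast
    moreover from this have "\<sigma> = \<sigma>'"
      using eq permutes_inj[OF \<pi>(1)] by (metis fun.inj_map_strong inj_eq comp_apply ext)
    ultimately show "\<pi> = \<pi>' \<and> \<sigma> = \<sigma>'" by blast
  qed
  moreover have "?f ` (?A \<times> ?P) \<subseteq> {\<pi>. \<pi> permutes {..<n}}"
    using permutes_subset[OF _ assms(2)] by (auto intro: permutes_compose)
  ultimately have "card (?A \<times> ?P) \<le> card {\<pi>. \<pi> permutes {..<n}}"
    using finP by (rule card_inj_on_le)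
  then show ?thesis
    using assms(1) by (simp add: card_cartesian_product card_permutations distinct_card)
qed

text \<open>There are \<open>n\<close> start vertices and at most \<open>x\<close> choices for each
  further vertex; \<open>max 1\<close> covers the empty list when \<open>n = 0\<close>.\<close>

lemma card_paths_le:
  fixes x :: real
  assumes "\<And>v. v < n \<Longrightarrow> finite {u. R v u}" "\<And>v. v < n \<Longrightarrow> real (card {u. R v u}) \<le> x" "1 \<le> x"
  shows "finite {xs. length xs = k \<and> set xs \<subseteq> {..<n} \<and> successively R xs} \<and>
    real (card {xs. length xs = k \<and> set xs \<subseteq> {..<n} \<and> successively R xs}) \<le> max 1 (real n) * x ^ k"
    (is "finite (?P k) \<and> _ \<le> _")
proof
  have fin: "finite (?P k)" for k
    by (rule finite_subset[OF _ finite_lists_length_eq[of "{..<n}" k]]) auto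
  then show "finite (?P k)" .
  have start: "real (card {xs \<in> ?P (Suc k). hd xs = v}) \<le> x ^ k" if "v < n" for v k
    using that
  proof (induction k arbitrary: v)
    case 0
    have "{xs \<in> ?P (Suc 0). hd xs = v} \<subseteq> {[v]}" by (auto simp: length_Suc_conv)
    from card_mono[OF _ this] show ?case by simp
  next
    case (Suc k)
    let ?N = "{u. R v u \<and> u < n}"
    have N: "finite ?N" by simp
    have fk: "finite {xs \<in> ?P (Suc k). hd xs = u}" for u
      by (rule finite_subset[OF _ fin[of "Suc k"]]) auto
    have "{xs \<in> ?P (Suc (Suc k)). hd xs = v} \<subseteq>
        (\<Union>u\<in>?N. (\<lambda>xs. v # xs) ` {xs \<in> ?P (Suc k). hd xs = u})"
    proof
      fix xs assume "xs \<in> {xs \<in> ?P (Suc (Suc k)). hd xs = v}"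
      then obtain u ys where xs: "xs = v # u # ys" "length ys = k" "set (u # ys) \<subseteq> {..<n}"
        "R v u" "successively R (u # ys)" by (auto simp: length_Suc_conv)
      then show "xs \<in> (\<Union>u\<in>?N. (\<lambda>xs. v # xs) ` {xs \<in> ?P (Suc k). hd xs = u})"
        by (intro UN_I[of u] image_eqI[of _ _ "u # ys"]) auto
    qed
    then have "card {xs \<in> ?P (Suc (Suc k)). hd xs = v} \<le>
        card (\<Union>u\<in>?N. (\<lambda>xs. v # xs) ` {xs \<in> ?P (Suc k). hd xs = u})"
    proof (rule card_mono[rotated])
      show "finite (\<Union>u\<in>?N. (\<lambda>xs. v # xs) ` {xs \<in> ?P (Suc k). hd xs = u})"
        by (intro finite_UN_I N finite_imageI fk)
    qed
    also have "\<dots> \<le> (\<Sum>u\<in>?N. card ((\<lambda>xs. v # xs) ` {xs \<in> ?P (Suc k). hd xs = u}))"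
      by (rule card_UN_le[OF N])
    also have "\<dots> \<le> (\<Sum>u\<in>?N. card {xs \<in> ?P (Suc k). hd xs = u})"
      by (intro sum_mono card_image_le fk)
    finally have "real (card {xs \<in> ?P (Suc (Suc k)). hd xs = v}) \<le>
        real (\<Sum>u\<in>?N. card {xs \<in> ?P (Suc k). hd xs = u})" by (rule of_nat_mono)
    also have "\<dots> = (\<Sum>u\<in>?N. real (card {xs \<in> ?P (Suc k). hd xs = u}))" by (rule of_nat_sum)
    also have "\<dots> \<le> (\<Sum>u\<in>?N. x ^ k)" using Suc.IH by (intro sum_mono) auto
    also have "\<dots> \<le> x * x ^ k"
    proof -
      have "real (card ?N) \<le> real (card {u. R v u})"
        using assms(1)[OF Suc.prems] by (auto intro: card_mono)
      also have "\<dots> \<le> x" using assms(2)[OF Suc.prems] .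
      finally show ?thesis using assms(3) by (auto intro: mult_right_mono)
    qed
    finally show ?case by simp
  qed
  show "real (card (?P k)) \<le> max 1 (real n) * x ^ k"
  proof (cases k)
    case 0
    then have "?P k = {[]}" by auto
    then show ?thesis using 0 by simp
  next
    case (Suc j)
    have "?P k = (\<Union>v<n. {xs \<in> ?P (Suc j). hd xs = v})"
      using Suc by (auto simp: length_Suc_conv)
    then have "card (?P k) \<le> (\<Sum>v<n. card {xs \<in> ?P (Suc j). hd xs = v})"
      by (simp only: card_UN_le finite_lessThan)
    then have "real (card (?P k)) \<le> real (\<Sum>v<n. card {xs \<in> ?P (Suc j). hd xs = v})"
      by (rule of_nat_mono)
    also have "\<dots> = (\<Sum>v<n. real (card {xs \<in> ?P (Suc j). hd xs = v}))" by (rule of_nat_sum)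
    also have "\<dots> \<le> (\<Sum>v<n. x ^ j)" using start by (intro sum_mono) auto
    also have "\<dots> = real n * x ^ j" by simp
    also have "\<dots> \<le> max 1 (real n) * x ^ k"
      using assms(3) Suc by (intro mult_mono power_increasing) auto
    finally show ?thesis .
  qed
qed

section \<open>Decreasing paths inside one level\<close>

definition level_succ :: "real \<Rightarrow> nat \<Rightarrow> nat set set \<Rightarrow> nat \<Rightarrow> nat \<Rightarrow> bool" where
  "level_succ \<epsilon> n E v u \<longleftrightarrow> {u, v} \<in> E \<and> level \<epsilon> n E u = level \<epsilon> n E v"

text \<open>\<open>level_succ\<close> is symmetric; the direction of a path comes from
  \<open>\<pi>\<close>. Length exactly \<open>K\<close> is enough, because prefixes of decreasing
  paths are again decreasing paths.\<close>

definition long_path :: "real \<Rightarrow> nat \<Rightarrow> nat set set \<Rightarrow> nat \<Rightarrow> (nat \<Rightarrow> nat) \<Rightarrow> bool" where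
  "long_path \<epsilon> n E K \<pi> \<longleftrightarrow> (\<exists>xs. length xs = K \<and> set xs \<subseteq> {..<n} \<and>
     successively (level_succ \<epsilon> n E) xs \<and> sorted_wrt (>) (map \<pi> xs))"

lemma card_long_path_le:
  assumes "0 < \<epsilon>" "simple_graph n E" "2 * (1 + \<epsilon>) * real (degeneracy n E) \<le> x" "1 \<le> x"
  shows "real (card {\<pi>. \<pi> permutes {..<n} \<and> long_path \<epsilon> n E K \<pi>}) * fact K
    \<le> max 1 (real n) * x ^ K * fact n"
proof -
  let ?P = "{xs. length xs = K \<and> set xs \<subseteq> {..<n} \<and> successively (level_succ \<epsilon> n E) xs}"
  let ?A = "\<lambda>xs. {\<pi>. \<pi> permutes {..<n} \<and> sorted_wrt (>) (map \<pi> xs)}"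
  have "finite {u. level_succ \<epsilon> n E v u}" if "v < n" for v
    by (rule finite_subset[of _ "{..<n}"])
      (auto simp: level_succ_def dest: simple_graph_edgeD[OF assms(2)])
  moreover have "real (card {u. level_succ \<epsilon> n E v u}) \<le> x" if "v < n" for v
    using card_level_nbrs_le[OF assms(1,2) that] assms(3) by (simp add: level_succ_def)
  ultimately have P: "finite ?P" "real (card ?P) \<le> max 1 (real n) * x ^ K"
    using card_paths_le[of n "level_succ \<epsilon> n E" x K] assms(4) by blast+
  have finA: "finite (?A xs)" for xs
    by (rule finite_subset[of _ "{\<pi>. \<pi> permutes {..<n}}"]) (auto simp: finite_permutations)
  have "{\<pi>. \<pi> permutes {..<n} \<and> long_path \<epsilon> n E K \<pi>} = (\<Union>xs\<in>?P. ?A xs)"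
    by (auto simp: long_path_def)
  then have "card {\<pi>. \<pi> permutes {..<n} \<and> long_path \<epsilon> n E K \<pi>} * fact K \<le> (\<Sum>xs\<in>?P. card (?A xs)) * fact K"
    using card_UN_le[OF P(1), of ?A] by (intro mult_right_mono) auto
  also have "\<dots> = (\<Sum>xs\<in>?P. card (?A xs) * fact K)" by (simp add: sum_distrib_right)
  also have "\<dots> \<le> (\<Sum>xs\<in>?P. fact n)"
  proof (rule sum_mono)
    fix xs assume xs: "xs \<in> ?P"
    show "card (?A xs) * fact K \<le> fact n"
    \<comment> \<open>A list with a repetition is never strictly decreasing, so the factorial bound
      is needed for distinct lists only.\<close>
    proof (cases "distinct xs")
      case True
      then show ?thesis using card_decreasing_permutations[of xs n] xs by auto
    next
      case False
      have A: "?A xs = {}"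
      proof (rule ccontr)
        assume "?A xs \<noteq> {}"
        then obtain \<pi> :: "nat \<Rightarrow> nat" where "sorted_wrt (>) (map \<pi> xs)" by blast
        then have "sorted_wrt (<) (rev (map \<pi> xs))" by (simp add: sorted_wrt_rev)
        then have "distinct (rev (map \<pi> xs))" by (simp only: strict_sorted_iff)
        then show False using False by (simp add: distinct_map)
      qed
      show ?thesis unfolding A by simp
    qed
  qed
  finally have "card {\<pi>. \<pi> permutes {..<n} \<and> long_path \<epsilon> n E K \<pi>} * fact K \<le> card ?P * fact n" by simp
  then have "real (card {\<pi>. \<pi> permutes {..<n} \<and> long_path \<epsilon> n E K \<pi>} * fact K) \<le> real (card ?P * fact n)"
    by (simp only: of_nat_le_iff)
  also have "\<dots> \<le> (max 1 (real n) * x ^ K) * fact n" using P(2) by (simp add: mult_right_mono)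
  finally show ?thesis by simp
qed

section \<open>A height function for the priority order\<close>

definition height_bound :: "real \<Rightarrow> nat \<Rightarrow> nat set set \<Rightarrow> nat \<Rightarrow> (nat \<Rightarrow> nat) \<Rightarrow> nat" where
  "height_bound \<epsilon> n E K \<pi> = (if long_path \<epsilon> n E K \<pi> then n else Suc (rounds \<epsilon> n) * K)"

text \<open>If there is a long path, the height of \<open>v\<close> counts the vertices below it.
  Otherwise it is lexicographic: \<open>K\<close> times the level plus the length of the longest
  decreasing path that continues from \<open>v\<close> inside its level; the latter stays below
  \<open>K\<close>, so a drop in level dominates it.\<close>

lemma height_exists:
  assumes "0 < \<epsilon>" "simple_graph n E"
  shows "\<exists>h. (\<forall>u v. {u, v} \<in> E \<longrightarrow> level \<epsilon> n E u < level \<epsilon> n E v \<or>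
        level \<epsilon> n E u = level \<epsilon> n E v \<and> \<pi> u < \<pi> v \<longrightarrow> h u < h v) \<and>
      (\<forall>v<n. h v \<le> height_bound \<epsilon> n E K \<pi>)"
proof -
  let ?l = "level \<epsilon> n E"
  let ?less = "\<lambda>u v. ?l u < ?l v \<or> ?l u = ?l v \<and> \<pi> u < (\<pi> v :: nat)"
  note edge = simple_graph_edgeD[OF assms(2)]
  show ?thesis
  proof (cases "long_path \<epsilon> n E K \<pi>")
    case True
    let ?h = "\<lambda>v. card {u. u < n \<and> ?less u v}"
    have "?h u < ?h v" if "{u, v} \<in> E" "?less u v" for u v
      by (rule psubset_card_mono) (use that edge[of u v] in auto)
    moreover have "?h v \<le> n" for v
      using card_mono[of "{..<n}" "{u. u < n \<and> ?less u v}"] by auto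
    ultimately show ?thesis using True by (intro exI[of _ ?h]) (auto simp: height_bound_def)
  next
    case False
    define P where "P = (\<lambda>v xs. set (v # xs) \<subseteq> {..<n} \<and>
      successively (level_succ \<epsilon> n E) (v # xs) \<and> sorted_wrt (>) (map \<pi> (v # xs)))"
    define g where "g = (\<lambda>v. Max (length ` {xs. P v xs}))"
    have short: "length xs < K" if "P v xs" for v xs
    proof (rule ccontr)
      assume "\<not> length xs < K"
      then have "length (take K (v # xs)) = K" by simp
      moreover have "set (take K (v # xs)) \<subseteq> {..<n}"
        using that set_take_subset unfolding P_def by fast
      moreover have "successively (level_succ \<epsilon> n E) (take K (v # xs))"
        using that successively_append_iff[of _ "take K (v # xs)" "drop K (v # xs)"]
        unfolding P_def append_take_drop_id by blast
      moreover have "sorted_wrt (>) (map \<pi> (take K (v # xs)))"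
        using that sorted_wrt_take unfolding P_def take_map[symmetric] by blast
      ultimately have "long_path \<epsilon> n E K \<pi>" unfolding long_path_def by blast
      then show False using False by simp
    qed
    have fin: "finite (length ` {xs. P v xs})" for v
      by (rule finite_subset[of _ "{..<K}"]) (use short in auto)
    have ge: "length xs \<le> g v" if "P v xs" for v xs
      unfolding g_def using fin that by (intro Max_ge) auto
    have ex: "\<exists>xs. P v xs \<and> length xs = g v" if "v < n" for v
    proof -
      have "P v []" using that by (simp add: P_def)
      then have "length ` {xs. P v xs} \<noteq> {}" by blast
      from Max_in[OF fin this] show ?thesis by (auto simp: g_def)
    qed
    have gK: "g v < K" if "v < n" for v using ex[OF that] short by fastforce
    let ?h = "\<lambda>v. ?l v * K + g v"
    have "?h u < ?h v" if E: "{u, v} \<in> E" and less: "?less u v" for u v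
      using less
    proof
      assume "?l u < ?l v"
      then have "Suc (?l u) * K \<le> ?l v * K" by (intro mult_right_mono) auto
      then show ?thesis using gK[of u] edge[OF E] by simp
    next
      assume eq: "?l u = ?l v \<and> \<pi> u < \<pi> v"
      obtain xs where xs: "P u xs" "length xs = g u" using ex edge[OF E] by blast
      then have "P v (u # xs)" using E eq edge[OF E] by (auto simp: P_def level_succ_def)
      from ge[OF this] show ?thesis using eq xs(2) by simp
    qed
    moreover have "?h v \<le> Suc (rounds \<epsilon> n) * K" if v: "v < n" for v
    proof -
      obtain l where "?l v = Suc l" "l < rounds \<epsilon> n" by (rule level_witness[OF assms(1) v])
      then have "?l v * K \<le> rounds \<epsilon> n * K" by (intro mult_right_mono) auto
      then show ?thesis using gK[OF v] unfolding mult_Suc by linarith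
    qed
    ultimately show ?thesis using False by (intro exI[of _ ?h]) (auto simp: height_bound_def)
  qed
qed

section \<open>Analytic estimates for the path length\<close>

lemma power_div_fact_le_exp: "0 \<le> x \<Longrightarrow> x ^ k / fact k \<le> exp (x :: real)"
proof -
  assume x: "0 \<le> x"
  have "(\<Sum>i\<in>{k}. x ^ i / fact i) \<le> (\<Sum>i. x ^ i / fact i)"
    using summable_exp[of x] x by (intro sum_le_suminf) (auto simp: field_simps)
  also have "\<dots> = exp x" by (simp add: exp_def divide_inverse_commute)
  finally show ?thesis by simp
qed

text \<open>One term of the exponential series gives \<open>fact k \<ge> (k / e) ^ k\<close>, so the
  quotient is at most \<open>(e * x / k) ^ k\<close>.\<close>

lemma power_div_fact_le:
  assumes "0 < x" "1 \<le> k" "L \<le> real k * ln (real k / (exp 1 * x))"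
  shows "x ^ k / fact k \<le> exp (- L)"
proof -
  have "real k ^ k / fact k \<le> exp (real k)" by (rule power_div_fact_le_exp) simp
  then have "x ^ k / fact k \<le> exp (real k) * (x / real k) ^ k"
    using assms by (simp add: power_divide field_simps)
  also have "exp (real k) * (x / real k) ^ k = (exp 1 * x / real k) ^ k"
    by (simp add: power_mult_distrib power_divide exp_of_nat_mult[of k 1, simplified])
  also have "exp 1 * x / real k = exp (- ln (real k / (exp 1 * x)))"
    using assms by (simp add: exp_minus)
  also have "\<dots> ^ k = exp (- (real k * ln (real k / (exp 1 * x))))"
    by (simp flip: exp_of_nat_mult)
  also have "\<dots> \<le> exp (- L)" using assms(3) by simp
  finally show ?thesis .
qed

lemma pos1_ge_1 [simp]: "1 \<le> pos1 x" and pos1_ge [simp]: "x \<le> pos1 x"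
  by (simp_all add: pos1_def)

text \<open>
  If \<open>D \<le> sqrt L\<close>, then \<open>k / D\<close> is at least a power of \<open>L\<close>, so the logarithm contributes
  a factor \<open>ln L\<close>; otherwise \<open>ln D\<close> is comparable to \<open>ln L\<close> and \<open>k\<close> alone is large enough.
\<close>

lemma path_length_suffices:
  assumes c: "1 \<le> c" and D: "1 \<le> D" and L: "1 \<le> L"
    and k: "4 * exp 2 * c * (D + pos1 (ln D) * L / pos1 (ln L)) \<le> real k"
  shows "2 * L \<le> real k * ln (real k / (exp 1 * (c * D)))"
proof -
  define l where "l = pos1 (ln L)"
  have l: "1 \<le> l" "ln L \<le> l" by (simp_all add: l_def)
  have e2: "1 \<le> exp (2 :: real)" by simp
  have e: "exp 2 = exp 1 * exp (1 :: real)" by (simp flip: exp_add)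
  let ?M = "pos1 (ln D) * L / l"
  have M: "0 \<le> ?M" using l L by (auto intro!: mult_nonneg_nonneg divide_nonneg_pos order.trans[OF _ pos1_ge_1])
  have C4: "4 \<le> 4 * exp 2 * c" using c e2 mult_mono[of 1 "exp 2" 1 c] by simp
  have c0: "0 \<le> c" and C0: "0 \<le> 4 * exp 2 * c" using c C4 by linarith+
  have k1: "4 * exp 2 * c * D \<le> real k" and k2: "4 * exp 2 * c * ?M \<le> real k"
  proof -
    have "4 * exp 2 * c * D + 4 * exp 2 * c * ?M \<le> real k"
      using k by (simp add: l_def algebra_simps)
    moreover have "0 \<le> 4 * exp 2 * c * ?M" "0 \<le> 4 * exp 2 * c * D"
      by (rule mult_nonneg_nonneg[OF C0 M], rule mult_nonneg_nonneg[OF C0]) (use D in linarith)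
    ultimately show "4 * exp 2 * c * D \<le> real k" "4 * exp 2 * c * ?M \<le> real k" by linarith+
  qed
  have cD: "0 < exp 1 * (c * D)" using c D by (auto intro!: mult_pos_pos)
  have k3: "4 * ?M \<le> real k" using k2 mult_right_mono[OF C4 M] by linarith
  show ?thesis
  proof (cases "D \<le> sqrt L")
    case True
    \<comment> \<open>\<open>y\<close> is the fourth root of \<open>L\<close>. Then
      \<open>D \<le> y ^ 2\<close> and \<open>l \<le> 4 * y\<close> give
      \<open>y * D * l \<le> 4 * L\<close>, so \<open>k / D\<close> is at least a constant multiple
      of \<open>y\<close>.\<close>
    define y where "y = exp (ln L / 4)"
    have y4: "y ^ 4 = L" using L by (simp add: y_def flip: exp_of_nat_mult)
    have y0: "0 < y" by (simp add: y_def)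
    have y1: "1 \<le> y" using L by (simp add: y_def)
    have "sqrt L = y ^ 2" using y4 y0 by (intro real_sqrt_unique) (auto simp flip: power_mult)
    then have Dy: "D \<le> y ^ 2" using True by simp
    have ly: "l \<le> 4 * y"
    proof -
      have "ln L / 4 \<le> y" unfolding y_def using exp_ge_add_one_self[of "ln L / 4"] by linarith
      then show ?thesis using y1 by (simp add: l_def pos1_def)
    qed
    have "4 * exp 2 * c * (L / l) \<le> 4 * exp 2 * c * ?M"
      using l L C4 by (intro mult_left_mono divide_right_mono) (use c0 in \<open>auto simp: mult_le_cancel_right1\<close>)
    then have kL: "4 * exp 2 * c * (L / l) \<le> real k" using k2 by linarith
    have "exp 1 * y * (exp 1 * (c * D)) = exp 2 * c * (y * D)" by (simp add: e)
    also have "\<dots> \<le> exp 2 * c * (4 * (L / l))"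
    proof (rule mult_left_mono)
      have "y * D * l \<le> y * y ^ 2 * (4 * y)" using Dy ly l y0 D by (intro mult_mono) auto
      also have "\<dots> = 4 * L" using y4 by (simp add: power4_eq_xxxx power2_eq_square)
      finally show "y * D \<le> 4 * (L / l)" using l by (simp add: field_simps)
    qed (use c in auto)
    also have "\<dots> \<le> real k" using kL by (simp add: mult_ac)
    finally have "exp 1 * y \<le> real k / (exp 1 * (c * D))" using cD by (simp add: pos_le_divide_eq)
    then have "ln (exp 1 * y) \<le> ln (real k / (exp 1 * (c * D)))"
      using y0 by (intro ln_mono) (auto intro: mult_pos_pos order.strict_trans2)
    then have lnk4: "1 + ln L / 4 \<le> ln (real k / (exp 1 * (c * D)))"
      using y0 by (simp add: ln_mult y_def)
    then have lnk: "l / 4 \<le> ln (real k / (exp 1 * (c * D)))"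
    proof -
      have "0 \<le> ln L" using L by simp
      with lnk4 have "max 1 (ln L) \<le> 4 * ln (real k / (exp 1 * (c * D)))" by linarith
      then show ?thesis by (simp add: l_def pos1_def)
    qed
    have "8 \<le> 4 * exp 2 * c"
    proof -
      have "2 \<le> exp (2 :: real)" using exp_ge_add_one_self[of "2 :: real"] by simp
      then show ?thesis using c mult_mono[of 2 "exp 2" 1 c] by (simp add: mult.commute)
    qed
    then have "8 * (L / l) \<le> real k"
      using kL mult_right_mono[of 8 "4 * exp 2 * c" "L / l"] l L by auto
    then have "8 * (L / l) * (l / 4) \<le> real k * ln (real k / (exp 1 * (c * D)))"
      using lnk l by (intro mult_mono) auto
    then show ?thesis using l by simp
  next
    case False
    \<comment> \<open>One factor of \<open>exp 2\<close> cancels the \<open>exp 1\<close> in the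
      goal, the other makes the logarithm at least 1.\<close>
    have "exp 1 * (exp 1 * (c * D)) \<le> 4 * exp 2 * c * D"
      using c D by (simp add: e)
    then have "exp 1 \<le> real k / (exp 1 * (c * D))"
      using k1 cD by (simp add: pos_le_divide_eq)
    then have "ln (exp 1) \<le> ln (real k / (exp 1 * (c * D)))"
      by (intro ln_mono) (auto intro: order.strict_trans2[OF exp_gt_zero])
    then have 1: "1 \<le> ln (real k / (exp 1 * (c * D)))" by simp
    have "ln (sqrt L) \<le> ln D" using False L by (intro ln_mono) auto
    then have "ln L / 2 \<le> ln D" using L by (simp add: ln_sqrt)
    then have "l / 2 \<le> pos1 (ln D)" by (auto simp: l_def pos1_def)
    then have "l / 2 * L / l \<le> ?M" using l L by (intro divide_right_mono mult_right_mono) auto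
    then have "L / 2 \<le> ?M" using l by simp
    then have "2 * L \<le> real k" using k3 by linarith
    then show ?thesis using 1 mult_mono[of "2 * L" "real k" 1 "ln (real k / (exp 1 * (c * D)))"] L
      by simp
  qed
qed

text \<open>The final bound contains \<open>ln (ln n)\<close>, but the estimate is applied to the
  truncated \<open>L = pos1 (ln n)\<close>. For \<open>ln n < 1\<close> both sides are 1.\<close>

lemma pos1_ln_ln: "pos1 (ln (ln (real n))) = pos1 (ln (pos1 (ln (real n))))"
proof (cases "1 \<le> ln (real n)")
  case True
  then show ?thesis by (simp add: pos1_def)
next
  case False
  have "ln (ln (real n)) \<le> 0"
  proof (cases "n \<le> 1")
    case True
    then have "n = 0 \<or> n = 1" by auto
    then show ?thesis by auto
  next
    case n: False
    then have "0 < ln (real n)" by simp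
    then show ?thesis using False by simp
  qed
  then show ?thesis using False by (simp add: pos1_def)
qed

lemma pos1_ln_pos1: "pos1 (ln (pos1 (real d))) = pos1 (ln (real d))"
  by (cases "d = 0") (auto simp: pos1_def max_def)

lemma rounds_le:
  assumes "0 < \<epsilon>"
  shows "real (Suc (rounds \<epsilon> n)) \<le> (3 + 1 / ln (1 + \<epsilon>)) * pos1 (ln n)"
proof -
  have ln: "0 < ln (1 + \<epsilon>)" using assms by simp
  have "0 \<le> ln (real n)" by (cases n) auto
  then have "0 \<le> ln n / ln (1 + \<epsilon>)" using ln by simp
  then have "real (rounds \<epsilon> n) \<le> 2 + ln n / ln (1 + \<epsilon>)" unfolding rounds_def by linarith
  also have "ln n / ln (1 + \<epsilon>) \<le> pos1 (ln n) / ln (1 + \<epsilon>)"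
    using ln by (intro divide_right_mono) auto
  finally have "real (Suc (rounds \<epsilon> n)) \<le> 3 * 1 + pos1 (ln n) / ln (1 + \<epsilon>)" by simp
  also have "\<dots> \<le> 3 * pos1 (ln n) + pos1 (ln n) / ln (1 + \<epsilon>)" by simp
  finally show ?thesis by (simp add: algebra_simps)
qed

section \<open>The expected height\<close>

lemma expectation_random_order:
  "measure_pmf.expectation (random_order n) f = (\<Sum>\<pi> | \<pi> permutes {..<n}. f \<pi>) / fact n"
  for f :: "(nat \<Rightarrow> nat) \<Rightarrow> real"
proof -
  have "{\<pi>. \<pi> permutes {..<n}} \<noteq> {}" using permutes_id by blast
  then show ?thesis
    by (simp add: random_order_def integral_pmf_of_set finite_permutations card_permutations)
qed

text \<open>\<open>K\<close> is fixed before the order is drawn and depends on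
  \<open>\<epsilon>\<close>, \<open>n\<close> and \<open>E\<close> only.\<close>

lemma expectation_height_bound:
  assumes "0 < \<epsilon>"
  shows "\<exists>C>0. \<forall>n E. simple_graph n E \<longrightarrow> (\<exists>K.
    measure_pmf.expectation (random_order n) (\<lambda>\<pi>. real (height_bound \<epsilon> n E K \<pi>)) \<le>
      C * (pos1 (ln n) * (pos1 (degeneracy n E) +
        pos1 (ln (degeneracy n E)) * pos1 (ln n) / pos1 (ln (ln n)))))"
proof -
  define c where "c = 2 * (1 + \<epsilon>)"
  define C0 where "C0 = 4 * exp 2 * c"
  define C2 where "C2 = 3 + 1 / ln (1 + \<epsilon>)"
  have c: "1 \<le> c" using assms by (simp add: c_def)
  have C0: "1 \<le> C0" using c mult_mono[of 1 "exp 2" 1 c] by (simp add: C0_def)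
  have C2: "0 < C2" using assms by (simp add: C2_def add_pos_nonneg)
  show ?thesis
  \<comment> \<open>The factor 2 comes from rounding \<open>C0 * A\<close> up to \<open>K\<close>,
    the summand 1 from the orders with a long path.\<close>
  proof (intro exI[of _ "2 * C2 * C0 + 1"] conjI allI impI)
    show "0 < 2 * C2 * C0 + 1" using C0 C2 by (simp add: add_pos_pos)
    fix n E assume G: "simple_graph n E"
    define L where "L = pos1 (ln n)"
    define D where "D = pos1 (degeneracy n E)"
    define A where "A = D + pos1 (ln D) * L / pos1 (ln L)"
    have A_eq: "A = pos1 (degeneracy n E) +
        pos1 (ln (degeneracy n E)) * pos1 (ln n) / pos1 (ln (ln n))"
      by (simp add: A_def D_def L_def pos1_ln_ln pos1_ln_pos1)
    have L: "1 \<le> L" and D: "1 \<le> D" by (simp_all add: L_def D_def)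
    have p1: "0 < pos1 z" "0 \<le> pos1 z" for z using pos1_ge_1[of z] by linarith+
    have A: "1 \<le> A"
      using D L p1 unfolding A_def by (intro order.trans[OF D]) auto
    define K where "K = nat \<lceil>C0 * A\<rceil>"
    have CA: "1 \<le> C0 * A" using mult_mono[of 1 C0 1 A] C0 A by simp
    have K: "C0 * A \<le> real K" "real K \<le> 2 * (C0 * A)" using CA unfolding K_def by linarith+
    have K1: "1 \<le> K" using K(1) CA by linarith
    let ?bad = "{\<pi>. \<pi> permutes {..<n} \<and> long_path \<epsilon> n E K \<pi>}"
    let ?perm = "{\<pi>. \<pi> permutes {..<n}}"
    have fin: "finite ?perm" by (simp add: finite_permutations)
    have h1: "(c * D) ^ K / fact K \<le> exp (- (2 * L))"
      using c D L K(1) K1 by (intro power_div_fact_le path_length_suffices) (auto simp: A_def C0_def)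
    have "max 1 (real n) \<le> exp L"
    proof (cases "n = 0")
      case False
      then have "real n = exp (ln n)" by simp
      also have "\<dots> \<le> exp L" by (simp add: L_def)
      finally show ?thesis using L by simp
    qed (use L in auto)
    \<comment> \<open>One factor \<open>n\<close> counts the start vertices of paths, the other is
      the height in the bad case. Together they explain the exponent \<open>2 * L\<close>.\<close>
    then have h2: "max 1 (real n) * real n \<le> exp L * exp L" by (intro mult_mono) auto
    have "(max 1 (real n) * real n) * ((c * D) ^ K / fact K) \<le> (exp L * exp L) * exp (- (2 * L))"
      by (rule mult_mono[OF h2 h1]) (use c D in auto)
    also have "\<dots> = 1" by (simp flip: exp_add)
    finally have small: "max 1 (real n) * real n * (c * D) ^ K \<le> fact K" by (simp add: field_simps)
    have "real (card ?bad) * fact K \<le> max 1 (real n) * (c * D) ^ K * fact n"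
      using c D by (intro card_long_path_le[OF assms G])
        (auto simp: c_def D_def intro: order.trans[OF _ mult_mono[of 1 _ 1]])
    then have "real n * (real (card ?bad) * fact K) \<le> real n * (max 1 (real n) * (c * D) ^ K * fact n)"
      by (rule mult_left_mono) simp
    also have "\<dots> = (max 1 (real n) * real n * (c * D) ^ K) * fact n" by (simp add: mult_ac)
    also have "\<dots> \<le> fact K * fact n" using small by (rule mult_right_mono) simp
    finally have "(real n * real (card ?bad)) * fact K \<le> fact n * fact K" by (simp add: mult_ac)
    then have bad: "real n * real (card ?bad) \<le> fact n" by (rule mult_right_le_imp_le) simp
    have "(\<Sum>\<pi>\<in>?perm. real (height_bound \<epsilon> n E K \<pi>)) \<le>
        (\<Sum>\<pi>\<in>?perm. real (Suc (rounds \<epsilon> n) * K) + (if long_path \<epsilon> n E K \<pi> then real n else 0))"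
      by (rule sum_mono) (simp add: height_bound_def)
    also have "\<dots> = fact n * real (Suc (rounds \<epsilon> n) * K) + real n * real (card ?bad)"
      using fin by (simp add: sum.distrib card_permutations sum.If_cases Int_def conj_commute)
    also have "\<dots> \<le> fact n * real (Suc (rounds \<epsilon> n) * K) + fact n" using bad by simp
    finally have "measure_pmf.expectation (random_order n) (\<lambda>\<pi>. real (height_bound \<epsilon> n E K \<pi>)) \<le>
        real (Suc (rounds \<epsilon> n)) * real K + 1"
      unfolding expectation_random_order by (simp add: field_simps)
    also have "\<dots> \<le> (C2 * L) * (2 * (C0 * A)) + L * A"
    proof (rule add_mono)
      show "real (Suc (rounds \<epsilon> n)) * real K \<le> (C2 * L) * (2 * (C0 * A))"
        using rounds_le[OF assms, of n] K(2) C2 L by (intro mult_mono) (auto simp: C2_def L_def)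
      show "1 \<le> L * A" using mult_mono[of 1 L 1 A] L A by simp
    qed
    also have "\<dots> = (2 * C2 * C0 + 1) * (L * A)" by (simp add: algebra_simps)
    finally show "\<exists>K. measure_pmf.expectation (random_order n) (\<lambda>\<pi>. real (height_bound \<epsilon> n E K \<pi>)) \<le>
        (2 * C2 * C0 + 1) * (pos1 (ln n) * (pos1 (degeneracy n E) +
        pos1 (ln (degeneracy n E)) * pos1 (ln n) / pos1 (ln (ln n))))"
      unfolding A_eq L_def by blast
  qed
qed

section \<open>Verification of ADG\<close>

lemma sum_nth:
  assumes "distinct us"
  shows "(\<Sum>i = 0..<length us. f (us ! i)) = (\<Sum>v\<in>set us. f v)"
proof -
  have "bij_betw ((!) us) {0..<length us} (set us)"
    using bij_betw_nth[OF assms, of "{0..<length us}" "set us"] by (simp add: atLeast0LessThan)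
  then show ?thesis by (rule sum.reindex_bij_betw)
qed

definition agrees_on_input :: "nat \<Rightarrow> loc mem \<Rightarrow> loc mem \<Rightarrow> bool" where
  "agrees_on_input n m0 m \<longleftrightarrow> (\<forall>i. m (Off i) = m0 (Off i) \<and> m (Adj i) = m0 (Adj i) \<and>
     m (RandPrio i) = m0 (RandPrio i))"

locale csr_input =
  fixes \<epsilon> :: real and n :: nat and E :: "nat set set" and m0 :: "loc mem"
  assumes eps: "0 < \<epsilon>" and graph: "simple_graph n E" and csr: "csr n E m0"
begin

abbreviation "\<Gamma> \<equiv> procs \<epsilon>"
abbreviation "off \<equiv> \<lambda>v. m0 (Off v)"
abbreviation "adj \<equiv> \<lambda>i. m0 (Adj i)"
abbreviation "deg \<equiv> vertex_degree n E"
abbreviation "N \<equiv> nbrs E {..<n}"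

lemma off_Suc: "v < n \<Longrightarrow> off (Suc v) = off v + deg v"
  using csr by (simp add: csr_def)

lemma adj_bij: "v < n \<Longrightarrow> bij_betw adj {off v..<off (Suc v)} (N v)"
  using csr unfolding csr_def by blast

lemma adj_mem: "v < n \<Longrightarrow> i \<in> {off v..<off (Suc v)} \<Longrightarrow> adj i \<in> N v"
  using adj_bij bij_betwE by blast

lemma adj_less: "v < n \<Longrightarrow> i \<in> {off v..<off (Suc v)} \<Longrightarrow> adj i < n"
  using adj_mem by (fastforce simp: nbrs_iff)

lemma sum_slots: "v < n \<Longrightarrow> (\<Sum>i = off v..<off (Suc v). f (adj i)) = (\<Sum>u\<in>N v. f u)"
  using sum.reindex_bij_betw[OF adj_bij] by blast

lemma sum_slots_const: "v < n \<Longrightarrow> (\<Sum>i = off v..<off (Suc v). c) = deg v * (c :: nat)"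
  using off_Suc by simp

lemma deg_less: "v < n \<Longrightarrow> deg v < n"
  using vertex_degree_less[OF graph] .

subsection \<open>The phases of one round\<close>

lemma adg_init:
  assumes "agrees_on_input n m0 m"
  shows "htri \<Gamma> (7 * n) (5 + 2 * clog n) m (adg_init n) (\<lambda>_ m'. agrees_on_input n m0 m' \<and>
    (\<forall>v<n. m' (Deg v) = deg v \<and> m' (InU v) = 1 \<and> m' (Active 1 v) = v))"
proof -
  \<comment> \<open>The memory after the phase is written down explicitly, and the loop is checked
    against it. Most later phases follow the same scheme.\<close>
  define m1 where "m1 = (\<lambda>l. case l of Deg v \<Rightarrow> if v < n then deg v else m l
    | InU v \<Rightarrow> if v < n then 1 else m l
    | Active k v \<Rightarrow> if k = 1 \<and> v < n then v else m l | _ \<Rightarrow> m l)"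
  have input: "m (Off i) = off i" "m1 (Off i) = off i" for i
    using assms by (simp_all add: agrees_on_input_def m1_def)
  show ?thesis
  proof (rule htri_stri[where ?m1.0 = m1])
    show "stri \<Gamma> UNIV UNIV m m1 (7 * n) (5 + 2 * clog n) {#} (adg_init n)
      (\<lambda>x r. \<forall>v\<in>{0..<n}. {Deg v, InU v, Active 1 v} \<subseteq> set_mset r)"
      unfolding adg_init_def
      by (rule stri_parfor[where w = "\<lambda>_. 5" and d = 5])
        (auto intro!: stri_Read stri_Write stri_Ret simp: input off_Suc, auto simp: m1_def)
    fix x r assume r: "\<forall>v\<in>{0..<n}. {Deg v, InU v, Active 1 v} \<subseteq> set_mset r"
    have "l \<in># r" if "m l \<noteq> m1 l" for l
      using that r by (cases l) (auto simp: m1_def split: if_splits)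
    then show "(\<forall>l. m l \<noteq> m1 l \<longrightarrow> l \<in># r) \<and> agrees_on_input n m0 m1 \<and>
      (\<forall>v<n. m1 (Deg v) = deg v \<and> m1 (InU v) = 1 \<and> m1 (Active 1 v) = v)"
      using assms by (auto simp: m1_def agrees_on_input_def)
  qed
qed

end

text \<open>Here \<open>R\<close> is an arbitrary subset of \<open>U\<close>; it is tied to the
  degree test only in \<open>set_InR\<close>.\<close>

locale round_phases = csr_input +
  fixes U R :: "nat set" and us :: "nat list" and l :: nat
  assumes U: "U \<subseteq> {..<n}" and R: "R \<subseteq> U" and us: "distinct us" "set us = U"
begin

definition "good m \<longleftrightarrow> agrees_on_input n m0 m \<and> (\<forall>i<length us. m (Active l i) = us ! i)"

lemma us_less: "i < length us \<Longrightarrow> us ! i < n"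
  using U us nth_mem by blast

lemma us_mem: "i < length us \<Longrightarrow> us ! i \<in> U"
  using us nth_mem by blast

lemma card_U: "card U = length us"
  using distinct_card[OF us(1)] us(2) by simp

lemma U_us: "v \<in> U \<Longrightarrow> \<exists>i<length us. us ! i = v"
  using us by (auto simp: in_set_conv_nth)

lemma sum_degrees:
  assumes "good m"
  shows "htri \<Gamma> (4 * length us) (2 + 2 * clog (length us)) m
    (reduce (+) 0 (\<lambda>i. do { v \<leftarrow> read (Active l i); read (Deg v) }) 0 (length us))
    (\<lambda>x m'. x = (\<Sum>v\<in>U. m (Deg v)) \<and> m' = m)" (is "htri _ _ _ _ ?p _")
proof (rule htri_stri[where ?m1.0 = m])
  show "stri \<Gamma> UNIV UNIV m m (4 * length us) (2 + 2 * clog (length us)) {#} ?p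
    (\<lambda>x r. x = (\<Sum>i = 0..<length us. m (Deg (us ! i))) \<and> (\<forall>i\<in>{0..<length us}. {} \<subseteq> set_mset r))"
    by (rule stri_reduce[where w = "\<lambda>_. 2" and d = 2])
      (use assms in \<open>auto intro!: stri_Read stri_Ret simp: good_def sum.atLeastLessThan_concat\<close>)
qed (use us sum_nth[of us "\<lambda>v. m (Deg v)"] in auto)

lemma set_InR:
  assumes "good m" "\<And>v. v \<in> U \<Longrightarrow> v \<in> R \<longleftrightarrow> P (m (Deg v))"
  shows "htri \<Gamma> (5 * length us) (3 + 2 * clog (length us)) m
    (parfor 0 (length us) (\<lambda>i. do {
       v \<leftarrow> read (Active l i);
       d \<leftarrow> read (Deg v);
       write (InR v) (if P d then 1 else 0)
     }))
    (\<lambda>x m'. (\<forall>v\<in>U. m' (InR v) = (if v \<in> R then 1 else 0)) \<and> (\<forall>l. (\<forall>v. l \<noteq> InR v) \<longrightarrow> m' l = m l))"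
    (is "htri _ _ _ _ (parfor _ _ ?body) _")
proof -
  define m1 where "m1 = (\<lambda>l. case l of InR v \<Rightarrow> if v \<in> U then if v \<in> R then 1 else 0 else m l | _ \<Rightarrow> m l)"
  show ?thesis
  proof (rule htri_stri[where ?m1.0 = m1])
    show "stri \<Gamma> UNIV UNIV m m1 (5 * length us) (3 + 2 * clog (length us)) {#}
      (parfor 0 (length us) ?body) (\<lambda>x r. \<forall>i\<in>{0..<length us}. {InR (us ! i)} \<subseteq> set_mset r)"
      by (rule stri_parfor[where w = "\<lambda>_. 3" and d = 3])
        (use assms us_mem in \<open>auto intro!: stri_Read stri_Write stri_Ret simp: good_def m1_def\<close>)
    fix x r assume r: "\<forall>i\<in>{0..<length us}. {InR (us ! i)} \<subseteq> set_mset r"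
    have "l \<in># r" if "m l \<noteq> m1 l" for l
      using that r U_us by (cases l) (fastforce simp: m1_def split: if_splits)+
    then show "(\<forall>l. m l \<noteq> m1 l \<longrightarrow> l \<in># r) \<and> (\<forall>v\<in>U. m1 (InR v) = (if v \<in> R then 1 else 0)) \<and>
      (\<forall>l. (\<forall>v. l \<noteq> InR v) \<longrightarrow> m1 l = m l)"
      by (auto simp: m1_def split: loc.split)
  qed
qed

text \<open>Serves two loops: \<open>c = InU\<close> with value 0, and \<open>c = AdgPrio\<close>
  with the round number. The written cells must differ from the cells \<open>Active\<close> and
  \<open>InR\<close> that the loop reads.\<close>

lemma set_removed:
  assumes "good m" "\<And>v. v \<in> U \<Longrightarrow> m (InR v) = (if v \<in> R then 1 else 0)"
    and "\<And>v i. c v \<noteq> Active l i" "\<And>v u. c v \<noteq> InR u"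
  shows "htri \<Gamma> (5 * length us) (3 + 2 * clog (length us)) m
    (parfor 0 (length us) (\<lambda>i. do {
       v \<leftarrow> read (Active l i);
       r \<leftarrow> read (InR v);
       when (r = 1) (write (c v) x)
     }))
    (\<lambda>_ m'. (\<forall>v\<in>R. m' (c v) = x) \<and> (\<forall>l. l \<notin> c ` R \<longrightarrow> m' l = m l))"
    (is "htri _ _ _ _ (parfor _ _ ?body) _")
proof -
  define m1 where "m1 = (\<lambda>l. if l \<in> c ` R then x else m l)"
  have nc: "Active l j \<notin> c ` R" "InR u \<notin> c ` R" for j u
    using assms(3,4) by (metis imageE)+
  show ?thesis
  proof (rule htri_stri[where ?m1.0 = m1])
    have "stri \<Gamma> UNIV UNIV m m1 3 3 {#} (?body i) (\<lambda>x r. (if us ! i \<in> R then {c (us ! i)} else {}) \<subseteq> set_mset r)"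
      if "i < length us" for i
    proof -
      have v: "m (Active l i) = us ! i" "m1 (Active l i) = us ! i"
        "m (InR (us ! i)) = (if us ! i \<in> R then 1 else 0)" "m1 (InR (us ! i)) = (if us ! i \<in> R then 1 else 0)"
        using assms(1,2) us_mem[OF that] that nc by (auto simp: good_def m1_def)
      have "us ! i \<in> R \<Longrightarrow> m1 (c (us ! i)) = x" by (simp add: m1_def)
      then show ?thesis
        using v by (cases "us ! i \<in> R") (auto intro!: stri_Read stri_Write stri_Ret)
    qed
    then show "stri \<Gamma> UNIV UNIV m m1 (5 * length us) (3 + 2 * clog (length us)) {#}
      (parfor 0 (length us) ?body) (\<lambda>x r. \<forall>i\<in>{0..<length us}. (if us ! i \<in> R then {c (us ! i)} else {}) \<subseteq> set_mset r)"
      by (intro stri_parfor[where w = "\<lambda>_. 3" and d = 3]) auto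
    fix y r
    assume r: "\<forall>i\<in>{0..<length us}. (if us ! i \<in> R then {c (us ! i)} else {}) \<subseteq> set_mset r"
    have "c v \<in># r" if "v \<in> R" for v
    proof -
      from that R have "v \<in> U" by blast
      then obtain i where "i < length us" "us ! i = v" using U_us by blast
      then show ?thesis using r that by force
    qed
    then show "(\<forall>l. m l \<noteq> m1 l \<longrightarrow> l \<in># r) \<and> (\<forall>v\<in>R. m1 (c v) = x) \<and>
      (\<forall>l. l \<notin> c ` R \<longrightarrow> m1 l = m l)"
      by (auto simp: m1_def)
  qed
qed

text \<open>Here a cell passes through several values, so \<open>settled\<close> does not apply.
  Decrements commute, however: the multiset of vertices decremented so far determines the memory.
  Truncated subtraction composes, so each further decrement preserves the relation.\<close>

definition decremented :: "loc mem \<Rightarrow> loc mem \<Rightarrow> nat multiset \<Rightarrow> bool" where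
  "decremented m m' T \<longleftrightarrow>
    (\<forall>l. m' l = (case l of Deg u \<Rightarrow> m (Deg u) - count T u | _ \<Rightarrow> m l))"

abbreviation "dtri m \<equiv> tri \<Gamma> (decremented m) (\<lambda>_ _. True) (\<lambda>_. 0)"

lemma dtri_Read:
  assumes "\<And>u. l' \<noteq> Deg u" "0 < w" "0 < d" "dtri m (w - 1) (d - 1) \<sigma> (k (m l')) Q"
  shows "dtri m w d \<sigma> (Read l' k) Q"
proof (rule tri_Read[OF assms(3)])
  fix m' o' assume I: "decremented m m' (\<sigma> + o')"
  then have "m' l' = m l'" using assms(1) by (cases l') (auto simp: decremented_def)
  then show "\<exists>\<sigma>' w'. decremented m m' (\<sigma>' + o') \<and> True \<and> w' + 0 < w + 0 \<and>
      dtri m w' (d - 1) \<sigma>' (k (m' l')) Q"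
    using I assms(2,4) by (intro exI[of _ \<sigma>] exI[of _ "w - 1"]) auto
qed

lemma dtri_DecFetch:
  assumes "0 < w" "0 < d" "\<And>x. dtri m (w - 1) (d - 1) (add_mset u \<sigma>) (k x) Q"
  shows "dtri m w d \<sigma> (DecFetch (Deg u) k) Q"
proof (rule tri_DecFetch[OF assms(2)])
  fix m' o' assume I: "decremented m m' (\<sigma> + o')"
  then have "decremented m (m'(Deg u := m' (Deg u) - 1)) (add_mset u \<sigma> + o')"
    by (auto simp: decremented_def split: loc.splits)
  then show "\<exists>\<sigma>' w'. decremented m (m'(Deg u := m' (Deg u) - 1)) (\<sigma>' + o') \<and> True \<and> w' + 0 < w + 0 \<and>
      dtri m w' (d - 1) \<sigma>' (k (m' (Deg u) - 1)) Q"
    using assms(1,3) by (intro exI[of _ "add_mset u \<sigma>"] exI[of _ "w - 1"]) auto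
qed

text \<open>A survivor \<open>u\<close> is hit once by each neighbour in \<open>R\<close>, and the
  degree in \<open>U\<close> minus the degree into \<open>R\<close> is the degree in
  \<open>U - R\<close>. The flags \<open>InU\<close> still include \<open>R\<close> at this point,
  so vertices of \<open>R\<close> are decremented too and the result speaks of survivors
  only.\<close>

lemma decrement:
  assumes "good m" and InR: "\<And>v. v \<in> U \<Longrightarrow> m (InR v) = (if v \<in> R then 1 else 0)"
    and InU: "\<And>v. v < n \<Longrightarrow> m (InU v) = (if v \<in> U then 1 else 0)"
    and Deg: "\<And>v. v \<in> U \<Longrightarrow> m (Deg v) = card (nbrs E U v)"
  shows "htri \<Gamma> (6 * length us + 5 * (\<Sum>v\<in>R. deg v)) (7 + 2 * clog n + 2 * clog (length us)) m
    (parfor 0 (length us) (\<lambda>i. do {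
       v \<leftarrow> read (Active l i);
       r \<leftarrow> read (InR v);
       when (r = 1) (do {
         a \<leftarrow> read (Off v);
         b \<leftarrow> read (Off (Suc v));
         parfor a b (\<lambda>j. do {
           u \<leftarrow> read (Adj j);
           x \<leftarrow> read (InU u);
           when (x = 1) (dec_fetch (Deg u))
         })
       })
     }))
    (\<lambda>_ m'. (\<forall>u\<in>U - R. m' (Deg u) = card (nbrs E (U - R) u)) \<and>
      (\<forall>l. (\<forall>u. l \<noteq> Deg u) \<longrightarrow> m' l = m l))"
    (is "htri _ _ _ _ (parfor _ _ ?body) ?Q")
proof -
  let ?slot = "\<lambda>j. do {
    u \<leftarrow> read (Adj j); x \<leftarrow> read (InU u); when (x = 1) (dec_fetch (Deg u)) } :: (loc, proc) prog"
  define h where "h = (\<lambda>u. if u \<in> U then {#u#} else {#})"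
  define g where "g = (\<lambda>v. if v \<in> R then \<Sum>u\<in>N v. h u else {#})"
  have inp: "m (Off v) = off v" "m (Adj v) = adj v" for v
    using assms(1) by (simp_all add: good_def agrees_on_input_def)
  have slots: "dtri m (5 * deg v) (3 + 2 * clog n) {#}
      (parfor (off v) (off (Suc v)) ?slot) (\<lambda>x r. r = (\<Sum>u\<in>N v. h u))" if v: "v < n" for v
  proof -
    have "dtri m (\<Sum>i = off v..<off (Suc v). 3 + 2) (3 + 2 * clog (off (Suc v) - off v))
      (\<Sum>i = off v..<off (Suc v). {#})
      (parfor (off v) (off (Suc v)) ?slot) (\<lambda>x r. r = (\<Sum>i = off v..<off (Suc v). h (adj i)))"
    proof (rule tri_reduce[where P = "\<lambda>a b x r. r = (\<Sum>i = a..<b. h (adj i))"])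
      fix j assume j: "off v \<le> j" "j < off (Suc v)"
      then have "m (InU (adj j)) = (if adj j \<in> U then 1 else 0)"
        using adj_less[OF v, of j] InU by simp
      then show "dtri m 3 3 {#} (?slot j) (\<lambda>x r. r = (\<Sum>i = j..<Suc j. h (adj i)))"
        by (cases "adj j \<in> U") (auto intro!: dtri_Read dtri_DecFetch tri_Ret simp: inp h_def)
    qed (simp_all add: sum.atLeastLessThan_concat)
    then show ?thesis
      unfolding sum_slots[OF v] sum_slots_const[OF v] sum.neutral_const
      by (rule tri_mono)
        (use off_Suc[OF v] clog_mono[of "deg v" n] deg_less[OF v] in \<open>simp_all\<close>)
  qed
  have body: "dtri m (if us ! i \<in> R then 4 + 5 * deg (us ! i) else 4) (7 + 2 * clog n) {#} (?body i) (\<lambda>x r. r = g (us ! i))" if i: "i < length us" for i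
  proof -
    have v: "m (Active l i) = us ! i" "m (InR (us ! i)) = (if us ! i \<in> R then 1 else 0)"
      using assms(1) InR us_mem[OF i] i by (auto simp: good_def)
    show ?thesis
    proof (cases "us ! i \<in> R")
      case True
      then show ?thesis
        using v slots[OF us_less[OF i]] by (auto intro!: dtri_Read simp: inp g_def)
    next
      case False
      then show ?thesis using v by (auto intro!: dtri_Read tri_Ret simp: g_def)
    qed
  qed
  let ?W = "6 * length us + 5 * (\<Sum>v\<in>R. deg v)"
  have work: "(\<Sum>i = 0..<length us. (if us ! i \<in> R then 4 + 5 * deg (us ! i) else 4) + 2) = ?W"
  proof -
    have "(\<Sum>i = 0..<length us. (if us ! i \<in> R then 4 + 5 * deg (us ! i) else 4) + 2) =
        (\<Sum>v\<in>U. 6 + (if v \<in> R then 5 * deg v else 0))"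
      unfolding us(2)[symmetric] sum_nth[OF us(1), symmetric] by (intro sum.cong) auto
    also have "\<dots> = 6 * card U + (\<Sum>v\<in>U \<inter> R. 5 * deg v)"
      using us sum.inter_restrict[of U "\<lambda>v. 5 * deg v" R] by (auto simp: sum.distrib)
    also have "U \<inter> R = R" using R by blast
    finally show ?thesis by (simp add: card_U sum_distrib_left)
  qed
  have "dtri m (\<Sum>i = 0..<length us. (if us ! i \<in> R then 4 + 5 * deg (us ! i) else 4) + 2)
      (7 + 2 * clog n + 2 * clog (length us - 0)) (\<Sum>i = 0..<length us. {#})
    (parfor 0 (length us) ?body) (\<lambda>x r. r = (\<Sum>i = 0..<length us. g (us ! i)))"
    by (rule tri_reduce[where P = "\<lambda>a b x r. r = (\<Sum>i = a..<b. g (us ! i))"])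
      (use body in \<open>auto simp: sum.atLeastLessThan_concat\<close>)
  note main = this[unfolded work sum_nth[OF us(1)] us(2) sum.neutral_const diff_zero]
  have finU: "finite U" using us(2) by auto
  have cnt: "count (\<Sum>v\<in>U. g v) u = card (nbrs E R u)" if u: "u \<in> U - R" for u
  proof -
    have "count (g v) u = (if v \<in> R \<and> {u, v} \<in> E then 1 else 0)" if "v \<in> U" for v
    proof -
      have "count (\<Sum>w\<in>N v. h w) u = (\<Sum>w\<in>N v. if w = u then 1 else 0)"
        unfolding count_sum by (rule sum.cong) (use u in \<open>auto simp: h_def\<close>)
      then show ?thesis using u U by (auto simp: g_def nbrs_iff)
    qed
    then have "count (\<Sum>v\<in>U. g v) u = (\<Sum>v\<in>U. if v \<in> R \<and> {u, v} \<in> E then 1 else 0)"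
      by (simp add: count_sum)
    also have "\<dots> = card (U \<inter> {v. v \<in> R \<and> {u, v} \<in> E})" using finU by (simp add: sum.If_cases)
    also have "U \<inter> {v. v \<in> R \<and> {u, v} \<in> E} = nbrs E R u"
      using R by (auto simp: nbrs_iff insert_commute)
    finally show ?thesis .
  qed
  have "htri \<Gamma> (?W + 0) (7 + 2 * clog n + 2 * clog (length us)) m
    (parfor 0 (length us) ?body) ?Q"
  proof (rule htri_nest[OF main])
    show "decremented m m {#}" by (simp add: decremented_def split: loc.split)
    fix x \<sigma> m' assume \<sigma>: "\<sigma> = (\<Sum>v\<in>U. g v)" and I: "decremented m m' \<sigma>"
    have "m' (Deg u) = card (nbrs E (U - R) u)" if u: "u \<in> U - R" for u
    proof -
      have "card (nbrs E U u) = card (nbrs E R u \<union> nbrs E (U - R) u)"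
        using R by (intro arg_cong[of _ _ card]) (auto simp: nbrs_iff)
      also have "\<dots> = card (nbrs E R u) + card (nbrs E (U - R) u)"
        using finU R by (intro card_Un_disjoint) (auto simp: nbrs_iff intro: finite_nbrs finite_subset)
      finally show ?thesis
        using I cnt[OF u] Deg u by (simp add: decremented_def \<sigma>)
    qed
    moreover have "m' l = m l" if "\<forall>u. l \<noteq> Deg u" for l
      using I that by (cases l) (auto simp: decremented_def)
    ultimately show "(\<forall>u\<in>U - R. m' (Deg u) = card (nbrs E (U - R) u)) \<and>
      (\<forall>l. (\<forall>u. l \<noteq> Deg u) \<longrightarrow> m' l = m l)" by blast
  qed
  then show ?thesis by simp
qed

section \<open>Compaction of the survivors by prefix sums\<close>

definition "kept lo hi = filter (\<lambda>v. v \<notin> R) (map ((!) us) [lo..<hi])"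

lemma kept_append: "lo \<le> mid \<Longrightarrow> mid \<le> hi \<Longrightarrow> kept lo hi = kept lo mid @ kept mid hi"
  using upt_add_eq_append[of lo mid "hi - mid"] by (simp add: kept_def)

lemma kept_single: "kept i (Suc i) = (if us ! i \<in> R then [] else [us ! i])"
  by (simp add: kept_def)

lemma kept_all: "kept 0 (length us) = filter (\<lambda>v. v \<notin> R) us"
  by (simp add: kept_def map_nth)

text \<open>The table that \<open>count_active\<close> leaves behind, following its recursion tree.
  Every interior position is the split point of exactly one interval, so entries never
  collide.\<close>

function left_counts :: "(nat \<Rightarrow> nat) \<Rightarrow> nat \<Rightarrow> nat \<Rightarrow> bool" where
  "left_counts c lo hi \<longleftrightarrow> (if hi \<le> Suc lo then True else let mid = (lo + hi) div 2 in
     c mid = length (kept lo mid) \<and> left_counts c lo mid \<and> left_counts c mid hi)"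
  by pat_completeness auto
termination by (relation "Wellfounded.measure (\<lambda>(c, lo, hi). hi - lo)") auto

declare left_counts.simps [simp del]

lemma left_counts_cong:
  "(\<And>p. lo < p \<Longrightarrow> p < hi \<Longrightarrow> c p = c' p) \<Longrightarrow> left_counts c lo hi = left_counts c' lo hi"
proof (induction "hi - lo" arbitrary: lo hi rule: less_induct)
  case less
  show ?case
  proof (cases "hi \<le> Suc lo")
    case False
    let ?m = "(lo + hi) div 2"
    have m: "lo < ?m" "?m < hi" "?m - lo < hi - lo" "hi - ?m < hi - lo" using False by linarith+
    have "left_counts c lo ?m = left_counts c' lo ?m" "left_counts c ?m hi = left_counts c' ?m hi"
      using m by (auto intro!: less)
    then show ?thesis
      using False m less.prems[of ?m]
      by (simp add: left_counts.simps[of c lo hi] left_counts.simps[of c' lo hi] Let_def)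
  qed (simp add: left_counts.simps[of _ lo hi])
qed

text \<open>\<open>stri\<close> needs the final memory in advance, hence this table must be known to
  exist. The tables of the two halves and the entry at the midpoint concern disjoint positions and
  can be glued.\<close>

lemma left_counts_exists: "\<exists>c. left_counts c lo hi"
proof (induction "hi - lo" arbitrary: lo hi rule: less_induct)
  case less
  show ?case
  proof (cases "hi \<le> Suc lo")
    case False
    let ?m = "(lo + hi) div 2"
    have m: "lo < ?m" "?m < hi" "?m - lo < hi - lo" "hi - ?m < hi - lo" using False by linarith+
    obtain c1 c2 where c: "left_counts c1 lo ?m" "left_counts c2 ?m hi"
      using less m by blast
    define c where "c = (\<lambda>p. if p < ?m then c1 p else if p = ?m then length (kept lo ?m) else c2 p)"
    have "left_counts c lo ?m" "left_counts c ?m hi"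
      using c left_counts_cong[of lo ?m c c1] left_counts_cong[of ?m hi c c2] by (auto simp: c_def)
    then have "left_counts c lo hi"
      by (subst left_counts.simps) (simp add: Let_def c_def)
    then show ?thesis by blast
  qed (simp add: left_counts.simps[of _ lo hi])
qed

text \<open>A leaf costs 2 steps and an inner node 3 (fork, join, write), so \<open>k\<close>
  positions cost \<open>2 * k + 3 * (k - 1) = 5 * k - 3\<close>.\<close>

lemma stri_count_active:
  assumes m1: "\<And>i. i < length us \<Longrightarrow> m (Active l i) = us ! i \<and> m1 (Active l i) = us ! i"
    "\<And>v. v \<in> U \<Longrightarrow> m (InR v) = (if v \<in> R then 1 else 0) \<and> m1 (InR v) = (if v \<in> R then 1 else 0)"
    and "left_counts (\<lambda>p. m1 (LeftCount p)) lo hi" "lo < hi" "hi \<le> length us"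
  shows "stri \<Gamma> UNIV UNIV m m1 (5 * (hi - lo) - 3) (2 + 3 * clog (hi - lo)) {#} (count_active l lo hi)
    (\<lambda>x r. x = length (kept lo hi) \<and> LeftCount ` {lo<..<hi} \<subseteq> set_mset r)"
  using assms(3-)
proof (induction "hi - lo" arbitrary: lo hi rule: less_induct)
  case less
  show ?case
  proof (cases "hi = Suc lo")
    case True
    have "lo < length us" using less.prems by simp
    then have "m (Active l lo) = us ! lo" "m1 (Active l lo) = us ! lo"
      "m (InR (us ! lo)) = (if us ! lo \<in> R then 1 else 0)"
      "m1 (InR (us ! lo)) = (if us ! lo \<in> R then 1 else 0)"
      using m1 us_mem by blast+
    then show ?thesis
      unfolding True
      by (subst count_active.simps) (auto intro!: stri_Read stri_Ret simp: kept_single)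
  next
    case False
    let ?m = "(lo + hi) div 2"
    let ?h = "Suc (hi - lo) div 2"
    have c: "lo < ?m" "?m < hi" "?m - lo \<le> ?h" "hi - ?m \<le> ?h" "?m - lo < hi - lo" "hi - ?m < hi - lo"
      using less.prems False by linarith+
    have mle: "?m \<le> length us" using c(2) less.prems(3) by simp
    have clog: "clog (hi - lo) = Suc (clog ?h)"
      using less.prems False by (subst clog.simps) auto
    have lc: "m1 (LeftCount ?m) = length (kept lo ?m)" "left_counts (\<lambda>p. m1 (LeftCount p)) lo ?m"
      "left_counts (\<lambda>p. m1 (LeftCount p)) ?m hi"
      using less.prems(1,2) False by (auto simp: left_counts.simps[of _ lo hi] Let_def)
    have eq: "count_active l lo hi = Fork (count_active l lo ?m) (count_active l ?m hi)
         (\<lambda>x y. do { write (LeftCount ?m) x; Ret (x + y) })"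
      using less.prems False by (subst count_active.simps) (simp add: Let_def)
    show ?thesis
      unfolding eq
    proof (rule stri_Fork[where ?d1.0 = "2 + 3 * clog ?h" and ?d3.0 = 1 and ?w3.0 = 1])
      show "stri \<Gamma> UNIV UNIV m m1 (5 * (?m - lo) - 3) (2 + 3 * clog ?h) {#} (count_active l lo ?m)
         (\<lambda>x r. x = length (kept lo ?m) \<and> LeftCount ` {lo<..<?m} \<subseteq> set_mset r)"
        by (rule stri_mono[OF less(1)[OF c(5) lc(2)]], (rule c mle less.prems(3))+)
          (simp_all only: mult_le_mono2[OF clog_mono[OF c(3)]] add_left_mono le_refl)
      show "stri \<Gamma> UNIV UNIV m m1 (5 * (hi - ?m) - 3) (2 + 3 * clog ?h) {#} (count_active l ?m hi)
         (\<lambda>x r. x = length (kept ?m hi) \<and> LeftCount ` {?m<..<hi} \<subseteq> set_mset r)"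
        by (rule stri_mono[OF less(1)[OF c(6) lc(3)]], (rule c mle less.prems(3))+)
          (simp_all only: mult_le_mono2[OF clog_mono[OF c(4)]] add_left_mono le_refl)
      show "5 * (?m - lo) - 3 + (5 * (hi - ?m) - 3) + 1 + 2 \<le> 5 * (hi - lo) - 3"
      proof -
        have "5 * x - 3 + (5 * y - 3) + 1 + 2 \<le> 5 * (x + y) - 3" if "1 \<le> x" "1 \<le> y" for x y :: nat
          using that by (cases x; cases y) simp_all
        from this[of "?m - lo" "hi - ?m"] show ?thesis using c(1,2) by simp
      qed
      show "2 + 3 * clog ?h + 1 + 2 \<le> 2 + 3 * clog (hi - lo)" using clog by simp
      fix x y r s
      assume x: "x = length (kept lo ?m) \<and> LeftCount ` {lo<..<?m} \<subseteq> set_mset r"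
        and y: "y = length (kept ?m hi) \<and> LeftCount ` {?m<..<hi} \<subseteq> set_mset s"
      have "{a<..<b} = {a<..<p} \<union> {p} \<union> {p<..<b}" if "a < p" "p < b" for a b p :: nat
        using that by auto
      from this[OF c(1,2)] have "LeftCount ` {lo<..<hi} \<subseteq> set_mset (add_mset (LeftCount ?m) (r + s))"
        using x y unfolding image_Un by auto
      moreover have "x + y = length (kept lo hi)" using x y kept_append[OF less_imp_le[OF c(1)] less_imp_le[OF c(2)]] by simp
      ultimately show "stri \<Gamma> UNIV UNIV m m1 1 1 (r + s) (do { write (LeftCount ?m) x; Ret (x + y) })
          (\<lambda>x r. x = length (kept lo hi) \<and> LeftCount ` {lo<..<hi} \<subseteq> set_mset r)"
        using x lc(1) by (auto intro!: stri_Write stri_Ret)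
    qed
  qed
qed

text \<open>\<open>length (kept 0 lo)\<close>, the number of survivors to the left, is the write
  position. A leaf costs at most 3 steps, an inner node 3 (read, fork, join).\<close>

lemma stri_scatter_active:
  assumes m1: "\<And>i. i < length us \<Longrightarrow> m (Active l i) = us ! i \<and> m1 (Active l i) = us ! i"
    "\<And>v. v \<in> U \<Longrightarrow> m (InR v) = (if v \<in> R then 1 else 0) \<and> m1 (InR v) = (if v \<in> R then 1 else 0)"
    "\<And>p. m1 (LeftCount p) = m (LeftCount p)"
    "\<And>j. j < length (kept 0 (length us)) \<Longrightarrow> m1 (Active (Suc l) j) = kept 0 (length us) ! j"
    and "left_counts (\<lambda>p. m (LeftCount p)) lo hi" "lo < hi" "hi \<le> length us"
  shows "stri \<Gamma> UNIV UNIV m m1 (6 * (hi - lo) - 3) (3 + 3 * clog (hi - lo)) {#}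
    (scatter_active l (length (kept 0 lo)) lo hi)
    (\<lambda>x r. Active (Suc l) ` {length (kept 0 lo)..<length (kept 0 hi)} \<subseteq> set_mset r)"
  using assms(5-)
proof (induction "hi - lo" arbitrary: lo hi rule: less_induct)
  case less
  show ?case
  proof (cases "hi = Suc lo")
    case True
    show ?thesis
    proof (cases "us ! lo \<in> R")
      case R: True
      then show ?thesis
        using less.prems m1 us_mem[of lo] True kept_append[of 0 lo hi]
        by (subst scatter_active.simps) (auto intro!: stri_Read stri_Ret simp: kept_single)
    next
      case R: False
      have hi: "kept 0 hi = kept 0 lo @ [us ! lo]"
        using True R kept_append[of 0 lo hi] by (simp add: kept_single)
      have "kept 0 (length us) = kept 0 hi @ kept hi (length us)"
        using less.prems kept_append[of 0 hi "length us"] by simp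
      then have "m1 (Active (Suc l) (length (kept 0 lo))) = us ! lo"
        using m1(4)[of "length (kept 0 lo)"] by (simp add: hi nth_append)
      moreover have cells: "Active (Suc l) ` {length (kept 0 lo)..<length (kept 0 hi)} =
          {Active (Suc l) (length (kept 0 lo))}" by (simp add: hi)
      moreover have "m (Active l lo) = us ! lo" "m1 (Active l lo) = us ! lo"
        "m (InR (us ! lo)) = 0" "m1 (InR (us ! lo)) = 0"
        using m1(1)[of lo] m1(2)[of "us ! lo"] us_mem[of lo] less.prems R by auto
      moreover have "scatter_active l base lo hi = Read (Active l lo) (\<lambda>v. Read (InR v)
          (\<lambda>r. when (r \<noteq> 1) (write (Active (Suc l) base) v)))" for base
        using True by (subst scatter_active.simps) simp
      ultimately show ?thesis
        using True by (simp only:) (rule stri_Read; simp add: stri_Read stri_Write stri_Ret)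
    qed
  next
    case False
    let ?m = "(lo + hi) div 2"
    let ?h = "Suc (hi - lo) div 2"
    have c: "lo < ?m" "?m < hi" "?m - lo \<le> ?h" "hi - ?m \<le> ?h" "?m - lo < hi - lo" "hi - ?m < hi - lo"
      using less.prems False by linarith+
    have mle: "?m \<le> length us" using c(2) less.prems(3) by simp
    have clog: "clog (hi - lo) = Suc (clog ?h)"
      using less.prems False by (subst clog.simps) auto
    have lc: "m (LeftCount ?m) = length (kept lo ?m)" "left_counts (\<lambda>p. m (LeftCount p)) lo ?m"
      "left_counts (\<lambda>p. m (LeftCount p)) ?m hi"
      using less.prems(1,2) False by (auto simp: left_counts.simps[of _ lo hi] Let_def)
    have len: "length (kept 0 lo) + length (kept lo ?m) = length (kept 0 ?m)"
      "length (kept 0 lo) \<le> length (kept 0 ?m)" "length (kept 0 ?m) \<le> length (kept 0 hi)"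
      using kept_append[OF le0 less_imp_le[OF c(1)]] kept_append[OF le0 less_imp_le[OF c(2)]]
      by simp_all
    have fork: "stri \<Gamma> UNIV UNIV m m1 (6 * (hi - lo) - 3 - 1) (3 + 3 * clog (hi - lo) - 1) {#}
      (Fork (scatter_active l (length (kept 0 lo)) lo ?m)
        (scatter_active l (length (kept 0 ?m)) ?m hi) (\<lambda>_ _. Ret 0))
      (\<lambda>x r. Active (Suc l) ` {length (kept 0 lo)..<length (kept 0 hi)} \<subseteq> set_mset r)"
    proof (rule stri_Fork[where ?d1.0 = "3 + 3 * clog ?h" and ?d3.0 = 0 and ?w3.0 = 0])
      show "stri \<Gamma> UNIV UNIV m m1 (6 * (?m - lo) - 3) (3 + 3 * clog ?h) {#}
          (scatter_active l (length (kept 0 lo)) lo ?m)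
          (\<lambda>x r. Active (Suc l) ` {length (kept 0 lo)..<length (kept 0 ?m)} \<subseteq> set_mset r)"
        by (rule stri_mono[OF less(1)[OF c(5) lc(2)]], (rule c mle less.prems(3))+)
          (simp_all only: mult_le_mono2[OF clog_mono[OF c(3)]] add_left_mono le_refl)
      show "stri \<Gamma> UNIV UNIV m m1 (6 * (hi - ?m) - 3) (3 + 3 * clog ?h) {#}
          (scatter_active l (length (kept 0 ?m)) ?m hi)
          (\<lambda>x r. Active (Suc l) ` {length (kept 0 ?m)..<length (kept 0 hi)} \<subseteq> set_mset r)"
        by (rule stri_mono[OF less(1)[OF c(6) lc(3)]], (rule c mle less.prems(3))+)
          (simp_all only: mult_le_mono2[OF clog_mono[OF c(4)]] add_left_mono le_refl)
      show "6 * (?m - lo) - 3 + (6 * (hi - ?m) - 3) + 0 + 2 \<le> 6 * (hi - lo) - 3 - 1"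
      proof -
        have "6 * x - 3 + (6 * y - 3) + 0 + 2 \<le> 6 * (x + y) - 3 - 1" if "1 \<le> x" "1 \<le> y" for x y :: nat
          using that by (cases x; cases y) simp_all
        from this[of "?m - lo" "hi - ?m"] show ?thesis using c(1,2) by simp
      qed
      show "3 + 3 * clog ?h + 0 + 2 \<le> 3 + 3 * clog (hi - lo) - 1" using clog by simp
      fix x y r s
      assume r: "Active (Suc l) ` {length (kept 0 lo)..<length (kept 0 ?m)} \<subseteq> set_mset r"
        and s: "Active (Suc l) ` {length (kept 0 ?m)..<length (kept 0 hi)} \<subseteq> set_mset s"
      have "{length (kept 0 lo)..<length (kept 0 hi)} =
          {length (kept 0 lo)..<length (kept 0 ?m)} \<union> {length (kept 0 ?m)..<length (kept 0 hi)}"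
        using ivl_disj_un_two(3)[OF len(2,3)] by blast
      then show "stri \<Gamma> UNIV UNIV m m1 0 0 (r + s) (Ret 0)
          (\<lambda>x r. Active (Suc l) ` {length (kept 0 lo)..<length (kept 0 hi)} \<subseteq> set_mset r)"
        using r s by (auto intro!: stri_Ret simp: image_Un)
    qed
    have eq: "scatter_active l (length (kept 0 lo)) lo hi = Read (LeftCount ?m) (\<lambda>c.
        Fork (scatter_active l (length (kept 0 lo)) lo ?m)
          (scatter_active l (length (kept 0 lo) + c) ?m hi) (\<lambda>_ _. Ret 0))"
      using less.prems False by (subst scatter_active.simps) (simp add: Let_def)
    show ?thesis
      unfolding eq by (rule stri_Read) (use fork c(1,2) m1(3) lc(1) len(1) in \<open>simp_all\<close>)
  qed
qed

lemma count_survivors: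
  assumes "good m" and InR: "\<And>v. v \<in> U \<Longrightarrow> m (InR v) = (if v \<in> R then 1 else 0)" and "us \<noteq> []"
  shows "htri \<Gamma> (5 * length us) (2 + 3 * clog (length us)) m (count_active l 0 (length us))
    (\<lambda>x m'. x = length (kept 0 (length us)) \<and> left_counts (\<lambda>p. m' (LeftCount p)) 0 (length us) \<and>
      (\<forall>l. (\<forall>p. l \<noteq> LeftCount p) \<longrightarrow> m' l = m l))"
proof -
  let ?k = "length us"
  obtain c where c: "left_counts c 0 ?k" using left_counts_exists by blast
  define m1 where "m1 = (\<lambda>l. case l of LeftCount p \<Rightarrow> if 0 < p \<and> p < ?k then c p else m l | _ \<Rightarrow> m l)"
  have lc: "left_counts (\<lambda>p. m1 (LeftCount p)) 0 ?k"
    using left_counts_cong[of 0 ?k c "\<lambda>p. m1 (LeftCount p)"] c by (simp add: m1_def)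
  have "stri \<Gamma> UNIV UNIV m m1 (5 * (?k - 0) - 3) (2 + 3 * clog (?k - 0)) {#} (count_active l 0 ?k)
    (\<lambda>x r. x = length (kept 0 ?k) \<and> LeftCount ` {0<..<?k} \<subseteq> set_mset r)"
    using assms by (intro stri_count_active lc) (auto simp: m1_def good_def)
  then show ?thesis
  proof (intro htri_mono[OF htri_stri])
    fix x r assume x: "x = length (kept 0 ?k) \<and> LeftCount ` {0<..<?k} \<subseteq> set_mset r"
    have "l' \<in># r" if "m l' \<noteq> m1 l'" for l'
      using that x by (cases l') (auto simp: m1_def split: if_splits)
    then show "(\<forall>l. m l \<noteq> m1 l \<longrightarrow> l \<in># r) \<and> x = length (kept 0 ?k) \<and>
        left_counts (\<lambda>p. m1 (LeftCount p)) 0 ?k \<and> (\<forall>l. (\<forall>p. l \<noteq> LeftCount p) \<longrightarrow> m1 l = m l)"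
      using x lc by (auto simp: m1_def split: loc.split)
  qed auto
qed

lemma scatter_survivors:
  assumes "good m" and InR: "\<And>v. v \<in> U \<Longrightarrow> m (InR v) = (if v \<in> R then 1 else 0)" and "us \<noteq> []"
    and lc: "left_counts (\<lambda>p. m (LeftCount p)) 0 (length us)"
  shows "htri \<Gamma> (6 * length us) (3 + 3 * clog (length us)) m (scatter_active l 0 0 (length us))
    (\<lambda>_ m'. (\<forall>j<length (kept 0 (length us)). m' (Active (Suc l) j) = kept 0 (length us) ! j) \<and>
      (\<forall>l'. (\<forall>j. l' \<noteq> Active (Suc l) j) \<longrightarrow> m' l' = m l'))"
proof -
  let ?k = "length us"
  let ?ys = "kept 0 (length us)"
  define m1 where "m1 = (\<lambda>l'. case l' of
    Active i j \<Rightarrow> if i = Suc l \<and> j < length ?ys then ?ys ! j else m l' | _ \<Rightarrow> m l')"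
  have "stri \<Gamma> UNIV UNIV m m1 (6 * (?k - 0) - 3) (3 + 3 * clog (?k - 0)) {#}
    (scatter_active l (length (kept 0 0)) 0 ?k)
    (\<lambda>x r. Active (Suc l) ` {length (kept 0 0)..<length ?ys} \<subseteq> set_mset r)"
    using assms by (intro stri_scatter_active lc) (auto simp: m1_def good_def)
  then have main: "stri \<Gamma> UNIV UNIV m m1 (6 * ?k - 3) (3 + 3 * clog ?k) {#} (scatter_active l 0 0 ?k)
    (\<lambda>x r. Active (Suc l) ` {0..<length ?ys} \<subseteq> set_mset r)"
    by (simp add: kept_def)
  then show ?thesis
  proof (intro htri_mono[OF htri_stri])
    fix x r assume x: "Active (Suc l) ` {0..<length ?ys} \<subseteq> set_mset r"
    have "l' \<in># r" if "m l' \<noteq> m1 l'" for l'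
      using that x by (cases l') (auto simp: m1_def split: if_splits)
    then show "(\<forall>l. m l \<noteq> m1 l \<longrightarrow> l \<in># r) \<and> (\<forall>j<length ?ys. m1 (Active (Suc l) j) = ?ys ! j) \<and>
        (\<forall>l'. (\<forall>j. l' \<noteq> Active (Suc l) j) \<longrightarrow> m1 l' = m l')"
      by (auto simp: m1_def split: loc.split)
  qed auto
qed

end

section \<open>Assembling a round and iterating it\<close>

context csr_input
begin

text \<open>State before the program's round \<open>Suc l\<close>, whence
  \<open>Active (Suc l)\<close>. \<open>AdgPrio\<close> is constrained for removed vertices only,
  since the memory starts uninitialized.\<close>

definition round_inv :: "nat \<Rightarrow> nat list \<Rightarrow> loc mem \<Rightarrow> bool" where
  "round_inv l us m \<longleftrightarrow> agrees_on_input n m0 m \<and> distinct us \<and> set us = remaining \<epsilon> n E l \<and>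
    (\<forall>i<length us. m (Active (Suc l) i) = us ! i) \<and>
    (\<forall>v\<in>set us. m (Deg v) = card (nbrs E (set us) v)) \<and>
    (\<forall>v<n. m (InU v) = (if v \<in> set us then 1 else 0)) \<and>
    (\<forall>v<n. v \<notin> set us \<longrightarrow> m (AdgPrio v) = level \<epsilon> n E v)"

text \<open>The next round is called in tail position, so its triple enters as the hypothesis
  \<open>cont\<close> and its budget as the summands \<open>w\<close> and \<open>d\<close>. The
  constant is the sum over the seven phases, \<open>36 = 4 + 5 + 6 + 5 + 5 + 6 + 5\<close>.\<close>

lemma round_correct:
  assumes inv: "round_inv l us m" and "us \<noteq> []"
    and cont: "\<And>us' m'. round_inv (Suc l) us' m' \<Longrightarrow>
      htri \<Gamma> w d m' (call (AdgRound (Suc (Suc l)) (length us'))) Q"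
  shows "htri \<Gamma> (36 * length us + 5 * (\<Sum>v\<in>removed \<epsilon> E (set us). deg v) + w) (23 + 18 * clog n + d) m
    (adg_round \<epsilon> (Suc l) (length us)) Q"
proof -
  let ?U = "set us"
  let ?R = "removed \<epsilon> E (set us)"
  let ?k = "length us"
  let ?c = "clog (length us)"
  let ?S = "\<Sum>v\<in>removed \<epsilon> E (set us). deg v"
  have U: "?U \<subseteq> {..<n}" using inv remaining_subset by (auto simp: round_inv_def)
  interpret round_phases \<epsilon> n E m0 ?U ?R us "Suc l"
    using U inv removed_subset by unfold_locales (auto simp: round_inv_def)
  have kn: "?k \<le> n" using card_mono[OF _ U] card_U by simp
  have good: "good m" using inv by (simp add: good_def round_inv_def)
  have avg: "v \<in> ?R \<longleftrightarrow> real (m (Deg v)) \<le> (1 + \<epsilon>) * (real (\<Sum>v\<in>?U. m (Deg v)) / real ?k)"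
    if "v \<in> ?U" for v
    using that inv by (simp add: removed_def round_inv_def card_U[symmetric])
  have goodI: "good m'" if "good m''" "\<And>l'. (\<forall>i. l' \<noteq> InR i) \<Longrightarrow> (\<forall>i. l' \<noteq> Deg i) \<Longrightarrow>
      (\<forall>i. l' \<noteq> InU i) \<Longrightarrow> (\<forall>i. l' \<noteq> LeftCount i) \<Longrightarrow> (\<forall>i. l' \<noteq> AdgPrio i) \<Longrightarrow>
      (\<forall>i. l' \<noteq> Active (Suc (Suc l)) i) \<Longrightarrow> m' l' = m'' l'" for m' m''
    using that(1) by (simp add: good_def agrees_on_input_def that(2))
  have k0: "?k \<noteq> 0" using assms(2) by simp
  have "htri \<Gamma> (36 * ?k + 5 * ?S + w) (23 + 16 * ?c + 2 * clog n + d) m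
    (adg_round \<epsilon> (Suc l) ?k) Q"
    unfolding adg_round_def Let_def if_P[OF k0]
  proof (rule htri_bind[OF sum_degrees[OF good],
        where ?w2.0 = "32 * ?k + 5 * ?S + w" and ?d2.0 = "21 + 14 * ?c + 2 * clog n + d"], goal_cases)
    case (1 s m1)
    then have m1: "m1 = m" and s: "s = (\<Sum>v\<in>?U. m (Deg v))" by auto
    show ?case
      unfolding m1
    proof (rule htri_bind[OF set_InR[OF good, where P = "\<lambda>x. real x \<le> (1 + \<epsilon>) * (real s / real ?k)"],
          where ?w2.0 = "27 * ?k + 5 * ?S + w" and ?d2.0 = "18 + 12 * ?c + 2 * clog n + d"], goal_cases)
      case (2 _ m2)
      then have m2: "\<And>v. v \<in> ?U \<Longrightarrow> m2 (InR v) = (if v \<in> ?R then 1 else 0)"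
        "\<And>l. (\<forall>v. l \<noteq> InR v) \<Longrightarrow> m2 l = m l" by auto
      have g2: "good m2" by (rule goodI[OF good]) (simp add: m2(2))
      show ?case
      proof (rule htri_bind[OF decrement[OF g2 m2(1)],
            where ?w2.0 = "21 * ?k + w" and ?d2.0 = "11 + 10 * ?c + d"], goal_cases)
        case (4 _ m3)
        then have m3: "\<And>u. u \<in> ?U - ?R \<Longrightarrow> m3 (Deg u) = card (nbrs E (?U - ?R) u)"
          "\<And>l. (\<forall>v. l \<noteq> Deg v) \<Longrightarrow> m3 l = m2 l" by auto
        have g3: "good m3" by (rule goodI[OF g2]) (simp add: m3(2))
        have r3: "\<And>v. v \<in> ?U \<Longrightarrow> m3 (InR v) = (if v \<in> ?R then 1 else 0)"
          using m2(1) m3(2) by simp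
        show ?case
        proof (rule htri_bind[OF set_removed[OF g3 r3],
              where ?w2.0 = "16 * ?k + w" and ?d2.0 = "8 + 8 * ?c + d"], goal_cases)
          case (4 _ m4)
          then have m4: "\<And>v. v \<in> ?R \<Longrightarrow> m4 (InU v) = 0"
            "\<And>l. l \<notin> InU ` ?R \<Longrightarrow> m4 l = m3 l" by auto
          have g4: "good m4" by (rule goodI[OF g3], rule m4(2)) blast
          have r4: "\<And>v. v \<in> ?U \<Longrightarrow> m4 (InR v) = (if v \<in> ?R then 1 else 0)"
            using r3 m4(2) by (simp add: image_iff)
          show ?case
          proof (rule htri_bind[OF count_survivors[OF g4 r4 assms(2)],
                where ?w2.0 = "11 * ?k + w" and ?d2.0 = "6 + 5 * ?c + d"], goal_cases)
            case (2 k' m5)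
            then have m5: "k' = length (kept 0 ?k)" "left_counts (\<lambda>p. m5 (LeftCount p)) 0 ?k"
              "\<And>l. (\<forall>p. l \<noteq> LeftCount p) \<Longrightarrow> m5 l = m4 l" by auto
            have g5: "good m5" by (rule goodI[OF g4]) (simp add: m5(3))
            have r5: "\<And>v. v \<in> ?U \<Longrightarrow> m5 (InR v) = (if v \<in> ?R then 1 else 0)"
              using r4 m5(3) by simp
            show ?case
            proof (rule htri_bind[OF scatter_survivors[OF g5 r5 assms(2) m5(2)],
                  where ?w2.0 = "5 * ?k + w" and ?d2.0 = "3 + 2 * ?c + d"], goal_cases)
              case (2 _ m6)
              then have m6: "\<And>j. j < length (kept 0 ?k) \<Longrightarrow> m6 (Active (Suc (Suc l)) j) = kept 0 ?k ! j"
                "\<And>l'. (\<forall>j. l' \<noteq> Active (Suc (Suc l)) j) \<Longrightarrow> m6 l' = m5 l'" by auto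
              have g6: "good m6" by (rule goodI[OF g5]) (simp add: m6(2))
              have r6: "\<And>v. v \<in> ?U \<Longrightarrow> m6 (InR v) = (if v \<in> ?R then 1 else 0)"
                using r5 m6(2) by simp
              show ?case
              proof (rule htri_bind[OF set_removed[OF g6 r6], where ?w2.0 = w and ?d2.0 = d], goal_cases)
                case (4 _ m7)
                then have m7: "\<And>v. v \<in> ?R \<Longrightarrow> m7 (AdgPrio v) = Suc l"
                  "\<And>l. l \<notin> AdgPrio ` ?R \<Longrightarrow> m7 l = m6 l" by auto
                have g7: "good m7" by (rule goodI[OF g6], rule m7(2)) blast
                have set: "set (kept 0 ?k) = ?U - ?R" unfolding kept_all by auto
                have old: "m7 (Deg v) = m3 (Deg v)" "m7 (InU v) = m4 (InU v)"
                  "m7 (Active i j) = m6 (Active i j)" for v i j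
                  using m7(2) m6(2) m5(3) m4(2) by (simp_all add: image_iff)
                have InU: "m4 (InU v) = (if v \<in> ?U - ?R then 1 else 0)" if "v < n" for v
                proof (cases "v \<in> ?R")
                  case False
                  then have "InU v \<notin> InU ` ?R" by auto
                  then have "m4 (InU v) = m (InU v)" using m4(2) m3(2) m2(2) by simp
                  then show ?thesis using that False inv by (simp add: round_inv_def)
                qed (use m4(1) in simp)
                have prio: "m7 (AdgPrio v) = level \<epsilon> n E v" if "v < n" "v \<notin> ?U - ?R" for v
                proof (cases "v \<in> ?R")
                  case True
                  then have "v \<in> remaining \<epsilon> n E l" "v \<notin> remaining \<epsilon> n E (Suc l)"
                    using inv removed_subset by (auto simp: round_inv_def)
                  then show ?thesis using m7(1)[OF True] level_eq by simp
                next
                  case False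
                  then have "AdgPrio v \<notin> AdgPrio ` ?R" "AdgPrio v \<notin> InU ` ?R" by auto
                  then have "m7 (AdgPrio v) = m (AdgPrio v)"
                    using m7(2) m6(2) m5(3) m4(2) m3(2) m2(2) by simp
                  then show ?thesis using False that inv by (simp add: round_inv_def)
                qed
                have "round_inv (Suc l) (kept 0 ?k) m7"
                  unfolding round_inv_def
                proof (intro conjI allI impI ballI)
                  show "agrees_on_input n m0 m7" using g7 by (simp add: good_def)
                  show "distinct (kept 0 ?k)" using us by (simp add: kept_all)
                  show "set (kept 0 ?k) = remaining \<epsilon> n E (Suc l)"
                    unfolding set using inv by (simp add: round_inv_def)
                qed (use old m6(1) m3(1) InU prio in \<open>auto simp: set\<close>)
                then show ?case unfolding m5(1) by (rule cont)
              qed auto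
            qed auto
          qed auto
        qed auto
      next
        case (2 v)
        then show ?case using inv m2(2) by (simp add: round_inv_def)
      next
        case (3 v)
        then show ?case using inv m2(2) by (simp add: round_inv_def)
      qed auto
    next
      case (1 v)
      then show ?case using avg s by simp
    qed auto
  qed auto
  then show ?thesis
    by (rule htri_mono) (use clog_mono[OF kn] in auto)
qed

lemma bind_prog_Ret [simp]: "p \<bind> Ret = p" for p :: "('l, 'c) prog"
  by (induction p) (auto intro!: ext)

definition survival_factor :: nat where
  "survival_factor = nat \<lceil>(1 + \<epsilon>) / \<epsilon>\<rceil>"

text \<open>At least the fraction \<open>\<epsilon> / (1 + \<epsilon>)\<close> of \<open>U\<close>
  leaves. A round can therefore charge its work to the vertices that it removes, and each vertex is
  charged once.\<close>

lemma card_le_removed: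
  assumes "finite U"
  shows "card U \<le> survival_factor * card (removed \<epsilon> E U)"
proof -
  let ?R = "removed \<epsilon> E U"
  have "card U = card ?R + card (U - ?R)"
    using assms removed_subset[of \<epsilon> E U] by (simp add: card_Diff_subset card_mono finite_subset)
  moreover have "(1 + \<epsilon>) * real (card (U - ?R)) \<le> real (card U)"
    using card_Diff_removed_le[OF eps assms] .
  ultimately have "\<epsilon> * real (card U) \<le> (1 + \<epsilon>) * real (card ?R)" by (simp add: algebra_simps)
  then have "real (card U) \<le> (1 + \<epsilon>) / \<epsilon> * real (card ?R)" using eps by (simp add: field_simps)
  also have "\<dots> \<le> real survival_factor * real (card ?R)"
    unfolding survival_factor_def by (intro mult_right_mono real_nat_ceiling_ge) simp
  finally show ?thesis by (simp flip: of_nat_mult)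
qed

text \<open>The term \<open>40 * survival_factor * length us\<close> is a potential that replaces
  the explicit geometric sum: a round lowers it by at least 40 per vertex of \<open>U\<close>. The
  number \<open>j\<close> of rounds still allowed enters only the depth.\<close>

lemma rounds_correct:
  assumes "round_inv l us m" "remaining \<epsilon> n E (l + j) = {}"
  shows "htri \<Gamma> (40 * survival_factor * length us + 5 * (\<Sum>v\<in>set us. deg v) + 1)
    (j * (24 + 18 * clog n) + 1) m (call (AdgRound (Suc l) (length us)))
    (\<lambda>_ m'. agrees_on_input n m0 m' \<and> (\<forall>v<n. m' (AdgPrio v) = level \<epsilon> n E v))"
    (is "htri _ _ _ _ _ ?Q")
  using assms
proof (induction j arbitrary: l us m)
  case (0 l us m)
  then have "us = []" by (auto simp: round_inv_def)
  then show ?case using 0 by (auto intro!: htri_Call htri_Ret simp: adg_round_def round_inv_def)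
next
  case (Suc j l us m)
  show ?case
  proof (cases "us = []")
    case True
    then show ?thesis
      using Suc.prems by (auto intro!: htri_Call htri_Ret simp: adg_round_def round_inv_def)
  next
    case False
    let ?U = "set us"
    let ?R = "removed \<epsilon> E ?U"
    let ?U' = "remaining \<epsilon> n E (Suc l)"
    let ?K = "survival_factor"
    let ?w = "40 * ?K * card ?U' + 5 * (\<Sum>v\<in>?U'. deg v) + 1"
    have U: "?U = remaining \<epsilon> n E l" and lenU: "card ?U = length us"
      using Suc.prems(1) distinct_card[of us] unfolding round_inv_def by blast+
    have "htri \<Gamma> (36 * length us + 5 * (\<Sum>v\<in>?R. deg v) + ?w)
        (23 + 18 * clog n + (j * (24 + 18 * clog n) + 1)) m (adg_round \<epsilon> (Suc l) (length us)) ?Q"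
    proof (rule round_correct[OF Suc.prems(1) False])
      fix us' m' assume inv: "round_inv (Suc l) us' m'"
      have "set us' = ?U'" "length us' = card ?U'"
        using inv distinct_card[of us'] unfolding round_inv_def by metis+
      then show "htri \<Gamma> ?w (j * (24 + 18 * clog n) + 1) m' (call (AdgRound (Suc (Suc l)) (length us'))) ?Q"
        using Suc.IH[OF inv] Suc.prems(2) by simp
    qed
    note body = this
    have split: "card ?U = card ?R + card ?U'" "(\<Sum>v\<in>?U. deg v) = (\<Sum>v\<in>?R. deg v) + (\<Sum>v\<in>?U'. deg v)"
      using removed_subset[of \<epsilon> E ?U] sum.subset_diff[of ?R ?U deg] sum.subset_diff[of ?R ?U "\<lambda>_. 1 :: nat"]
      by (simp_all add: U)
    \<comment> \<open>For nonempty \<open>U\<close> the constant 40 covers the 36 steps per vertex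
      and the call node.\<close>
    have "1 + 36 * card ?U \<le> 40 * card ?U" using False lenU by (cases us) auto
    also have "\<dots> \<le> 40 * (?K * card ?R)" using card_le_removed[of ?U] by (intro mult_le_mono2) simp
    finally have "1 + (36 * length us + 5 * (\<Sum>v\<in>?R. deg v) + ?w) \<le>
        40 * ?K * length us + 5 * (\<Sum>v\<in>?U. deg v) + 1"
      unfolding split lenU[symmetric] by (simp add: algebra_simps)
    then show ?thesis
      by (intro htri_Call) (auto intro: htri_mono[OF body])
  qed
qed

lemma adg_correct:
  assumes "agrees_on_input n m0 m"
  shows "htri \<Gamma> ((7 + 40 * survival_factor) * n + 10 * card E + 1)
    (6 + 2 * clog n + rounds \<epsilon> n * (24 + 18 * clog n)) m (adg n)
    (\<lambda>_ m'. agrees_on_input n m0 m' \<and> (\<forall>v<n. m' (AdgPrio v) = level \<epsilon> n E v))"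
  unfolding adg_def
proof (rule htri_bind[OF adg_init[OF assms]])
  fix x m' assume m': "agrees_on_input n m0 m' \<and>
    (\<forall>v<n. m' (Deg v) = deg v \<and> m' (InU v) = 1 \<and> m' (Active 1 v) = v)"
  have "round_inv 0 [0..<n] m'"
    using m' by (auto simp: round_inv_def vertex_degree_def atLeast0LessThan)
  from rounds_correct[OF this, of "rounds \<epsilon> n"]
  show "htri \<Gamma> (40 * survival_factor * n + 5 * (\<Sum>v<n. deg v) + 1) (rounds \<epsilon> n * (24 + 18 * clog n) + 1) m'
      (call (AdgRound 1 n))
      (\<lambda>_ m'. agrees_on_input n m0 m' \<and> (\<forall>v<n. m' (AdgPrio v) = level \<epsilon> n E v))"
    using remaining_rounds[OF eps] by (simp add: atLeast0LessThan)
qed (use sum_vertex_degree_le[OF graph] in \<open>simp_all add: algebra_simps\<close>)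

end

section \<open>Verification of JP\<close>

text \<open>\<open>Root v\<close> is the right of the start loop to begin \<open>v\<close> if it has
  no predecessor; \<open>Working v f\<close> owns the marks \<open>Used v\<close>, with contents
  \<open>f\<close>; \<open>Colored v\<close> records that \<open>Color v\<close> is final.\<close>

datatype token =
    Root nat | Working nat "nat \<Rightarrow> nat" | Colored nat | MayDec nat nat | HasDec nat nat

text \<open>The height is a parameter, so the verification works with any function that decreases
  along calls; its values bound their nesting.\<close>

locale jp_input = csr_input +
  fixes \<pi> h :: "nat \<Rightarrow> nat"
  assumes perm: "\<pi> permutes {..<n}"
    and height: "\<And>u v. {u, v} \<in> E \<Longrightarrow> level \<epsilon> n E u < level \<epsilon> n E v \<or>
      level \<epsilon> n E u = level \<epsilon> n E v \<and> \<pi> u < \<pi> v \<Longrightarrow> h u < h v"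
    and rand: "\<And>v. v < n \<Longrightarrow> m0 (RandPrio v) = \<pi> v"
begin

definition less :: "nat \<Rightarrow> nat \<Rightarrow> bool" where
  "less u v \<longleftrightarrow> level \<epsilon> n E u < level \<epsilon> n E v \<or> level \<epsilon> n E u = level \<epsilon> n E v \<and> \<pi> u < \<pi> v"

definition "pred v = {u \<in> N v. less v u}"
definition "succ v = {u \<in> N v. less u v}"

abbreviation "slots v \<equiv> {off v..<off (Suc v)}"

lemma N_iff: "u \<in> N v \<longleftrightarrow> {u, v} \<in> E"
  using simple_graph_edgeD[OF graph] by (auto simp: nbrs_iff)

lemma pred_iff_succ: "u \<in> pred v \<longleftrightarrow> v \<in> succ u"
  by (auto simp: pred_def succ_def N_iff insert_commute)

lemma less_linear: "u \<noteq> v \<Longrightarrow> less u v \<or> less v u"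
proof -
  assume "u \<noteq> v"
  then have "\<pi> u \<noteq> \<pi> v" using permutes_inj[OF perm] injD by metis
  then show ?thesis unfolding less_def by linarith
qed

lemma pred_less: "u \<in> pred v \<Longrightarrow> u < n \<and> v < n \<and> h v < h u"
  using height[of v u] simple_graph_edgeD[OF graph, of u v]
  by (auto simp: pred_def N_iff less_def insert_commute)

lemma finite_pred [simp]: "finite (pred v)" and finite_succ [simp]: "finite (succ v)"
  by (simp_all add: pred_def succ_def)

lemma card_pred_le: "card (pred v) \<le> deg v"
  unfolding vertex_degree_def by (intro card_mono) (auto simp: pred_def)

lemma wf_pred: "wf {(u, v). u \<in> pred v}"
proof (rule wf_subset)
  show "wf (Wellfounded.measure (\<lambda>v. Max (h ` {..<n}) - h v))" by simp
  show "{(u, v). u \<in> pred v} \<subseteq> Wellfounded.measure (\<lambda>v. Max (h ` {..<n}) - h v)"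
    by (auto dest!: pred_less intro!: diff_less_mono2 order.strict_trans2[OF _ Max_ge])
qed

text \<open>The greedy coloring by recursion along the priority order. It refers to no execution;
  every schedule is shown to produce it.\<close>

definition col :: "nat \<Rightarrow> nat" where
  "col = wfrec {(u, v). u \<in> pred v} (\<lambda>f v. LEAST c. 1 \<le> c \<and> c \<notin> f ` pred v)"

lemma col_eq: "col v = (LEAST c. 1 \<le> c \<and> c \<notin> col ` pred v)"
proof -
  have "cut col {(u, v). u \<in> pred v} v ` pred v = col ` pred v"
    by (intro image_cong) (auto simp: cut_apply)
  then show ?thesis by (subst col_def, subst wfrec[OF wf_pred]) (fold col_def, simp only:)
qed

lemma col_free_exists: "\<exists>c. 1 \<le> c \<and> c \<le> card (pred v) + 1 \<and> c \<notin> col ` pred v"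
proof (rule ccontr)
  assume "\<not> ?thesis"
  then have "{1..card (pred v) + 1} \<subseteq> col ` pred v" by auto
  then have "card {1..card (pred v) + 1} \<le> card (col ` pred v)" by (intro card_mono) auto
  also have "\<dots> \<le> card (pred v)" by (rule card_image_le) simp
  finally show False by simp
qed

lemma col_props: "1 \<le> col v" "col v \<le> card (pred v) + 1" "u \<in> pred v \<Longrightarrow> col v \<noteq> col u"
proof -
  let ?P = "\<lambda>c. 1 \<le> c \<and> c \<notin> col ` pred v"
  obtain c where c: "1 \<le> c" "c \<le> card (pred v) + 1" "c \<notin> col ` pred v"
    using col_free_exists by blast
  have "?P (LEAST c. ?P c)" using c by (intro LeastI[of ?P c]) auto
  then have P: "?P (col v)" unfolding col_eq[of v, symmetric] .
  have "(LEAST c. ?P c) \<le> c" using c by (intro Least_le) auto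
  then have "col v \<le> c" unfolding col_eq[of v, symmetric] .
  then show "1 \<le> col v" "col v \<le> card (pred v) + 1" "u \<in> pred v \<Longrightarrow> col v \<noteq> col u"
    using P c by auto
qed

lemma proper_col: "proper_coloring n E col"
  unfolding proper_coloring_def
proof (intro conjI allI impI)
  fix u v assume E: "{u, v} \<in> E"
  then have "u \<in> pred v \<or> v \<in> pred u"
    using less_linear[of u v] simple_graph_edgeD(3)[OF graph E]
    by (auto simp: pred_def N_iff insert_commute)
  then show "col u \<noteq> col v" using col_props(3) by metis
qed (rule col_props)

lemma off_mono: "v \<le> w \<Longrightarrow> w \<le> n \<Longrightarrow> off v \<le> off w"
proof (induction w)
  case (Suc w)
  then show ?case using off_Suc[of w] by (cases "v = Suc w") auto
qed simp

lemma slots_unique: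
  assumes "v < n" "w < n" "i \<in> slots v" "i \<in> slots w"
  shows "v = w"
proof -
  have "\<not> v < w" "\<not> w < v"
    using assms off_mono[of "Suc v" w] off_mono[of "Suc w" v] by auto
  then show ?thesis by simp
qed

section \<open>Initialization of the counters\<close>

definition initialized :: "loc mem \<Rightarrow> bool" where
  "initialized m \<longleftrightarrow> agrees_on_input n m0 m \<and>
    (\<forall>v<n. (\<forall>i\<in>slots v. m (InSucc i) = (if less (adj i) v then 1 else 0) \<and>
        m (InPred i) = (if less v (adj i) then 1 else 0)) \<and>
      m (NumPred v) = card (pred v) \<and> m (Count v) = card (pred v))"

lemma jp_init_correct:
  assumes inp: "agrees_on_input n m0 m" and prio: "\<forall>v<n. m (AdgPrio v) = level \<epsilon> n E v"
  shows "htri \<Gamma> (6 * n + 26 * card E) (15 + 4 * clog n) m (jp_init n) (\<lambda>_. initialized)"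
proof -
  \<comment> \<open>\<open>InSucc\<close> and \<open>InPred\<close> are indexed by slots, but their
    values depend also on the vertex whose neighbour list contains the slot. \<open>owner\<close>
    recovers it, uniquely because the lists do not overlap.\<close>
  define owner where "owner = (\<lambda>i. SOME v. v < n \<and> i \<in> slots v)"
  have owner: "owner i = v" if "v < n" "i \<in> slots v" for i v
    unfolding owner_def by (rule some_equality) (use that slots_unique in blast)+
  define m1 where "m1 = (\<lambda>l. case l of
      InSucc i \<Rightarrow> if \<exists>v<n. i \<in> slots v then if less (adj i) (owner i) then 1 else 0 else m l
    | InPred i \<Rightarrow> if \<exists>v<n. i \<in> slots v then if less (owner i) (adj i) then 1 else 0 else m l
    | NumPred v \<Rightarrow> if v < n then card (pred v) else m l
    | Count v \<Rightarrow> if v < n then card (pred v) else m l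
    | _ \<Rightarrow> m l)"
  have same: "m (Off v) = off v" "m1 (Off v) = off v" "m (Adj v) = adj v" "m1 (Adj v) = adj v"
    "v < n \<Longrightarrow> m (RandPrio v) = \<pi> v" "v < n \<Longrightarrow> m1 (RandPrio v) = \<pi> v"
    "v < n \<Longrightarrow> m (AdgPrio v) = level \<epsilon> n E v" "v < n \<Longrightarrow> m1 (AdgPrio v) = level \<epsilon> n E v" for v
    using inp prio rand by (simp_all add: agrees_on_input_def m1_def)
  have slot: "m1 (InSucc i) = (if less (adj i) v then 1 else 0)"
    "m1 (InPred i) = (if less v (adj i) then 1 else 0)" if "v < n" "i \<in> slots v" for i v
    using owner[OF that] that by (auto simp: m1_def)
  have cnt: "(\<Sum>i\<in>slots v. if less v (adj i) then 1 else 0) = card (pred v)" if "v < n" for v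
    unfolding sum_slots[OF that, of "\<lambda>u. if less v u then 1 else 0"]
    by (simp add: sum.If_cases pred_def Int_def)
  let ?slot = "\<lambda>v i. do {
      u \<leftarrow> read (Adj i); s \<leftarrow> prio_less u v; write (InSucc i) s;
      q \<leftarrow> prio_less v u; write (InPred i) q; Ret q } :: (loc, proc) prog"
  let ?W = "\<lambda>v. {NumPred v, Count v} \<union> (\<Union>i\<in>slots v. {InSucc i, InPred i})"
  have body: "stri \<Gamma> UNIV UNIV m m1 (4 + 13 * deg v) (15 + 2 * clog n) {#} (do {
     a \<leftarrow> read (Off v);
     b \<leftarrow> read (Off (Suc v));
     p \<leftarrow> reduce (+) 0 (?slot v) a b;
     write (NumPred v) p;
     write (Count v) p
   }) (\<lambda>x r. ?W v \<subseteq> set_mset r)" if v: "v < n" for v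
  proof -
    have red: "stri \<Gamma> UNIV UNIV m m1 (13 * deg v) (11 + 2 * clog n) {#} (reduce (+) 0 (?slot v) (off v) (off (Suc v))) (\<lambda>x r. x = (\<Sum>i = off v..<off (Suc v). if less v (adj i) then 1 else 0) \<and>
        (\<forall>i\<in>slots v. {InSucc i, InPred i} \<subseteq> set_mset r))"
    proof (rule stri_reduce[where w = "\<lambda>_. 11" and d = 11])
      fix i assume "off v \<le> i" "i < off (Suc v)"
      then have i: "i \<in> slots v" by simp
      note slot = slot[OF v i] and au = adj_less[OF v i]
      show "stri \<Gamma> UNIV UNIV m m1 11 11 {#} (?slot v i) (\<lambda>x r. x = (\<Sum>i = i..<Suc i. if less v (adj i) then 1 else 0) \<and> {InSucc i, InPred i} \<subseteq> set_mset r)"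
        using slot au v unfolding prio_less_def
        by (auto intro!: stri_Read stri_Write stri_Ret simp: same less_def)
    qed (use off_Suc[OF v] clog_mono[of "deg v" n] deg_less[OF v] in
        \<open>simp_all add: sum.atLeastLessThan_concat\<close>)
    have "stri \<Gamma> UNIV UNIV m m1 (2 + 13 * deg v) (13 + 2 * clog n) {#} (do {
      p \<leftarrow> reduce (+) 0 (?slot v) (off v) (off (Suc v));
     write (NumPred v) p;
     write (Count v) p
     }) (\<lambda>x r. ?W v \<subseteq> set_mset r)"
    proof (rule stri_bind[OF red, where ?w2.0 = 2 and ?d2.0 = 2])
      fix x :: nat and \<sigma>
      assume x: "x = (\<Sum>i = off v..<off (Suc v). if less v (adj i) then 1 else 0) \<and>
        (\<forall>i\<in>slots v. {InSucc i, InPred i} \<subseteq> set_mset \<sigma>)"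
      then have "x = card (pred v)" using cnt[OF v] by simp
      then show "stri \<Gamma> UNIV UNIV m m1 2 2 \<sigma> (do { write (NumPred v) x; write (Count v) x })
          (\<lambda>x r. ?W v \<subseteq> set_mset r)"
        using x v by (auto intro!: stri_Write stri_Ret simp: m1_def)
    qed simp_all
    then show ?thesis
      using v by (auto intro!: stri_Read simp: same)
  qed
  show ?thesis
    unfolding jp_init_def
  proof (rule htri_stri[OF stri_parfor[OF body]])
    have "(\<Sum>v = 0..<n. 4 + 13 * deg v + 2) = 6 * n + 13 * (\<Sum>v<n. deg v)"
      by (simp add: sum.distrib atLeast0LessThan sum_distrib_left)
    then show "(\<Sum>v = 0..<n. 4 + 13 * deg v + 2) \<le> 6 * n + 26 * card E"
      using sum_vertex_degree_le[OF graph] by simp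
    fix x r assume r: "\<forall>v\<in>{0..<n}. ?W v \<subseteq> set_mset r"
    have "l \<in># r" if "m l \<noteq> m1 l" for l
      using that r by (cases l) (auto simp: m1_def split: if_splits; fastforce)+
    moreover have "initialized m1"
      using inp slot by (auto simp: initialized_def agrees_on_input_def m1_def)
    ultimately show "(\<forall>l. m l \<noteq> m1 l \<longrightarrow> l \<in># r) \<and> initialized m1" by blast
  qed auto
qed

end

primrec token_active :: "nat \<Rightarrow> token \<Rightarrow> bool" where
  "token_active v (Root u) \<longleftrightarrow> False"
| "token_active v (Working u f) \<longleftrightarrow> u = v"
| "token_active v (Colored u) \<longleftrightarrow> u = v"
| "token_active v (MayDec u w) \<longleftrightarrow> False"
| "token_active v (HasDec u w) \<longleftrightarrow> False"

text \<open>Counting, rather than testing membership, is additive over the tokens of different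
  threads and can express that the coloring of a vertex is started at most once.\<close>

definition active :: "nat \<Rightarrow> token multiset \<Rightarrow> nat" where
  "active v T = size (filter_mset (token_active v) T)"

lemma active_simps [simp]:
  "active v {#} = 0"
  "active v (add_mset t T) = (if token_active v t then Suc (active v T) else active v T)"
  "active v (T + T') = active v T + active v T'"
  by (simp_all add: active_def)

lemma active_eq_0: "active v T = 0 \<longleftrightarrow> Colored v \<notin># T \<and> (\<forall>f. Working v f \<notin># T)"
proof -
  have "active v T = 0 \<longleftrightarrow> (\<forall>t\<in>#T. \<not> token_active v t)"
    by (induction T) auto
  also have "\<dots> \<longleftrightarrow> Colored v \<notin># T \<and> (\<forall>f. Working v f \<notin># T)"
  proof -
    have "token_active v t \<longleftrightarrow> t = Colored v \<or> (\<exists>f. t = Working v f)" for t by (cases t) auto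
    then show ?thesis by auto
  qed
  finally show ?thesis .
qed

locale jp_run = jp_input +
  fixes ms :: "loc mem"
  assumes ms: "initialized ms"
begin

primrec static :: "loc \<Rightarrow> bool" where
  "static (Off _) = True" | "static (Adj _) = True" | "static (RandPrio _) = True"
| "static (Deg _) = True" | "static (Active _ _) = True" | "static (InU _) = True"
| "static (InR _) = True" | "static (LeftCount _) = True" | "static (AdgPrio _) = True"
| "static (InPred _) = True" | "static (InSucc _) = True" | "static (NumPred _) = True"
| "static (Count _) = False" | "static (Used _ _) = False" | "static (Color _) = False"

definition rights :: "nat \<Rightarrow> token multiset" where
  "rights v = (\<Sum>u\<in>succ v. {#MayDec v u#})"

text \<open>All of the work on \<open>v\<close>: the call, 3 reads,
  \<open>6 * (card (pred v) + 1)\<close> for clearing and searching the marks, 6 and 5 per neighbour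
  in the two neighbour loops, and the write of the color; finally
  \<open>card (pred v) \<le> deg v\<close>.\<close>

definition cost :: "nat \<Rightarrow> nat" where
  "cost v = 11 + 17 * deg v"

definition credit :: "token multiset \<Rightarrow> nat" where
  "credit T = (\<Sum>v<n. if active v T = 0 then cost v else 0)"

text \<open>
  A vertex is active once its coloring has started. \<open>MayDec v u\<close> is the pending, \<open>HasDec v u\<close>
  the completed decrement of \<open>Count u\<close> by \<open>v\<close>. The budget \<open>cost v\<close> stays in the invariant until
  \<open>v\<close> becomes active.
\<close>

definition jp_inv :: "loc mem \<Rightarrow> token multiset \<Rightarrow> bool" where
  "jp_inv m T \<longleftrightarrow>
    (\<forall>l. static l \<longrightarrow> m l = ms l) \<and>
    (\<forall>v. active v T \<le> 1) \<and>
    (\<forall>v f. Working v f \<in># T \<longrightarrow> v < n \<and> (\<forall>c. m (Used v c) = f c) \<and> (\<forall>u\<in>pred v. Colored u \<in># T)) \<and>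
    (\<forall>v. Colored v \<in># T \<longrightarrow> v < n \<and> m (Color v) = col v) \<and>
    (\<forall>v u. count T (MayDec v u) + count T (HasDec v u) \<le> 1) \<and>
    (\<forall>v u. MayDec v u \<in># T \<or> HasDec v u \<in># T \<longrightarrow> v \<in> pred u \<and> Colored v \<in># T) \<and>
    (\<forall>u<n. m (Count u) = card (pred u - {v. HasDec v u \<in># T})) \<and>
    (\<forall>u<n. pred u \<noteq> {} \<longrightarrow> (active u T \<noteq> 0 \<longleftrightarrow> (\<forall>v\<in>pred u. HasDec v u \<in># T))) \<and>
    (\<forall>v. count T (Root v) \<le> 1) \<and>
    (\<forall>v. Root v \<in># T \<longrightarrow> pred v = {} \<longrightarrow> active v T = 0)"

section \<open>Ghost transitions of the coloring protocol\<close>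

lemma credit_start:
  assumes "v < n" "active v T = 0" "active v T' = 1" "\<And>w. w \<noteq> v \<Longrightarrow> active w T' = active w T"
  shows "cost v + credit T' = credit T"
proof -
  have v: "v \<in> {..<n}" using assms(1) by simp
  have "(\<Sum>w\<in>{..<n} - {v}. if active w T' = 0 then cost w else 0) =
      (\<Sum>w\<in>{..<n} - {v}. if active w T = 0 then cost w else 0)"
    using assms(4) by (intro sum.cong) auto
  then show ?thesis
    using assms(2,3) unfolding credit_def by (simp add: sum.remove[OF _ v])
qed

lemma credit_cong: "(\<And>w. active w T' = active w T) \<Longrightarrow> credit T' = credit T"
  by (simp add: credit_def)

lemma count_rights: "count (rights v) t = (case t of MayDec w u \<Rightarrow> if w = v \<and> u \<in> succ v then 1 else 0 | _ \<Rightarrow> 0)"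
  by (cases t) (auto simp: rights_def count_sum if_distrib sum.If_cases)

lemma active_rights [simp]: "active w (rights v) = 0"
  unfolding active_eq_0 by (auto simp: count_rights simp flip: count_greater_zero_iff)

lemma set_rights: "t \<in># rights v \<longleftrightarrow> (\<exists>u\<in>succ v. t = MayDec v u)"
  by (cases t) (auto simp: count_rights simp flip: count_greater_zero_iff split: if_splits)

text \<open>The \<open>Root\<close> token is unique and is consumed, so a vertex without
  predecessors is started once, and its budget is released at that moment.\<close>

lemma start_root:
  assumes "jp_inv m (add_mset (Root v) T)" "pred v = {}" "v < n"
  shows "jp_inv m (add_mset (Working v (\<lambda>c. m (Used v c))) T)"
    "cost v + credit (add_mset (Working v (\<lambda>c. m (Used v c))) T) = credit (add_mset (Root v) T)"
proof -
  have 0: "active v T = 0" using assms(1,2) unfolding jp_inv_def by (metis active_simps(2) token_active.simps(1) union_single_eq_member)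
  have R: "Root v \<notin># T" using assms(1) unfolding jp_inv_def
    by (metis add_mset_add_single count_add_mset count_eq_zero_iff le_zero_eq Suc_le_mono One_nat_def)
  show "jp_inv m (add_mset (Working v (\<lambda>c. m (Used v c))) T)"
    unfolding jp_inv_def
  proof (intro conjI)
    show "\<forall>u<n. pred u \<noteq> {} \<longrightarrow> (active u (add_mset (Working v (\<lambda>c. m (Used v c))) T) \<noteq> 0 \<longleftrightarrow>
        (\<forall>w\<in>pred u. HasDec w u \<in># add_mset (Working v (\<lambda>c. m (Used v c))) T))"
      using assms unfolding jp_inv_def by auto
    show "\<forall>w. count (add_mset (Working v (\<lambda>c. m (Used v c))) T) (Root w) \<le> 1"
    proof
      fix w
      have "count (add_mset (Root v) T) (Root w) \<le> 1" using assms(1) unfolding jp_inv_def by blast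
      then show "count (add_mset (Working v (\<lambda>c. m (Used v c))) T) (Root w) \<le> 1"
        by (simp split: if_splits)
    qed
  qed (use assms 0 R in \<open>auto simp: jp_inv_def\<close>)
  show "cost v + credit (add_mset (Working v (\<lambda>c. m (Used v c))) T) = credit (add_mset (Root v) T)"
    by (rule credit_start) (use assms 0 in auto)
qed

lemma update_used:
  assumes "jp_inv m (add_mset (Working v f) T)" "only_writes (range (Used v)) m m'"
    "\<And>c. m' (Used v c) = g c"
  shows "jp_inv m' (add_mset (Working v g) T)"
    "credit (add_mset (Working v g) T) = credit (add_mset (Working v f) T)"
proof -
  have same: "m' l = m l" if "\<And>c. l \<noteq> Used v c" for l
    using assms(2) that by (auto simp: only_writes_def)
  have st: "static l \<Longrightarrow> m' l = m l" for l using same[of l] by (cases l) auto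
  have 0: "active v T = 0" using assms(1) unfolding jp_inv_def by (metis active_simps(2) le_zero_eq One_nat_def Suc_le_mono token_active.simps(2))
  then have W: "Working v f' \<notin># T" for f' by (simp add: active_eq_0)
  have others: "w \<noteq> v \<Longrightarrow> m' (Used w c) = m (Used w c)" "m' (Color w) = m (Color w)"
    "m' (Count w) = m (Count w)" for w c
    by (simp_all add: same)
  show "jp_inv m' (add_mset (Working v g) T)"
    unfolding jp_inv_def
  proof (intro conjI)
    show "\<forall>w f'. Working w f' \<in># add_mset (Working v g) T \<longrightarrow> w < n \<and> (\<forall>c. m' (Used w c) = f' c) \<and>
        (\<forall>u\<in>pred w. Colored u \<in># add_mset (Working v g) T)"
    proof (intro allI impI)
      fix w f' assume w: "Working w f' \<in># add_mset (Working v g) T"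
      show "w < n \<and> (\<forall>c. m' (Used w c) = f' c) \<and> (\<forall>u\<in>pred w. Colored u \<in># add_mset (Working v g) T)"
      proof (cases "w = v")
        case True
        then have "f' = g" using w W by auto
        moreover have "v < n" "\<forall>u\<in>pred v. Colored u \<in># T" using assms(1) unfolding jp_inv_def by auto
        ultimately show ?thesis using True assms(3) by auto
      next
        case False
        then have "Working w f' \<in># add_mset (Working v f) T" using w by auto
        then have "w < n \<and> (\<forall>c. m (Used w c) = f' c) \<and> (\<forall>u\<in>pred w. Colored u \<in># add_mset (Working v f) T)"
          using assms(1) unfolding jp_inv_def by blast
        then show ?thesis using others False by auto
      qed
    qed
  qed (use assms(1) others st in \<open>auto simp: jp_inv_def\<close>)
  show "credit (add_mset (Working v g) T) = credit (add_mset (Working v f) T)"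
    by (rule credit_cong) auto
qed

text \<open>Writing the color creates one decrement right per successor. None can exist earlier,
  because such tokens require \<open>Colored v\<close>.\<close>

lemma finish_color:
  assumes "jp_inv m (add_mset (Working v f) T)"
  shows "jp_inv (m(Color v := col v)) (add_mset (Colored v) (rights v + T))"
    "credit (add_mset (Colored v) (rights v + T)) = credit (add_mset (Working v f) T)"
proof -
  have 0: "active v T = 0" using assms(1) unfolding jp_inv_def by (metis active_simps(2) le_zero_eq One_nat_def Suc_le_mono token_active.simps(2))
  then have W: "Working v f' \<notin># T" "Colored v \<notin># T" for f' by (simp_all add: active_eq_0)
  have M: "MayDec v u \<notin># T" "HasDec v u \<notin># T" for u
    using assms W(2) unfolding jp_inv_def by auto
  have cnt: "count T (MayDec w u) + count T (HasDec w u) \<le> 1" for w u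
    using assms unfolding jp_inv_def by auto
  have act: "active w T \<le> 1" for w
  proof -
    have "active w (add_mset (Working v f) T) \<le> 1" using assms unfolding jp_inv_def by blast
    then show ?thesis by (simp split: if_splits)
  qed
  show "jp_inv (m(Color v := col v)) (add_mset (Colored v) (rights v + T))"
    unfolding jp_inv_def
  proof (intro conjI)
    show "\<forall>w u. count (add_mset (Colored v) (rights v + T)) (MayDec w u) +
        count (add_mset (Colored v) (rights v + T)) (HasDec w u) \<le> 1"
      using cnt M by (auto simp: count_rights not_in_iff)
    show "\<forall>w u. MayDec w u \<in># add_mset (Colored v) (rights v + T) \<or>
        HasDec w u \<in># add_mset (Colored v) (rights v + T) \<longrightarrow>
        w \<in> pred u \<and> Colored w \<in># add_mset (Colored v) (rights v + T)"
      using assms unfolding jp_inv_def by (auto simp: set_rights pred_iff_succ)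
  qed (use assms W 0 act in \<open>auto simp: jp_inv_def set_rights count_rights split: if_splits\<close>)
  show "credit (add_mset (Colored v) (rights v + T)) = credit (add_mset (Working v f) T)"
    by (rule credit_cong) auto
qed

text \<open>The counter equals the number of predecessors whose decrement is outstanding. Uniqueness
  of \<open>MayDec v u\<close> makes \<open>v\<close> one of them, so the subtraction is
  exact.\<close>

lemma count_decrement:
  assumes "jp_inv m (add_mset (MayDec v u) T)"
  shows "v \<in> pred u" "v < n" "u < n" "HasDec v u \<notin># T" "MayDec v u \<notin># T"
    "m (Count u) - 1 = card (pred u - {w. HasDec w u \<in># add_mset (HasDec v u) T})"
proof -
  show v: "v \<in> pred u" using assms unfolding jp_inv_def by auto
  then show "v < n" "u < n" using pred_less by auto
  have "count (add_mset (MayDec v u) T) (MayDec v u) + count (add_mset (MayDec v u) T) (HasDec v u) \<le> 1"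
    using assms unfolding jp_inv_def by blast
  then show H: "HasDec v u \<notin># T" and "MayDec v u \<notin># T" by (auto simp: not_in_iff)
  have "m (Count u) = card (pred u - {w. HasDec w u \<in># T})"
    using assms \<open>u < n\<close> unfolding jp_inv_def by auto
  moreover have "pred u - {w. HasDec w u \<in># T} = insert v (pred u - {w. HasDec w u \<in># add_mset (HasDec v u) T})"
    using v H by auto
  ultimately show "m (Count u) - 1 = card (pred u - {w. HasDec w u \<in># add_mset (HasDec v u) T})"
    by simp
qed

lemma decrement_positive:
  assumes inv: "jp_inv m (add_mset (MayDec v u) T)" and "m (Count u) - 1 \<noteq> 0"
  shows "jp_inv (m(Count u := m (Count u) - 1)) (add_mset (HasDec v u) T)"
    "credit (add_mset (HasDec v u) T) = credit (add_mset (MayDec v u) T)"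
proof -
  note c = count_decrement[OF inv]
  \<comment> \<open>A nonzero result means that some predecessor is still outstanding, so
    \<open>u\<close> has not been started.\<close>
  have wait: "\<exists>w\<in>pred u. HasDec w u \<notin># add_mset (HasDec v u) T"
  proof (rule ccontr)
    assume "\<not> ?thesis"
    then have "pred u - {w. HasDec w u \<in># add_mset (HasDec v u) T} = {}" by auto
    then show False using assms(2) unfolding c(6) by (simp only: card.empty)
  qed
  then have "active u (add_mset (MayDec v u) T) = 0"
    using inv c(1,3) unfolding jp_inv_def by auto
  then have act: "active u (add_mset (HasDec v u) T) = 0" by simp
  show "jp_inv (m(Count u := m (Count u) - 1)) (add_mset (HasDec v u) T)"
    unfolding jp_inv_def
  proof (intro conjI)
    show "\<forall>x<n. (m(Count u := m (Count u) - 1)) (Count x) =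
        card (pred x - {w. HasDec w x \<in># add_mset (HasDec v u) T})"
      using inv c(6) unfolding jp_inv_def by auto
    show "\<forall>x<n. pred x \<noteq> {} \<longrightarrow> (active x (add_mset (HasDec v u) T) \<noteq> 0 \<longleftrightarrow>
        (\<forall>w\<in>pred x. HasDec w x \<in># add_mset (HasDec v u) T))"
    proof (intro allI impI)
      fix x assume "x < n" "pred x \<noteq> {}"
      then show "active x (add_mset (HasDec v u) T) \<noteq> 0 \<longleftrightarrow>
        (\<forall>w\<in>pred x. HasDec w x \<in># add_mset (HasDec v u) T)"
        using inv act wait unfolding jp_inv_def by (cases "x = u") auto
    qed
    show "\<forall>w x. count (add_mset (HasDec v u) T) (MayDec w x) + count (add_mset (HasDec v u) T) (HasDec w x) \<le> 1"
    proof (intro allI)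
      fix w x
      have "count (add_mset (MayDec v u) T) (MayDec w x) + count (add_mset (MayDec v u) T) (HasDec w x) \<le> 1"
        using inv unfolding jp_inv_def by blast
      then show "count (add_mset (HasDec v u) T) (MayDec w x) + count (add_mset (HasDec v u) T) (HasDec w x) \<le> 1"
        by (auto split: if_splits)
    qed
  qed (use inv c in \<open>auto simp: jp_inv_def\<close>)
  show "credit (add_mset (HasDec v u) T) = credit (add_mset (MayDec v u) T)"
    by (rule credit_cong) auto
qed

text \<open>The atomic decrement decides the race: the thread that sees 0 obtains
  \<open>Working u\<close> and the credits \<open>cost u\<close> in the same step. By then all
  predecessors have decremented and hence are colored.\<close>

lemma decrement_zero:
  assumes inv: "jp_inv m (add_mset (MayDec v u) T)" and "m (Count u) - 1 = 0"
  shows "jp_inv (m(Count u := m (Count u) - 1))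
      (add_mset (Working u (\<lambda>c. m (Used u c))) (add_mset (HasDec v u) T))"
    "cost u + credit (add_mset (Working u (\<lambda>c. m (Used u c))) (add_mset (HasDec v u) T)) =
      credit (add_mset (MayDec v u) T)"
proof -
  note c = count_decrement[OF inv]
  let ?T = "add_mset (Working u (\<lambda>c. m (Used u c))) (add_mset (HasDec v u) T)"
  have "pred u - {w. HasDec w u \<in># add_mset (HasDec v u) T} = {}"
    using assms(2) unfolding c(6) by simp
  then have all: "HasDec w u \<in># add_mset (HasDec v u) T" if "w \<in> pred u" for w using that by blast
  have "active u (add_mset (MayDec v u) T) = 0"
    using inv c(1,3,4) unfolding jp_inv_def by auto
  then have act: "active u T = 0" by simp
  have col: "Colored w \<in># T" if "w \<in> pred u" for w
    using all[OF that] inv unfolding jp_inv_def by (cases "w = v") auto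
  show "jp_inv (m(Count u := m (Count u) - 1)) ?T"
    unfolding jp_inv_def
  proof (intro conjI)
    show "\<forall>x<n. (m(Count u := m (Count u) - 1)) (Count x) = card (pred x - {w. HasDec w x \<in># ?T})"
      using inv c(6) unfolding jp_inv_def by auto
    show "\<forall>x<n. pred x \<noteq> {} \<longrightarrow> (active x ?T \<noteq> 0 \<longleftrightarrow> (\<forall>w\<in>pred x. HasDec w x \<in># ?T))"
    proof (intro allI impI)
      fix x assume "x < n" "pred x \<noteq> {}"
      then show "active x ?T \<noteq> 0 \<longleftrightarrow> (\<forall>w\<in>pred x. HasDec w x \<in># ?T)"
        using inv all unfolding jp_inv_def by (cases "x = u") auto
    qed
    show "\<forall>w x. count ?T (MayDec w x) + count ?T (HasDec w x) \<le> 1"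
    proof (intro allI)
      fix w x
      have "count (add_mset (MayDec v u) T) (MayDec w x) + count (add_mset (MayDec v u) T) (HasDec w x) \<le> 1"
        using inv unfolding jp_inv_def by blast
      then show "count ?T (MayDec w x) + count ?T (HasDec w x) \<le> 1"
        by (auto split: if_splits)
    qed
  qed (use inv c act col in \<open>auto simp: jp_inv_def\<close>)
  show "cost u + credit ?T = credit (add_mset (MayDec v u) T)"
    by (rule credit_start) (use act c in auto)
qed

abbreviation "jtri \<equiv> tri \<Gamma> jp_inv (\<lambda>_ _. True) credit"

lemma ms_static:
  "ms (Off v) = off v" "ms (Adj i) = adj i"
  "v < n \<Longrightarrow> i \<in> slots v \<Longrightarrow> ms (InSucc i) = (if adj i \<in> succ v then 1 else 0)"
  "v < n \<Longrightarrow> i \<in> slots v \<Longrightarrow> ms (InPred i) = (if adj i \<in> pred v then 1 else 0)"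
  "v < n \<Longrightarrow> ms (NumPred v) = card (pred v)"
  using ms adj_mem by (auto simp: initialized_def agrees_on_input_def pred_def succ_def)

lemma jtri_read_bind:
  assumes "static l" "0 < w" "0 < d" "jtri (w - 1) (d - 1) \<sigma> (f (ms l)) Q"
  shows "jtri w d \<sigma> (read l \<bind> f) Q"
  unfolding bind_prog.simps
proof (rule tri_Read[OF assms(3)])
  fix m o' assume I: "jp_inv m (\<sigma> + o')"
  then have "m l = ms l" using assms(1) unfolding jp_inv_def by blast
  then show "\<exists>\<sigma>' w'. jp_inv m (\<sigma>' + o') \<and> True \<and> w' + credit (\<sigma>' + o') < w + credit (\<sigma> + o') \<and>
      jtri w' (d - 1) \<sigma>' (f (m l)) Q"
    using I assms(2,4) by (intro exI[of _ \<sigma>] exI[of _ "w - 1"]) auto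
qed

text \<open>An idealized memory that is compared with the real one on \<open>stable v\<close> only,
  so it may give every row the contents \<open>f\<close> and every vertex its final color.\<close>

definition view :: "(nat \<Rightarrow> nat) \<Rightarrow> loc mem" where
  "view f = (\<lambda>l. case l of Used w c \<Rightarrow> f c | Color u \<Rightarrow> col u | _ \<Rightarrow> ms l)"

definition stable :: "nat \<Rightarrow> loc set" where
  "stable v = {l. static l} \<union> range (Used v) \<union> Color ` pred v"

text \<open>
  While \<open>v\<close> is being colored, its marks are private and the colors of its predecessors are
  final, so this part of the computation can be verified in isolation.
\<close>

lemma jtri_local:
  assumes "stri \<Gamma> (stable v) (range (Used v)) (view f) (view g) w d {#} p Q2"
    and "\<And>x r c. Q2 x r \<Longrightarrow> f c \<noteq> g c \<Longrightarrow> Used v c \<in># r" "\<And>x r. Q2 x r \<Longrightarrow> P x"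
  shows "jtri w d {#Working v f#} p (\<lambda>x \<sigma>. \<sigma> = {#Working v g#} \<and> P x)"
proof -
  \<comment> \<open>Contents of the row at an intermediate moment, determined by the cells written
    so far.\<close>
  let ?f = "\<lambda>T c. if Used v c \<in># T then g c else f c"
  have "jtri (w + 0) d {#Working v f#} p (\<lambda>x \<sigma>. \<sigma> = {#Working v g#} \<and> P x)"
  proof (rule tri_nest[OF assms(1)[unfolded stri_def], where A = "\<lambda>T \<sigma>. \<sigma> = {#Working v (?f T)#}"])
    show "{#Working v f#} = {#Working v (?f {#})#}" by simp
    fix m o' \<sigma> T
    assume "\<sigma> = {#Working v (?f T)#}" and I: "jp_inv m (\<sigma> + o')"
    then have inv: "jp_inv m (add_mset (Working v (?f T)) o')" by simp
    have "m (Color u) = col u" if "u \<in> pred v" for u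
      using inv that unfolding jp_inv_def by auto
    moreover have "m (Used v c) = ?f T c" for c using inv unfolding jp_inv_def by auto
    moreover have "m l = ms l" if "static l" for l using inv that unfolding jp_inv_def by blast
    moreover have "view f l = ms l" "view g l = ms l" if "static l" for l
      using that by (cases l; simp add: view_def)+
    ultimately show "settled (stable v) (view f) (view g) m T"
      by (auto simp: settled_def stable_def view_def)
  next
    fix m m' o' T \<sigma> T'
    assume "\<sigma> = {#Working v (?f T)#}" "jp_inv m (\<sigma> + o')"
      and J: "settled (stable v) (view f) (view g) m' T'" and H: "only_writes (range (Used v)) m m'"
    then have inv: "jp_inv m (add_mset (Working v (?f T)) o')" and \<sigma>: "\<sigma> = {#Working v (?f T)#}" by auto
    have "m' (Used v c) = ?f T' c" for c
      using J by (auto simp: settled_def stable_def view_def)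
    from update_used[OF inv H this] show "\<exists>\<sigma>'. \<sigma>' = {#Working v (?f T')#} \<and> jp_inv m' (\<sigma>' + o') \<and>
        True \<and> credit (\<sigma>' + o') = credit (\<sigma> + o')" by (simp add: \<sigma>)
  next
    fix x T \<sigma> assume "{#} \<subseteq># T \<and> Q2 x T" "\<sigma> = {#Working v (?f T)#}"
    moreover from this have "?f T = g" using assms(2) by fastforce
    ultimately show "\<sigma> = {#Working v g#} \<and> P x" using assms(3) by auto
  qed
  then show ?thesis by simp
qed

section \<open>Coloring a single vertex\<close>

definition "cleared v f = (\<lambda>c. if 1 \<le> c \<and> c < card (pred v) + 2 then 0 else f c)"
definition "marked v f = (\<lambda>c. if 1 \<le> c \<and> c < card (pred v) + 2
  then if c \<in> col ` pred v then 1 else 0 else f c)"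

lemma clear_marks:
  "jtri (3 * (card (pred v) + 1)) (1 + 2 * clog (card (pred v) + 1)) {#Working v f#}
    (parfor 1 (card (pred v) + 2) (\<lambda>c. write (Used v c) 0))
    (\<lambda>x \<sigma>. \<sigma> = {#Working v (cleared v f)#} \<and> True)"
proof (rule jtri_local[OF stri_parfor[where w = "\<lambda>_. 1" and d = 1 and W = "\<lambda>c. {Used v c}"]])
  fix i assume "1 \<le> i" "i < card (pred v) + 2"
  then show "stri \<Gamma> (stable v) (range (Used v)) (view f) (view (cleared v f)) 1 1 {#}
      (write (Used v i) 0) (\<lambda>x r. {Used v i} \<subseteq> set_mset r)"
    by (auto intro!: stri_Write stri_Ret simp: view_def cleared_def)
qed (auto simp: cleared_def split: if_splits)

text \<open>Neighbours of equal color write the same value 1, which \<open>stri_Write\<close>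
  permits. Larger colors can be skipped, since the color sought is at most
  \<open>card (pred v) + 1\<close>.\<close>

lemma mark_colors:
  assumes v: "v < n"
  shows "jtri (6 * deg v) (4 + 2 * clog (deg v)) {#Working v (cleared v f)#}
    (parfor (off v) (off (Suc v)) (\<lambda>i. do {
       q \<leftarrow> read (InPred i);
       when (q = 1) (do {
         u \<leftarrow> read (Adj i);
         c \<leftarrow> read (Color u);
         when (c \<le> card (pred v) + 1) (write (Used v c) 1)
       })
     }))
    (\<lambda>x \<sigma>. \<sigma> = {#Working v (marked v f)#} \<and> True)"
    (is "tri _ _ _ _ _ _ _ (parfor _ _ ?body) _")
proof -
  let ?W = "\<lambda>i. if adj i \<in> pred v \<and> col (adj i) \<le> card (pred v) + 1 then {Used v (col (adj i))} else {}"
  let ?m0 = "view (cleared v f)"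
  let ?m1 = "view (marked v f)"
  have "stri \<Gamma> (stable v) (range (Used v)) ?m0 ?m1 4 4 {#} (?body i) (\<lambda>x r. ?W i \<subseteq> set_mset r)" if i: "i \<in> slots v" for i
  proof -
    have st: "InPred i \<in> stable v" "Adj i \<in> stable v" by (auto simp: stable_def)
    have val: "?m0 (InPred i) = (if adj i \<in> pred v then 1 else 0)"
      "?m1 (InPred i) = (if adj i \<in> pred v then 1 else 0)" "?m0 (Adj i) = adj i" "?m1 (Adj i) = adj i"
      "?m0 (Color u) = col u" "?m1 (Color u) = col u" for u
      using ms_static v i by (simp_all add: view_def)
    show ?thesis
    proof (cases "adj i \<in> pred v")
      case True
      have "Color (adj i) \<in> stable v" using True by (simp add: stable_def)
      moreover have "?m1 (Used v (col (adj i))) = 1" if "col (adj i) \<le> card (pred v) + 1"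
        using True that col_props(1)[of "adj i"] by (auto simp: view_def marked_def)
      ultimately show ?thesis
        using True st val
        by (cases "col (adj i) \<le> card (pred v) + 1") (auto intro!: stri_Read stri_Write stri_Ret)
    next
      case False
      then show ?thesis using st val by (auto intro!: stri_Read stri_Ret)
    qed
  qed
  then show ?thesis
  proof (intro jtri_local[OF stri_parfor[where w = "\<lambda>_. 4" and d = 4 and W = ?W]], goal_cases)
    case (1 i)
    then show ?case by simp
  next
    case (4 x r c)
    then obtain u where u: "u \<in> pred v" "c = col u" "c \<le> card (pred v) + 1"
      by (auto simp: cleared_def marked_def split: if_splits)
    have "u \<in> adj ` slots v"
      using u(1) unfolding bij_betw_imp_surj_on[OF adj_bij[OF v]] by (simp add: pred_def)
    then obtain i where "i \<in> slots v" "adj i = u" by blast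
    then show ?case using 4(2) u by fastforce
  qed (use off_Suc[OF v] in auto)
qed

text \<open>Used colors contribute \<open>card (pred v) + 1\<close>, which cannot spoil the minimum:
  \<open>col v\<close> is itself a candidate and never exceeds this value.\<close>

lemma find_color:
  "jtri (3 * (card (pred v) + 1)) (1 + 2 * clog (card (pred v) + 1)) {#Working v (marked v f)#}
    (reduce min (card (pred v) + 1) (\<lambda>c. do {
       x \<leftarrow> read (Used v c);
       Ret (if x = 0 then c else card (pred v) + 1)
     }) 1 (card (pred v) + 2))
    (\<lambda>x \<sigma>. \<sigma> = {#Working v (marked v f)#} \<and> x = col v)"
    (is "tri _ _ _ _ _ _ _ ?prog _")
proof -
  let ?p = "card (pred v)"
  let ?m = "view (marked v f)"
  define F where "F = (\<lambda>a b. Min (insert (?p + 1) {c. a \<le> c \<and> c < b \<and> marked v f c = 0}))"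
  have fin: "finite {c. a \<le> c \<and> c < b \<and> marked v f c = 0}" for a b
    by (rule finite_subset[of _ "{..<b}"]) auto
  have "F 1 (?p + 2) = col v"
    unfolding F_def
  proof (rule Min_eqI)
    have "col v \<notin> col ` pred v" using col_props(3) by blast
    then have "marked v f (col v) = 0"
      using col_props(1,2)[of v] by (simp add: marked_def)
    then show "col v \<in> insert (?p + 1) {c. 1 \<le> c \<and> c < ?p + 2 \<and> marked v f c = 0}"
      using col_props(1,2)[of v] by auto
    fix c assume "c \<in> insert (?p + 1) {c. 1 \<le> c \<and> c < ?p + 2 \<and> marked v f c = 0}"
    then show "col v \<le> c"
    proof
      assume "c \<in> {c. 1 \<le> c \<and> c < ?p + 2 \<and> marked v f c = 0}"
      then have "1 \<le> c \<and> c \<notin> col ` pred v" by (auto simp: marked_def split: if_splits)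
      then show ?thesis unfolding col_eq[of v] by (rule Least_le)
    qed (use col_props(2) in simp)
  qed (simp add: fin)
  moreover have "min (F a b) (F b c) = F a c" if "a < b" "b < c" for a b c
  proof -
    have "insert (?p + 1) {x. a \<le> x \<and> x < c \<and> marked v f x = 0} =
        insert (?p + 1) {x. a \<le> x \<and> x < b \<and> marked v f x = 0} \<union>
        insert (?p + 1) {x. b \<le> x \<and> x < c \<and> marked v f x = 0}" using that by auto
    then show ?thesis unfolding F_def by (subst \<open>insert _ _ = _\<close>, subst Min_Un) (auto simp: fin)
  qed
  moreover have "F i (Suc i) = (if marked v f i = 0 then i else ?p + 1)" if "i < ?p + 2" for i
  proof -
    have "{c. i \<le> c \<and> c < Suc i \<and> marked v f c = 0} = (if marked v f i = 0 then {i} else {})"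
      by (auto simp: less_Suc_eq_le dest: le_antisym)
    then show ?thesis using that by (auto simp: F_def)
  qed
  ultimately have "stri \<Gamma> (stable v) (range (Used v)) ?m ?m (3 * (?p + 1)) (1 + 2 * clog (?p + 1)) {#} ?prog (\<lambda>x r. x = col v \<and> (\<forall>i\<in>{1..<?p + 2}. {} \<subseteq> set_mset r))"
    by (intro stri_mono[OF stri_reduce[where w = "\<lambda>_. 1" and d = 1 and F = F and W = "\<lambda>_. {}"]])
      (auto intro!: stri_Read stri_Ret simp: stable_def view_def)
  then show ?thesis by (rule jtri_local) auto
qed

lemma write_color:
  assumes "0 < w" "0 < d" "jtri (w - 1) (d - 1) (add_mset (Colored v) (rights v)) p Q"
  shows "jtri w d {#Working v f#} (write (Color v) (col v) \<bind> (\<lambda>_. p)) Q"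
  unfolding bind_prog.simps
proof (rule tri_Write[OF assms(2)])
  fix m o' assume "jp_inv m ({#Working v f#} + o')"
  then have "jp_inv m (add_mset (Working v f) o')" by simp
  from finish_color[OF this] show "\<exists>\<sigma>' w'. jp_inv (m(Color v := col v)) (\<sigma>' + o') \<and> True \<and>
      w' + credit (\<sigma>' + o') < w + credit ({#Working v f#} + o') \<and> jtri w' (d - 1) \<sigma>' p Q"
    using assms by (intro exI[of _ "add_mset (Colored v) (rights v)"] exI[of _ "w - 1"]) auto
qed

text \<open>Describes a thread that has finished everything it started, nested calls included. The
  property is additive and so survives joins.\<close>

definition closed :: "token multiset \<Rightarrow> bool" where
  "closed T \<longleftrightarrow> (\<forall>v f. Working v f \<notin># T) \<and>
    (\<forall>v u. Colored v \<in># T \<longrightarrow> u \<in> succ v \<longrightarrow> HasDec v u \<in># T)"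

lemma closed_empty: "closed {#}"
  by (simp add: closed_def)

lemma closed_add: "closed r \<Longrightarrow> closed s \<Longrightarrow> closed (r + s)"
  by (auto simp: closed_def)

text \<open>Depth spent on one vertex outside the bodies of nested calls: four loops, each of depth
  twice \<open>clog\<close> of at most \<open>max_degree n E + 1\<close>, and 14 for straight-line
  code and loop bodies.\<close>

definition span :: nat where
  "span = 14 + 8 * clog (max_degree n E + 1)"

text \<open>Induction on \<open>h\<close>: a nested call goes to a successor, which has smaller
  height, and the calls of different slots run in parallel, so one \<open>span\<close> per unit of
  height accumulates. The missing unit of \<open>cost v\<close> has paid for the call node.\<close>

lemma color_vertex_correct:
  assumes "v < n"
  shows "jtri (cost v - 1) (span * Suc (h v)) {#Working v f#} (color_vertex v)
    (\<lambda>x \<sigma>. closed \<sigma> \<and> Colored v \<in># \<sigma>)"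
  using assms
proof (induction "h v" arbitrary: v f rule: less_induct)
  case (less v f)
  note v = less.prems
  let ?p = "card (pred v)"
  let ?slot = "\<lambda>i. do { s \<leftarrow> read (InSucc i); when (s = 1) (do {
      u \<leftarrow> read (Adj i); x \<leftarrow> dec_fetch (Count u); when (x = 0) (call (ColorVertex u)) }) } :: (loc, proc) prog"
  let ?c = "clog (max_degree n E + 1)"
  have deg: "deg v \<le> max_degree n E" using vertex_degree_le_max_degree[OF v] .
  have clogs: "clog (?p + 1) \<le> ?c" "clog (deg v) \<le> ?c"
    using card_pred_le[of v] deg by (auto intro!: clog_mono)
  \<comment> \<open>Three units of work suffice although a slot may color a whole vertex: the nested
    call is paid by the credits \<open>cost u\<close> released at the decrement.\<close>
  have slot: "jtri 3 (4 + span * h v) (if adj i \<in> succ v then {#MayDec v (adj i)#} else {#}) (?slot i) (\<lambda>x \<sigma>. \<exists>r. closed r \<and> \<sigma> = (if adj i \<in> succ v then {#HasDec v (adj i)#} else {#}) + r)"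
    if i: "i \<in> slots v" for i
  proof (cases "adj i \<in> succ v")
    case False
    then show ?thesis
      using ms_static(3)[OF v i] by (intro jtri_read_bind) (simp_all add: tri_Ret closed_def)
  next
    case True
    let ?u = "adj i"
    have u: "v \<in> pred ?u" using True by (simp add: pred_iff_succ)
    have un: "?u < n" and hu: "h ?u < h v" using pred_less[OF u] by auto
    have h_le: "span * Suc (h ?u) \<le> span * h v" using hu by (intro mult_le_mono2) simp
    have recc: "jtri (cost ?u) (1 + span * h v) {#Working ?u g, HasDec v ?u#}
        (call (ColorVertex ?u)) (\<lambda>x \<sigma>. \<exists>r. closed r \<and> \<sigma> = {#HasDec v ?u#} + r)" for g
    proof (rule tri_Call)
      have "jtri (cost ?u - 1) (span * Suc (h ?u)) ({#Working ?u g#} + {#HasDec v ?u#}) (color_vertex ?u)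
          (\<lambda>x \<sigma>. \<exists>\<sigma>0. \<sigma> = \<sigma>0 + {#HasDec v ?u#} \<and> closed \<sigma>0 \<and> Colored ?u \<in># \<sigma>0)"
        by (rule tri_frame) (rule less.hyps[OF hu un])
      moreover have "{#Working ?u g#} + {#HasDec v ?u#} = {#Working ?u g, HasDec v ?u#}" by simp
      moreover have "color_vertex ?u = \<Gamma> (ColorVertex ?u) \<bind> Ret" by simp
      ultimately have "jtri (cost ?u - 1) (span * Suc (h ?u)) {#Working ?u g, HasDec v ?u#}
          (\<Gamma> (ColorVertex ?u) \<bind> Ret)
          (\<lambda>x \<sigma>. \<exists>\<sigma>0. \<sigma> = \<sigma>0 + {#HasDec v ?u#} \<and> closed \<sigma>0 \<and> Colored ?u \<in># \<sigma>0)"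
        by (simp only:)
      then show "jtri (cost ?u - 1) (1 + span * h v - 1) {#Working ?u g, HasDec v ?u#}
          (\<Gamma> (ColorVertex ?u) \<bind> Ret) (\<lambda>x \<sigma>. \<exists>r. closed r \<and> \<sigma> = {#HasDec v ?u#} + r)"
        by (rule tri_mono) (use h_le in \<open>auto simp: add.commute\<close>)
    qed (simp_all add: cost_def)
    have "jtri 1 (2 + span * h v) {#MayDec v ?u#} (DecFetch (Count ?u) (\<lambda>x. when (x = 0) (call (ColorVertex ?u))))
        (\<lambda>x \<sigma>. \<exists>r. closed r \<and> \<sigma> = {#HasDec v ?u#} + r)"
    proof (rule tri_DecFetch)
      fix m o' assume "jp_inv m ({#MayDec v ?u#} + o')"
      then have inv: "jp_inv m (add_mset (MayDec v ?u) o')" by simp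
      show "\<exists>\<sigma>' w'. jp_inv (m(Count ?u := m (Count ?u) - 1)) (\<sigma>' + o') \<and> True \<and>
          w' + credit (\<sigma>' + o') < 1 + credit ({#MayDec v ?u#} + o') \<and>
          jtri w' (2 + span * h v - 1) \<sigma>' (when (m (Count ?u) - 1 = 0) (call (ColorVertex ?u)))
            (\<lambda>x \<sigma>. \<exists>r. closed r \<and> \<sigma> = {#HasDec v ?u#} + r)"
      proof (cases "m (Count ?u) - 1 = 0")
        case zero: True
        show ?thesis
          using decrement_zero[OF inv zero] zero recc[of "\<lambda>c. m (Used ?u c)"]
          by (intro exI[of _ "{#Working ?u (\<lambda>c. m (Used ?u c)), HasDec v ?u#}"] exI[of _ "cost ?u"]) auto
      next
        case pos: False
        show ?thesis
          using decrement_positive[OF inv pos] pos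
          by (intro exI[of _ "{#HasDec v ?u#}"] exI[of _ 0]) (auto intro!: tri_Ret simp: closed_def)
      qed
    qed simp
    then have "jtri 2 (3 + span * h v) {#MayDec v ?u#} (do {
         u \<leftarrow> read (Adj i);
         x \<leftarrow> dec_fetch (Count u);
         when (x = 0) (call (ColorVertex u))
       }) (\<lambda>x \<sigma>. \<exists>r. closed r \<and> \<sigma> = {#HasDec v ?u#} + r)"
      by (intro jtri_read_bind) (simp_all add: ms_static(2) cong del: if_weak_cong)
    then show ?thesis
      unfolding if_P[OF True] using ms_static(3)[OF v i] True
      by (intro jtri_read_bind) simp_all
  qed
  have slots: "jtri (5 * deg v) (4 + span * h v + 2 * ?c) (add_mset (Colored v) (rights v))
     (parfor (off v) (off (Suc v)) ?slot) (\<lambda>x \<sigma>. closed \<sigma> \<and> Colored v \<in># \<sigma>)"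
  proof -
    let ?H = "\<lambda>i. if adj i \<in> succ v then {#HasDec v (adj i)#} else {#}"
    have "jtri (\<Sum>i = off v..<off (Suc v). 3 + 2) (4 + span * h v + 2 * clog (off (Suc v) - off v))
      (\<Sum>i = off v..<off (Suc v). if adj i \<in> succ v then {#MayDec v (adj i)#} else {#})
      (parfor (off v) (off (Suc v)) ?slot) (\<lambda>x \<sigma>. \<exists>r. closed r \<and> \<sigma> = (\<Sum>i = off v..<off (Suc v). ?H i) + r)"
    proof (rule tri_reduce[where P = "\<lambda>a b x \<sigma>. \<exists>r. closed r \<and> \<sigma> = (\<Sum>i = a..<b. ?H i) + r"], goal_cases)
      case (2 i)
      then show ?case using slot[of i] by simp
    next
      case (3 a b c x y r s)
      then obtain r' s' where rs: "closed r'" "closed s'" "r = (\<Sum>i = a..<b. ?H i) + r'"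
        "s = (\<Sum>i = b..<c. ?H i) + s'" by blast
      have "(\<Sum>i = a..<b. ?H i) + (\<Sum>i = b..<c. ?H i) = (\<Sum>i = a..<c. ?H i)"
        using 3 by (intro sum.atLeastLessThan_concat) auto
      then have "r + s = (\<Sum>i = a..<c. ?H i) + (r' + s')"
        unfolding rs(3,4) by (metis (no_types, lifting) add.assoc add.left_commute)
      then show ?case using closed_add[OF rs(1,2)] by blast
    qed (auto simp: closed_def)
    moreover have "(\<Sum>i = off v..<off (Suc v). if adj i \<in> succ v then {#MayDec v (adj i)#} else {#}) = rights v"
      unfolding sum_slots[OF v, of "\<lambda>u. if u \<in> succ v then {#MayDec v u#} else {#}"] rights_def
      by (subst sum.inter_restrict[symmetric]) (auto simp: succ_def intro!: sum.cong)
    moreover have "(\<Sum>i = off v..<off (Suc v). ?H i) = (\<Sum>u\<in>succ v. {#HasDec v u#})"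
      unfolding sum_slots[OF v, of "\<lambda>u. if u \<in> succ v then {#HasDec v u#} else {#}"]
      by (subst sum.inter_restrict[symmetric]) (auto simp: succ_def intro!: sum.cong)
    ultimately have "jtri (\<Sum>i = off v..<off (Suc v). 3 + 2) (4 + span * h v + 2 * clog (off (Suc v) - off v))
      (rights v) (parfor (off v) (off (Suc v)) ?slot) (\<lambda>x \<sigma>. \<exists>r. closed r \<and> \<sigma> = (\<Sum>u\<in>succ v. {#HasDec v u#}) + r)"
      by (simp only:)
    from tri_frame[OF this, of "{#Colored v#}"] show ?thesis
      unfolding add_mset_add_single[of "Colored v", symmetric]
    proof (rule tri_mono)
      fix x \<sigma>
      assume "\<exists>\<sigma>0. \<sigma> = add_mset (Colored v) \<sigma>0 \<and> (\<exists>r. closed r \<and> \<sigma>0 = (\<Sum>u\<in>succ v. {#HasDec v u#}) + r)"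
      then obtain r where r: "closed r" "\<sigma> = add_mset (Colored v) ((\<Sum>u\<in>succ v. {#HasDec v u#}) + r)"
        by blast
      have mem: "t \<in># (\<Sum>u\<in>succ v. {#HasDec v u#}) \<longleftrightarrow> (\<exists>u\<in>succ v. t = HasDec v u)" for t
        by (simp add: set_mset_sum)
      show "closed \<sigma> \<and> Colored v \<in># \<sigma>" using r(1) unfolding r(2) closed_def by (auto simp: mem)
    qed (use off_Suc[OF v] clogs in simp_all)
  qed
  show ?case
    unfolding color_vertex_def
    apply (rule jtri_read_bind, simp, simp add: cost_def, simp add: span_def)+
    unfolding ms_static(1) ms_static(5)[OF v]
    apply (rule tri_bind[OF clear_marks, where ?w2.0 = "6 * deg v + 3 * (?p + 1) + 1 + 5 * deg v" and
        ?d2.0 = "10 + 6 * ?c + span * h v"])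
    subgoal
      apply (elim conjE, hypsubst)
      apply (rule tri_bind[OF mark_colors[OF v], where ?w2.0 = "3 * (?p + 1) + 1 + 5 * deg v" and
          ?d2.0 = "6 + 4 * ?c + span * h v"])
      subgoal
        apply (elim conjE, hypsubst)
        apply (rule tri_bind[OF find_color, where ?w2.0 = "1 + 5 * deg v" and
            ?d2.0 = "5 + 2 * ?c + span * h v"])
        subgoal
          apply (elim conjE, hypsubst)
          apply (rule write_color, simp, simp)
          using slots apply (simp add: add_ac)
          done
        using clogs by simp_all
      using clogs by simp_all
    using clogs card_pred_le[of v] by (simp_all add: cost_def span_def)
qed

lemma root_correct:
  assumes v: "v < n" and H: "h v \<le> H"
  shows "jtri 1 (2 + span * Suc H) {#Root v#} (do {
       p \<leftarrow> read (NumPred v);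
       when (p = 0) (call (ColorVertex v))
     }) (\<lambda>x \<sigma>. closed \<sigma> \<and> (pred v = {} \<longrightarrow> Colored v \<in># \<sigma>))"
proof (cases "pred v = {}")
  case False
  then have "card (pred v) \<noteq> 0" by simp
  then show ?thesis
    using ms_static(5)[OF v] False by (intro jtri_read_bind) (auto simp: closed_def intro!: tri_Ret)
next
  case True
  have call: "jtri (cost v) (1 + span * Suc H) {#Working v f#} (call (ColorVertex v))
      (\<lambda>x \<sigma>. closed \<sigma> \<and> (pred v = {} \<longrightarrow> Colored v \<in># \<sigma>))" for f
  proof (rule tri_Call)
    have "span * Suc (h v) \<le> 1 + span * Suc H - 1" using H by (simp add: mult_le_mono2)
    moreover have "color_vertex v = \<Gamma> (ColorVertex v) \<bind> Ret" by simp
    ultimately show "jtri (cost v - 1) (1 + span * Suc H - 1) {#Working v f#} (\<Gamma> (ColorVertex v) \<bind> Ret)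
        (\<lambda>x \<sigma>. closed \<sigma> \<and> (pred v = {} \<longrightarrow> Colored v \<in># \<sigma>))"
      using tri_mono[OF color_vertex_correct[OF v]] by (metis (no_types, lifting) le_refl)
  qed (simp_all add: cost_def)
  show ?thesis
    unfolding bind_prog.simps
  \<comment> \<open>The general read rule is needed because the tokens change here:
    \<open>Root v\<close> is exchanged for \<open>Working v\<close>, and the released credits pay
    for the call.\<close>
  proof (rule tri_Read)
    fix m o' assume "jp_inv m ({#Root v#} + o')"
    then have inv: "jp_inv m (add_mset (Root v) o')" by simp
    have "m (NumPred v) = 0"
      using inv ms_static(5)[OF v] True unfolding jp_inv_def by simp
    then show "\<exists>\<sigma>' w'. jp_inv m (\<sigma>' + o') \<and> True \<and> w' + credit (\<sigma>' + o') < 1 + credit ({#Root v#} + o') \<and>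
        jtri w' (2 + span * Suc H - 1) \<sigma>' (when (m (NumPred v) = 0) (call (ColorVertex v)))
          (\<lambda>x \<sigma>. closed \<sigma> \<and> (pred v = {} \<longrightarrow> Colored v \<in># \<sigma>))"
      using start_root[OF inv True v] call[of "\<lambda>c. m (Used v c)"]
      by (intro exI[of _ "{#Working v (\<lambda>c. m (Used v c))#}"] exI[of _ "cost v"]) auto
  qed simp
qed

section \<open>The start loop and the final coloring\<close>

definition roots :: "token multiset" where
  "roots = (\<Sum>v = 0..<n. {#Root v#})"

lemma count_roots: "count roots t = (case t of Root v \<Rightarrow> if v < n then 1 else 0 | _ \<Rightarrow> 0)"
  by (cases t) (auto simp: roots_def count_sum if_distrib sum.If_cases)

lemma active_roots [simp]: "active v roots = 0"
  unfolding active_eq_0 by (auto simp: count_roots simp flip: count_greater_zero_iff)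

lemma jp_inv_roots: "jp_inv ms roots"
proof -
  have no: "HasDec v u \<notin># roots" "MayDec v u \<notin># roots" "Colored v \<notin># roots" "Working v f \<notin># roots"
    for v u f
    by (simp_all add: count_roots flip: count_eq_zero_iff)
  have "\<forall>v<n. ms (Count v) = card (pred v)" using ms by (simp add: initialized_def)
  then show ?thesis unfolding jp_inv_def by (auto simp: no count_roots)
qed

text \<open>Induction in priority order: the predecessors are colored and by \<open>closed\<close>
  have decremented, so the invariant makes \<open>v\<close> active, and \<open>closed\<close>
  excludes that it is still being worked on.\<close>

lemma all_colored:
  assumes "jp_inv m \<sigma>" "closed \<sigma>" "\<And>v. v < n \<Longrightarrow> pred v = {} \<Longrightarrow> Colored v \<in># \<sigma>"
  shows "v < n \<Longrightarrow> Colored v \<in># \<sigma>"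
proof (induction v rule: wf_induct_rule[OF wf_pred])
  case (1 v)
  show ?case
  proof (cases "pred v = {}")
    case False
    have "HasDec u v \<in># \<sigma>" if "u \<in> pred v" for u
      using 1 that pred_less[OF that] assms(2) by (auto simp: closed_def pred_iff_succ)
    then have "active v \<sigma> \<noteq> 0" using assms(1) False 1(2) unfolding jp_inv_def by blast
    then show ?thesis using assms(2) by (auto simp: active_eq_0 closed_def)
  qed (use assms(3) 1 in blast)
qed

lemma colored_value: "jp_inv m \<sigma> \<Longrightarrow> Colored v \<in># \<sigma> \<Longrightarrow> m (Color v) = col v"
  by (simp add: jp_inv_def)

text \<open>All budgets are deposited in the invariant before the loop: \<open>credit roots\<close>
  is the sum of all \<open>cost v\<close>, linear in \<open>n + card E\<close>.\<close>

lemma jp_loop_correct: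
  assumes H: "\<And>v. v < n \<Longrightarrow> h v \<le> H"
  shows "htri \<Gamma> (14 * n + 34 * card E) (2 + span * Suc H + 2 * clog n) ms
    (parfor 0 n (\<lambda>v. do { p \<leftarrow> read (NumPred v); when (p = 0) (call (ColorVertex v)) }))
    (\<lambda>_ m. proper_coloring n E (\<lambda>v. m (Color v)))" (is "htri _ _ _ _ ?prog ?Q")
proof -
  have "jtri (\<Sum>v = 0..<n. 1 + 2) (2 + span * Suc H + 2 * clog (n - 0)) (\<Sum>v = 0..<n. {#Root v#}) ?prog
    (\<lambda>x \<sigma>. closed \<sigma> \<and> (\<forall>v\<in>{0..<n}. pred v = {} \<longrightarrow> Colored v \<in># \<sigma>))"
  proof (rule tri_reduce[where P = "\<lambda>a b x \<sigma>. closed \<sigma> \<and> (\<forall>v\<in>{a..<b}. pred v = {} \<longrightarrow> Colored v \<in># \<sigma>)"],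
      goal_cases)
    case (2 v)
    then show ?case by (intro tri_mono[OF root_correct[of v H]] H) (auto simp: less_Suc_eq_le)
  next
    case (3 a b c x y r s)
    then show ?case using closed_add[of r s] by (force simp: not_less)
  next
    case 4
    then have empty: "{0..<n} = {}" by simp
    show ?case unfolding empty using closed_empty by simp
  qed simp
  then have main: "jtri (\<Sum>v = 0..<n. 1 + 2) (2 + span * Suc H + 2 * clog n) roots ?prog
    (\<lambda>x \<sigma>. closed \<sigma> \<and> (\<forall>v\<in>{0..<n}. pred v = {} \<longrightarrow> Colored v \<in># \<sigma>))"
    unfolding roots_def by simp
  have loop: "htri \<Gamma> ((\<Sum>v = 0..<n. 1 + 2) + credit roots) (2 + span * Suc H + 2 * clog n) ms ?prog ?Q"
  proof (rule htri_nest[OF main])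
    show "jp_inv ms roots" by (rule jp_inv_roots)
  next
    fix x \<sigma> m
    assume fin: "closed \<sigma> \<and> (\<forall>v\<in>{0..<n}. pred v = {} \<longrightarrow> Colored v \<in># \<sigma>)" and inv: "jp_inv m \<sigma>"
    have "m (Color v) = col v" if "v < n" for v
    proof -
      have "Colored v \<in># \<sigma>" by (rule all_colored[OF inv _ _ that]) (use fin in auto)
      then show ?thesis by (rule colored_value[OF inv])
    qed
    then show "proper_coloring n E (\<lambda>v. m (Color v))"
      using proper_col by (simp add: proper_coloring_def)
  qed
  have "credit roots \<le> 11 * n + 34 * card E"
  proof -
    have "credit roots = 11 * n + 17 * (\<Sum>v<n. deg v)"
      by (simp add: credit_def cost_def sum.distrib sum_distrib_left)
    then show ?thesis using sum_vertex_degree_le[OF graph] by simp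
  qed
  then show ?thesis by (intro htri_mono[OF loop]) auto
qed

end

context jp_input
begin

text \<open>The same number as \<open>span\<close>, stated where the initialized memory is not yet
  fixed.\<close>

definition color_span :: nat where
  "color_span = 14 + 8 * clog (max_degree n E + 1)"

lemma jp_correct:
  assumes "agrees_on_input n m0 m" "\<forall>v<n. m (AdgPrio v) = level \<epsilon> n E v" "\<And>v. v < n \<Longrightarrow> h v \<le> H"
  shows "htri \<Gamma> (20 * n + 60 * card E) (17 + 6 * clog n + color_span * Suc H) m (jp n)
    (\<lambda>_ m. proper_coloring n E (\<lambda>v. m (Color v)))"
  unfolding jp_def
proof (rule htri_bind[OF jp_init_correct[OF assms(1,2)],
      where ?w2.0 = "14 * n + 34 * card E" and ?d2.0 = "2 + color_span * Suc H + 2 * clog n"])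
  fix x m' assume "initialized m'"
  then interpret jp_run \<epsilon> n E m0 \<pi> h m' by unfold_locales
  show "htri \<Gamma> (14 * n + 34 * card E) (2 + color_span * Suc H + 2 * clog n) m'
    (parfor 0 n (\<lambda>v. do { p \<leftarrow> read (NumPred v); when (p = 0) (call (ColorVertex v)) }))
    (\<lambda>_ m. proper_coloring n E (\<lambda>v. m (Color v)))"
    using jp_loop_correct[OF assms(3)] by (simp only: span_def color_span_def)
qed simp_all

lemma jp_adg_correct:
  assumes "\<And>v. v < n \<Longrightarrow> h v \<le> H"
  shows "htri \<Gamma> ((27 + 40 * survival_factor) * n + 70 * card E + 1)
    (23 + 8 * clog n + rounds \<epsilon> n * (24 + 18 * clog n) + color_span * Suc H) m0 (jp_adg n)
    (\<lambda>_ m. proper_coloring n E (\<lambda>v. m (Color v)))"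
  unfolding jp_adg_def
proof (rule htri_bind[OF adg_correct])
  fix x m' assume "agrees_on_input n m0 m' \<and> (\<forall>v<n. m' (AdgPrio v) = level \<epsilon> n E v)"
  then show "htri \<Gamma> (20 * n + 60 * card E) (17 + 6 * clog n + color_span * Suc H) m' (jp n)
    (\<lambda>_ m. proper_coloring n E (\<lambda>v. m (Color v)))"
    using assms by (intro jp_correct) auto
qed (simp_all add: agrees_on_input_def algebra_simps)

end

section \<open>Bounds for JP-ADG\<close>

text \<open>Every \<open>K\<close> gives a valid depth bound for this \<open>\<pi>\<close>; the
  choice is left to the expectation. The work exceeds the number of steps by 1, the start
  node.\<close>

lemma reaches_bounds:
  assumes "0 < \<epsilon>" "simple_graph n E" "\<pi> permutes {..<n}" "jp_adg_reaches \<epsilon> n E \<pi> s"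
  shows "work (dag_of s) \<le> (27 + 40 * nat \<lceil>(1 + \<epsilon>) / \<epsilon>\<rceil>) * n + 70 * card E + 2"
    "depth (dag_of s) \<le> 23 + 8 * clog n + rounds \<epsilon> n * (24 + 18 * clog n) +
      (14 + 8 * clog (max_degree n E + 1)) * Suc (height_bound \<epsilon> n E K \<pi>)"
    "terminated (procs \<epsilon>) s \<Longrightarrow> proper_coloring n E (\<lambda>v. memory s (Color v))"
proof -
  let ?\<Gamma> = "procs \<epsilon>"
  let ?H = "height_bound \<epsilon> n E K \<pi>"
  obtain m0 where m0: "csr n E m0" "\<forall>v<n. m0 (RandPrio v) = \<pi> v"
    "(step ?\<Gamma>)\<^sup>*\<^sup>* (initial (jp_adg n) m0) s"
    using assms(4) unfolding jp_adg_reaches_def by blast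
  obtain h where h: "\<forall>u v. {u, v} \<in> E \<longrightarrow> level \<epsilon> n E u < level \<epsilon> n E v \<or>
        level \<epsilon> n E u = level \<epsilon> n E v \<and> \<pi> u < \<pi> v \<longrightarrow> h u < h v" "\<forall>v<n. h v \<le> ?H"
    using height_exists[OF assms(1,2)] by blast
  interpret jp_input \<epsilon> n E m0 \<pi> h
    using assms m0 h by unfold_locales blast+
  obtain t m g where s: "s = (t, m, g)" by (cases s)
  from steps_imp_csteps[OF m0(3)[unfolded s]] obtain f k where f: "fst g = Suc k"
    "(cstep ?\<Gamma> ^^ k) (Run 0 (jp_adg n), m0) (relabel f t, m)"
    "\<forall>(a, b)\<in>snd g. a < fst g \<and> b < fst g \<and> f a < f b"
    "\<forall>a<fst g. \<exists>k t' m'. (cstep ?\<Gamma> ^^ k) (Run 0 (jp_adg n), m0) (t', m') \<and> f a \<le> max_label t'"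
    by blast
  note sound = htri_sound[OF jp_adg_correct[of ?H]]
  show "work (dag_of s) \<le> (27 + 40 * nat \<lceil>(1 + \<epsilon>) / \<epsilon>\<rceil>) * n + 70 * card E + 2"
    using sound[OF _ f(2)] h(2) f(1) by (simp add: work_def dag_of_def s survival_factor_def)
  show "depth (dag_of s) \<le> 23 + 8 * clog n + rounds \<epsilon> n * (24 + 18 * clog n) +
      (14 + 8 * clog (max_degree n E + 1)) * Suc ?H"
  proof (rule depth_le[where f = f])
    show "0 < fst (dag_of s)" using f(1) by (simp add: dag_of_def s)
    show "\<forall>(a, b)\<in>snd (dag_of s). f a < f b" using f(3) by (auto simp: dag_of_def s)
    fix a assume "a < fst (dag_of s)"
    then obtain k t' m' where c: "(cstep ?\<Gamma> ^^ k) (Run 0 (jp_adg n), m0) (t', m')"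
      and le: "f a \<le> max_label t'"
      using f(4) by (auto simp: dag_of_def s)
    have "max_label t' \<le> 0 + (23 + 8 * clog n + rounds \<epsilon> n * (24 + 18 * clog n) + color_span * Suc ?H)"
      using sound[OF _ c] h(2) by blast
    then show "f a \<le> 23 + 8 * clog n + rounds \<epsilon> n * (24 + 18 * clog n) +
      (14 + 8 * clog (max_degree n E + 1)) * Suc ?H"
      using le unfolding color_span_def by linarith
  qed
  assume "terminated ?\<Gamma> s"
  then obtain a x where "t = Run a (Ret x)"
    using not_terminal_imp_step[of t ?\<Gamma> m g] unfolding terminated_def s by blast
  then have "relabel f t = Run (f a) (Ret x)" by simp
  then show "proper_coloring n E (\<lambda>v. memory s (Color v))"
    using sound[OF _ f(2)] h(2) by (simp add: memory_def s)
qed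

text \<open>The factor 4 arises from \<open>ln 2 \<ge> 1 / 2\<close> and from bounding
  \<open>ln 2\<close> and \<open>ln k\<close> by \<open>pos1 (ln k)\<close> each.\<close>

lemma clog_le_ln: "real (clog (Suc k)) \<le> 4 * pos1 (ln k)"
proof (cases "k = 0")
  case True
  then show ?thesis by (simp add: clog.simps pos1_def)
next
  case False
  then have "(2 :: nat) ^ clog (Suc k) \<le> 2 * k" using clog_le[of "Suc k"] by simp
  then have "(2 :: real) ^ clog (Suc k) \<le> 2 * real k"
    by (metis of_nat_le_iff of_nat_mult of_nat_numeral of_nat_power)
  then have "ln (2 ^ clog (Suc k)) \<le> ln (2 * real k)" using False by (intro ln_mono) auto
  then have "real (clog (Suc k)) * ln 2 \<le> ln 2 + ln k" using False by (simp add: ln_realpow ln_mult)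
  moreover have "real (clog (Suc k)) * (1 / 2) \<le> real (clog (Suc k)) * ln 2"
    using ln_ge_iff[of 2 "1 / 2"] exp_half_le2 by (intro mult_left_mono) auto
  moreover have "ln 2 \<le> (1 :: real)" using ln_le_minus_one[of "2 :: real"] by simp
  moreover have "1 \<le> pos1 (ln k)" "ln k \<le> pos1 (ln k)" by simp_all
  ultimately show ?thesis by linarith
qed

theorem theorem1:
  fixes \<epsilon> :: real
  assumes "\<epsilon> > 0"
  shows "\<exists>C>0. \<forall>n E. simple_graph n E \<longrightarrow>
    (\<forall>\<pi> s. \<pi> permutes {..<n} \<and> jp_adg_finishes \<epsilon> n E \<pi> s \<longrightarrow>
      proper_coloring n E (\<lambda>v. memory s (Color v))) \<and>
    (\<forall>\<pi> s. \<pi> permutes {..<n} \<and> jp_adg_reaches \<epsilon> n E \<pi> s \<longrightarrow>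
      real (work (dag_of s)) \<le> C * pos1 (real (n + card E))) \<and>
    (\<forall>sched. (\<forall>\<pi>. \<pi> permutes {..<n} \<longrightarrow> jp_adg_reaches \<epsilon> n E \<pi> (sched \<pi>)) \<longrightarrow>
      measure_pmf.expectation (random_order n) (\<lambda>\<pi>. real (depth (dag_of (sched \<pi>))))
        \<le> C * jp_adg_depth_bound n (max_degree n E) (degeneracy n E))"
proof -
  obtain C1 where C1: "0 < C1" and height: "\<And>n E. simple_graph n E \<Longrightarrow> \<exists>K.
      measure_pmf.expectation (random_order n) (\<lambda>\<pi>. real (height_bound \<epsilon> n E K \<pi>)) \<le>
        C1 * (pos1 (ln n) * (pos1 (degeneracy n E) +
          pos1 (ln (degeneracy n E)) * pos1 (ln n) / pos1 (ln (ln n))))"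
    using expectation_height_bound[OF assms] by blast
  define F where "F = nat \<lceil>(1 + \<epsilon>) / \<epsilon>\<rceil>"
  define C2 where "C2 = 3 + 1 / ln (1 + \<epsilon>)"
  \<comment> \<open>With \<open>clog\<close> at most 4 times the truncated logarithm, the constants
    are \<open>99 = 27 + 70 + 2\<close>, \<open>55 = 23 + 8 * 4\<close>,
    \<open>96 = 24 + 18 * 4\<close> and \<open>46 = 14 + 8 * 4\<close>.\<close>
  define Cw where "Cw = 99 + 40 * real F"
  define A where "A = 55 + 96 * C2"
  define Cd where "Cd = A + 46 * (C1 + 1)"
  have C2: "0 < C2" using assms by (simp add: C2_def add_pos_nonneg)
  have pos: "0 < Cw" "0 < A" "0 < Cd" using C1 C2 by (simp_all add: Cw_def A_def Cd_def add_pos_pos)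
  have work: "real (work (dag_of s)) \<le> (Cw + Cd) * pos1 (real (n + card E))"
    if "simple_graph n E" "\<pi> permutes {..<n}" "jp_adg_reaches \<epsilon> n E \<pi> s" for n E \<pi> s
  proof -
    let ?P = "pos1 (real (n + card E))"
    have "real (work (dag_of s)) \<le> real ((27 + 40 * F) * n + 70 * card E + 2)"
      unfolding F_def using reaches_bounds(1)[OF assms that] by (rule of_nat_mono)
    also have "\<dots> = (27 + 40 * real F) * real n + 70 * real (card E) + 2" by simp
    also have "\<dots> \<le> (27 + 40 * real F) * ?P + 70 * ?P + 2 * ?P"
      by (intro add_mono mult_left_mono) (auto simp: pos1_def)
    also have "\<dots> = Cw * ?P" by (simp add: Cw_def algebra_simps)
    also have "\<dots> \<le> (Cw + Cd) * ?P"
      using pos by (intro mult_right_mono) (auto intro: order.trans[OF _ pos1_ge_1])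
    finally show ?thesis .
  qed
  have depth: "measure_pmf.expectation (random_order n) (\<lambda>\<pi>. real (depth (dag_of (sched \<pi>))))
      \<le> (Cw + Cd) * jp_adg_depth_bound n (max_degree n E) (degeneracy n E)"
    if G: "simple_graph n E"
      and sched: "\<forall>\<pi>. \<pi> permutes {..<n} \<longrightarrow> jp_adg_reaches \<epsilon> n E \<pi> (sched \<pi>)" for n E sched
  proof -
    define L where "L = pos1 (ln n)"
    define M where "M = pos1 (ln (max_degree n E))"
    define X where "X = pos1 (degeneracy n E) +
      pos1 (ln (degeneracy n E)) * pos1 (ln n) / pos1 (ln (ln n))"
    obtain K where K: "measure_pmf.expectation (random_order n) (\<lambda>\<pi>. real (height_bound \<epsilon> n E K \<pi>))
        \<le> C1 * (L * X)"
      using height[OF G] unfolding L_def X_def by blast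
    let ?H = "\<lambda>\<pi>. real (height_bound \<epsilon> n E K \<pi>)"
    have p1: "0 < pos1 z" "0 \<le> pos1 z" for z using pos1_ge_1[of z] by linarith+
    have L: "1 \<le> L" and M: "1 \<le> M" by (simp_all add: L_def M_def)
    have "0 \<le> pos1 (ln (degeneracy n E)) * pos1 (ln n) / pos1 (ln (ln n))"
      by (intro divide_nonneg_nonneg mult_nonneg_nonneg p1)
    then have X: "1 \<le> X" unfolding X_def using pos1_ge_1[of "degeneracy n E"] by linarith
    have "L * 1 \<le> L * L" using L by (intro mult_left_mono) auto
    then have LL: "L \<le> L\<^sup>2" "1 \<le> L\<^sup>2" unfolding power2_eq_square using L by linarith+
    have LX: "1 \<le> L * X" using mult_mono[of 1 L 1 X] L X by simp
    have MLX: "1 \<le> M * (L * X)" using mult_mono[of 1 M 1 "L * X"] M LX by simp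
    have "clog n \<le> clog (Suc n)" by (rule clog_mono) simp
    then have cn: "real (clog n) \<le> 4 * L" using clog_le_ln[of n] unfolding L_def by linarith
    have cM: "real (clog (max_degree n E + 1)) \<le> 4 * M" using clog_le_ln unfolding M_def by simp
    have rd: "real (rounds \<epsilon> n) \<le> C2 * L" using rounds_le[OF assms, of n] unfolding C2_def L_def by simp
    \<comment> \<open>This holds for each order separately and for whatever schedule
      \<open>sched\<close> picks for it, so averaging needs no independence.\<close>
    have each: "real (depth (dag_of (sched \<pi>))) \<le> A * L\<^sup>2 + 46 * M * (?H \<pi> + 1)"
      if perm: "\<pi> permutes {..<n}" for \<pi>
    proof -
      have "real (depth (dag_of (sched \<pi>))) \<le>
          real (23 + 8 * clog n + rounds \<epsilon> n * (24 + 18 * clog n) +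
            (14 + 8 * clog (max_degree n E + 1)) * Suc (height_bound \<epsilon> n E K \<pi>))"
        using reaches_bounds(2)[OF assms G perm] sched perm by (intro of_nat_mono) blast
      also have "\<dots> = 23 + 8 * real (clog n) + real (rounds \<epsilon> n) * (24 + 18 * real (clog n)) +
            (14 + 8 * real (clog (max_degree n E + 1))) * (?H \<pi> + 1)"
        by (simp add: algebra_simps)
      also have "\<dots> \<le> 23 * L\<^sup>2 + 32 * L\<^sup>2 + (C2 * L) * (96 * L) + (46 * M) * (?H \<pi> + 1)"
      proof -
        have "real (rounds \<epsilon> n) * (24 + 18 * real (clog n)) \<le> (C2 * L) * (96 * L)"
          by (rule mult_mono) (use rd cn C2 L in auto)
        moreover have "(14 + 8 * real (clog (max_degree n E + 1))) * (?H \<pi> + 1) \<le> (46 * M) * (?H \<pi> + 1)"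
          by (rule mult_right_mono) (use cM M in auto)
        ultimately show ?thesis using cn LL by linarith
      qed
      also have "\<dots> = A * L\<^sup>2 + 46 * M * (?H \<pi> + 1)"
        by (simp add: A_def algebra_simps power2_eq_square)
      finally show ?thesis .
    qed
    have "(\<Sum>\<pi> | \<pi> permutes {..<n}. real (depth (dag_of (sched \<pi>)))) \<le>
        (\<Sum>\<pi> | \<pi> permutes {..<n}. A * L\<^sup>2 + 46 * M * (?H \<pi> + 1))"
      by (rule sum_mono) (use each in simp)
    also have "\<dots> = fact n * (A * L\<^sup>2 + 46 * M) + 46 * M * (\<Sum>\<pi> | \<pi> permutes {..<n}. ?H \<pi>)"
      by (simp add: sum.distrib card_permutations sum_distrib_left algebra_simps)
    finally have "measure_pmf.expectation (random_order n) (\<lambda>\<pi>. real (depth (dag_of (sched \<pi>)))) \<le>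
        A * L\<^sup>2 + 46 * M + 46 * M * measure_pmf.expectation (random_order n) ?H"
      unfolding expectation_random_order by (simp add: field_simps)
    also have "\<dots> \<le> A * L\<^sup>2 + 46 * M * (L * X) + 46 * M * (C1 * (L * X))"
    proof -
      have "46 * M * 1 \<le> 46 * M * (L * X)" by (rule mult_left_mono[OF LX]) (use M in simp)
      moreover have "46 * M * measure_pmf.expectation (random_order n) ?H \<le> 46 * M * (C1 * (L * X))"
        by (rule mult_left_mono[OF K]) (use M in simp)
      ultimately show ?thesis by linarith
    qed
    also have "\<dots> = A * L\<^sup>2 + 46 * (C1 + 1) * (M * (L * X))" by (simp add: algebra_simps)
    also have "\<dots> \<le> (Cw + Cd) * L\<^sup>2 + (Cw + Cd) * (M * (L * X))"
    proof (rule add_mono)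
      show "A * L\<^sup>2 \<le> (Cw + Cd) * L\<^sup>2"
        by (rule mult_right_mono) (use pos C1 in \<open>simp_all add: Cd_def\<close>)
      show "46 * (C1 + 1) * (M * (L * X)) \<le> (Cw + Cd) * (M * (L * X))"
        by (rule mult_right_mono) (use pos MLX in \<open>simp_all add: Cd_def\<close>)
    qed
    also have "\<dots> = (Cw + Cd) * (L\<^sup>2 + M * (L * X))" by (simp add: algebra_simps)
    also have "L\<^sup>2 + M * (L * X) = jp_adg_depth_bound n (max_degree n E) (degeneracy n E)"
      by (simp add: jp_adg_depth_bound_def L_def M_def X_def algebra_simps power2_eq_square)
    finally show ?thesis .
  qed
  show ?thesis
  proof (intro exI[of _ "Cw + Cd"] conjI allI impI)
    show "0 < Cw + Cd" using pos by simp
  next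
    fix n E \<pi> s
    assume "simple_graph n E" "\<pi> permutes {..<n} \<and> jp_adg_finishes \<epsilon> n E \<pi> s"
    then show "proper_coloring n E (\<lambda>v. memory s (Color v))"
      using reaches_bounds(3)[OF assms] unfolding jp_adg_finishes_def by blast
  qed (use work depth in blast)+
qed

end
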